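(* For all integers $N\ge 1$, $p\ge 2$, and all Borel sets $B\subset\mathbb R$, $$\mathbb E[\mathrm{Crt}_N(B)] = 2N\sqrt{\frac 2p}\,(p-1)^{\frac N2}\int_{\sqrt{\frac{p}{2(p-1)}}\,B}\exp\Big\{-\frac{N(p-2)x^2}{2p}\Big\}\,\rho_N(x)\,\mathrm dx.$$
   Context: Let $S^{N-1}(\sqrt N)\subset\mathbb R^N$ be the Euclidean sphere of radius $\sqrt N$ centered at $0$. The Hamiltonian of the $p$-spin spherical spin glass is the random function on $S^{N-1}(\sqrt N)$ $$H_{N,p}(\boldsymbol\sigma)=\frac{1}{N^{(p-1)/2}}\sum_{i_1,\dots,i_p=1}^N J_{i_1,\dots,i_p}\,\sigma_{i_1}\cdots\sigma_{i_p},$$ where the $J_{i_1,\dots,i_p}$ are independent standard Gaussian random variables. For a Borel set $B\subset\mathbb R$, $\mathrm{Crt}_N(B)$ is the (random) number of points $\boldsymbol\sigma\in S^{N-1}(\sqrt N)$ with $\nabla H_{N,p}(\boldsymbol\sigma)=0$ and $H_{N,p}(\boldsymbol\sigma)\in NB=\{Nx:x\in B\}$, where $\nabla$ is the gradient on the sphere. (For $N=1$ both points of the sphere count as critical points.) GOE: let $M^N$ be the $N\times N$ real symmetric random matrix whose entries $(M_{ij})_{i\le j}$ are independent centered Gaussians with $\mathbb E M_{ij}^2=\frac{1+\delta_{ij}}{2N}$, with eigenvalues $\lambda_0^N\le\dots\le\lambda^N_{N-1}$. $\rho_N$ is the density of the mean empirical spectral measure, i.e. $\int_{\mathbb R} f(x)\rho_N(x)\,\mathrm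 dx=\frac1N\mathbb E\big[\sum_{i=0}^{N-1}f(\lambda_i^N)\big]$ for bounded measurable $f$. For $c>0$, $cB=\{cx:x\in B\}$. *)

theory Defs
  imports "HOL-Probability.Probability" "Jordan_Normal_Form.Char_Poly"
begin

no_notation Matrix.vec_index (infixl "$" 100)
no_notation Matrix.scalar_prod (infix "\<bullet>" 70)

text \<open>The space \<open>\<real>\<^sup>N\<close> is \<open>real ^ 'n\<close> with \<open>N = CARD('n)\<close>. A multi-index \<open>(i\<^sub>1, \<dots>, i\<^sub>p)\<close> is a list
  of length \<open>p\<close> over \<open>'n\<close>.\<close>

definition pspin_hamiltonian :: "nat \<Rightarrow> ('n::finite list \<Rightarrow> real) \<Rightarrow> real ^ 'n \<Rightarrow> real" where
  "pspin_hamiltonian p J \<sigma> =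
     1 / real CARD('n) powr ((real p - 1) / 2) *
       (\<Sum>i | length i = p. J i * (\<Prod>k<p. \<sigma> $ (i ! k)))"

text \<open>The gradient of \<open>f\<close>, restricted to the sphere centred at 0 through \<open>x\<close>: the tangent vector at
  \<open>x\<close> that represents the derivative of \<open>f\<close> within the sphere. In dimension 1 the sphere is discrete
  and tangency alone makes the gradient 0.\<close>

definition sphere_gradient :: "('a::euclidean_space \<Rightarrow> real) \<Rightarrow> 'a \<Rightarrow> 'a" where
  "sphere_gradient f x =
     (THE g. g \<bullet> x = 0 \<and> (f has_derivative (\<lambda>h. g \<bullet> h)) (at x within sphere 0 (norm x)))"

lemma sphere_gradient_unique:
  fixes f :: "'a::euclidean_space \<Rightarrow> real"
  assumes "x \<noteq> 0"
    and a: "a \<bullet> x = 0" "(f has_derivative (\<lambda>h. a \<bullet> h)) (at x within sphere 0 (norm x))"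
    and b: "b \<bullet> x = 0" "(f has_derivative (\<lambda>h. b \<bullet> h)) (at x within sphere 0 (norm x))"
  shows "a = b"
proof (rule ccontr)
  assume "a \<noteq> b"
  define d where "d = a - b"
  define u where "u = (norm x / norm d) *\<^sub>R d"
  have d: "d \<noteq> 0" "d \<bullet> x = 0"
    using \<open>a \<noteq> b\<close> a(1) b(1) by (auto simp: d_def inner_diff_left)
  have u: "norm u = norm x" "u \<bullet> x = 0"
    using d by (simp_all add: u_def)
  define c where "c = (\<lambda>t::real. cos t *\<^sub>R x + sin t *\<^sub>R u)"
  have c0: "c 0 = x" by (simp add: c_def)
  have "(norm (c t))\<^sup>2 = (norm x)\<^sup>2" for t
  proof -
    have "(norm (c t))\<^sup>2 = (cos t)\<^sup>2 * (norm x)\<^sup>2 + (sin t)\<^sup>2 * (norm u)\<^sup>2"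
      using u(2) unfolding c_def power2_norm_eq_inner
      by (simp add: inner_add_left inner_add_right inner_commute power2_eq_square)
    also have "\<dots> = (norm x)\<^sup>2"
      using u(1) by (simp add: distrib_right[symmetric])
    finally show ?thesis .
  qed
  then have cs: "range c \<subseteq> sphere 0 (norm x)"
    by (auto simp: power2_eq_iff_nonneg)
  have dc: "(c has_derivative (\<lambda>t. t *\<^sub>R u)) (at 0)"
    unfolding c_def by (auto intro!: derivative_eq_intros)
  have "((\<lambda>t. f (c t)) has_derivative (\<lambda>t. a \<bullet> (t *\<^sub>R u))) (at 0)"
    using has_derivative_in_compose[OF dc, of f "\<lambda>h. a \<bullet> h"]
      has_derivative_subset[OF a(2) cs] c0 by simp
  moreover have "((\<lambda>t. f (c t)) has_derivative (\<lambda>t. b \<bullet> (t *\<^sub>R u))) (at 0)"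
    using has_derivative_in_compose[OF dc, of f "\<lambda>h. b \<bullet> h"]
      has_derivative_subset[OF b(2) cs] c0 by simp
  ultimately have "(\<lambda>t. a \<bullet> (t *\<^sub>R u)) = (\<lambda>t. b \<bullet> (t *\<^sub>R u))"
    by (rule has_derivative_unique)
  then have "a \<bullet> (1 *\<^sub>R u) = b \<bullet> (1 *\<^sub>R u)" by (rule fun_cong)
  then have "d \<bullet> u = 0" by (simp add: d_def inner_diff_left)
  then show False using d \<open>x \<noteq> 0\<close> by (simp add: u_def)
qed

lemma sphere_gradient_eq:
  fixes f :: "'a::euclidean_space \<Rightarrow> real"
  assumes "x \<noteq> 0" "(f has_derivative (\<lambda>h. g \<bullet> h)) (at x)"
  shows "sphere_gradient f x = g - ((g \<bullet> x) / (x \<bullet> x)) *\<^sub>R x"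
proof -
  define c where "c = (g \<bullet> x) / (x \<bullet> x)"
  let ?S = "sphere 0 (norm x)" and ?v = "g - c *\<^sub>R x"
  define q where "q = (\<lambda>y::'a. c / 2 * (y \<bullet> y))"
  have dq: "(q has_derivative (\<lambda>h. c * (x \<bullet> h))) (at x within ?S)"
    unfolding q_def
    by (auto intro!: derivative_eq_intros simp: inner_commute)
  have d: "((\<lambda>y. f y - (q y - q x)) has_derivative (\<lambda>h. ?v \<bullet> h)) (at x within ?S)"
    using has_derivative_diff[OF has_derivative_at_withinI[OF assms(2), of ?S]
        has_derivative_diff[OF dq has_derivative_const]]
    by (simp add: inner_diff_left)
  have eq: "f y - (q y - q x) = f y" if "y \<in> ?S" for y
    using that by (simp add: q_def dot_square_norm)
  have "(f has_derivative (\<lambda>h. ?v \<bullet> h)) (at x within ?S)"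
    using has_derivative_transform_within[OF d, of 1 f] eq by simp
  moreover have "?v \<bullet> x = 0"
    using assms(1) by (simp add: inner_diff_left c_def)
  ultimately show ?thesis
    unfolding sphere_gradient_def c_def[symmetric] using sphere_gradient_unique[OF assms(1)]
    by (intro the_equality) blast+
qed

definition Crt :: "nat \<Rightarrow> ('n::finite list \<Rightarrow> real) \<Rightarrow> real set \<Rightarrow> ennreal" where
  "Crt p J B = emeasure (count_space UNIV)
     {\<sigma> \<in> sphere 0 (sqrt (real CARD('n))).
        sphere_gradient (pspin_hamiltonian p J) \<sigma> = 0 \<and>
        pspin_hamiltonian p J \<sigma> \<in> (\<lambda>x. real CARD('n) * x) ` B}"

definition GOE :: "nat \<Rightarrow> 'b measure \<Rightarrow> ('b \<Rightarrow> real mat) \<Rightarrow> bool" where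
  "GOE N Q W \<longleftrightarrow>
     prob_space Q \<and>
     (\<forall>\<omega>\<in>space Q. W \<omega> \<in> carrier_mat N N \<and> transpose_mat (W \<omega>) = W \<omega>) \<and>
     prob_space.indep_vars Q (\<lambda>_. borel) (\<lambda>(i, j) \<omega>. W \<omega> $$ (i, j)) {(i, j). i \<le> j \<and> j < N} \<and>
     (\<forall>i j. i \<le> j \<longrightarrow> j < N \<longrightarrow>
        distributed Q lborel (\<lambda>\<omega>. W \<omega> $$ (i, j))
          (normal_density 0 (sqrt ((1 + of_bool (i = j)) / (2 * real N)))))"

text \<open>The real eigenvalues in increasing order, with multiplicity.\<close>

definition ordered_eigenvalues :: "real mat \<Rightarrow> real list" where
  "ordered_eigenvalues A = sorted_list_of_multiset (proots (char_poly A))"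

definition mean_spectral_density ::
    "nat \<Rightarrow> 'b measure \<Rightarrow> ('b \<Rightarrow> real mat) \<Rightarrow> (real \<Rightarrow> real) \<Rightarrow> bool" where
  "mean_spectral_density N Q W \<rho> \<longleftrightarrow>
     integrable lborel \<rho> \<and>
     (\<forall>f :: real \<Rightarrow> real. f \<in> borel_measurable borel \<longrightarrow> bounded (range f) \<longrightarrow>
        (LINT x|lborel. f x * \<rho> x) =
          1 / real N * (LINT \<omega>|Q. (\<Sum>i<N. f (ordered_eigenvalues (W \<omega>) ! i))))"

end

theory Submission
  imports Defs
begin

hide_const (open) Determinant.det Matrix.orthogonal

text \<open>
  The case \<open>p = 2\<close> is elementary, because there the critical points are the unit eigenvectors of a
  GOE matrix, and general \<open>p\<close> is compared with it; no formula for the density of the eigenvalues is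
  needed. Rescale to the unit sphere and let \<open>B\<close> be an interval of energies. In a chart around a pole
  in which the energy is one of the coordinates, the critical equations express the couplings
  \<open>J(a, k, \<dots>, k)\<close> through the remaining ones, and the area formula turns the mean number of critical
  points in a cap into an integral. Count the pairs of critical points \<open>x\<close>, \<open>y\<close> of two independent
  Hamiltonians, with parameters \<open>p\<close> and \<open>q\<close>, that satisfy \<open>x \<bullet> y \<ge> \<theta>\<close>. As both laws are invariant
  under rotations, Fubini's theorem gives \<open>E\<^sub>p(B) m\<^sub>q(B', \<theta>) = E\<^sub>q(B') m\<^sub>p(B, \<theta>)\<close>, where \<open>E\<close> is the mean
  number on the sphere and \<open>m\<close> the mean number in a cap. After normalisation, \<open>m\<^sub>p(B, \<theta>)\<close> tends for
  \<open>\<theta> \<rightarrow> 1\<close> to the integral over \<open>B\<close> of a density \<open>\<kappa>\<^sub>p(t)\<close>, a Gaussian factor times the mean absolute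
  determinant of the Hessian at the pole conditioned on the energy \<open>t\<close>. So \<open>E\<^sub>p(B)\<close> is the integral of
  \<open>\<kappa>\<^sub>p\<close> over \<open>B\<close> up to a factor that does not depend on \<open>p\<close>. Up to scaling the conditioned Hessian has the
  same law for all \<open>p\<close>, hence \<open>\<kappa>\<^sub>p(t)\<close> and \<open>\<kappa>\<^sub>2(s t)\<close> with \<open>s\<^sup>2 = p / (2 (p - 1))\<close> differ by an explicit
  exponential factor.
\<close>

section \<open>Counting zeros\<close>

text \<open>With the energy as a coordinate there are as many unknowns as equations, and the
  couplings solved for are standard Gaussian and independent of the rest, so the area formula yields
  a Kac-Rice formula with an explicit weight. It can be evaluated at the pole itself, hence the
  limit of small caps; comparing two Hamiltonians replaces integration over the sphere. Finiteness
  of the mean makes the critical set finite almost surely; for p = 2 this is simplicity of the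
  spectrum. The constants: at the pole the components of the gradient have variance p, the Hessian
  entries have p(p-1)/2 times their variance for p = 2, and the multiplier is p t. Dividing p t by
  sqrt(p(p-1)/2) leaves 2 s t, the multiplier for p = 2 at energy s t; this determines s. The
  density of the gradient at 0 and the determinant of size N-1 give sqrt(p-1)^(N-1); the
  substitution adds 1/s = sqrt(2/p) sqrt(p-1). The factor 2N counts u and -u for each of N
  eigenvalues. Measurability of the count comes from compactness, hence for closed intervals; Borel
  sets are reached through versions that agree almost everywhere.\<close>

definition cnt :: "'a set \<Rightarrow> ennreal" where
  "cnt X = emeasure (count_space UNIV) X"

lemma cnt_finite: "finite X \<Longrightarrow> cnt X = of_nat (card X)"
  by (simp add: cnt_def emeasure_count_space_finite)

lemma cnt_infinite: "infinite X \<Longrightarrow> cnt X = \<infinity>"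
  by (simp add: cnt_def)

lemma cnt_empty [simp]: "cnt {} = 0"
  by (simp add: cnt_def)

lemma cnt_mono: "X \<subseteq> Y \<Longrightarrow> cnt X \<le> cnt Y"
  unfolding cnt_def by (rule emeasure_mono) auto

lemma cnt_bij_betw:
  assumes "bij_betw f X Y"
  shows "cnt X = cnt Y"
  using bij_betw_finite[OF assms] bij_betw_same_card[OF assms]
  by (cases "finite X") (auto simp: cnt_finite cnt_infinite)

lemma cnt_ge_card:
  assumes "F \<subseteq> X" "finite F"
  shows "of_nat (card F) \<le> cnt X"
  using cnt_mono[OF assms(1)] cnt_finite[OF assms(2)] by simp

text \<open>An infinite \<open>X\<close> has finite subsets of every size, so \<open>c\<close> then
  exceeds all natural numbers.\<close>

lemma cnt_leI:
  assumes "\<And>F. finite F \<Longrightarrow> F \<subseteq> X \<Longrightarrow> of_nat (card F) \<le> c"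
  shows "cnt X \<le> c"
proof (cases "finite X")
  case True
  then show ?thesis using assms[of X] by (simp add: cnt_finite)
next
  case False
  have "of_nat n \<le> c" for n
    using infinite_arbitrarily_large[OF False, of n] assms by auto
  then have "c = \<infinity>"
    using ennreal_Ex_less_of_nat[of c] by (metis infinity_ennreal_def leD less_top)
  then show ?thesis by simp
qed

text \<open>A common radius below a quarter of the least distance keeps the balls disjoint although
  each centre is moved by less than the radius. Rational radius and centres in \<open>D\<close>
  leave only countably many candidates when \<open>D\<close> is countable.\<close>

lemma finite_separated_balls:
  fixes F :: "'a::{metric_space} set"
  assumes "finite F" and D: "UNIV = closure D"
  shows "\<exists>c r. (\<forall>x\<in>F. c x \<in> D \<and> r \<in> \<rat> \<and> 0 < r \<and> x \<in> cball (c x) r) \<and>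
    (\<forall>x\<in>F. \<forall>y\<in>F. x \<noteq> y \<longrightarrow> cball (c x) r \<inter> cball (c y) r = {})"
proof -
  \<comment> \<open>The 1 keeps the minimum meaningful when \<open>F\<close> has fewer than two
    points.\<close>
  define P where "P = insert 1 ((\<lambda>(x, y). dist x y) ` {(x, y). x \<in> F \<and> y \<in> F \<and> x \<noteq> y})"
  have fP: "finite P"
    unfolding P_def using assms(1)
    by (intro finite.insertI finite_imageI, rule_tac finite_subset[of _ "F \<times> F"]) auto
  have P0: "P \<noteq> {}" "\<forall>d\<in>P. 0 < d" by (auto simp: P_def)
  have "0 < Min P / 4" using Min_gr_iff[OF fP P0(1), of 0] P0(2) by simp
  then obtain r where r: "r \<in> \<rat>" "0 < r" "r < Min P / 4"
    using Rats_dense_in_real by blast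
  have "\<exists>c\<in>D. dist c x < r" for x
    using D r(2) closure_approachable[of x D] by auto
  then obtain c where c: "\<And>x. c x \<in> D" "\<And>x. dist (c x) x < r" by metis
  have "cball (c x) r \<inter> cball (c y) r = {}" if "x \<in> F" "y \<in> F" "x \<noteq> y" for x y
  proof (rule ccontr)
    assume "cball (c x) r \<inter> cball (c y) r \<noteq> {}"
    then obtain z where z: "dist (c x) z \<le> r" "dist (c y) z \<le> r" by auto
    have "dist x y \<le> dist x (c x) + dist (c x) z + dist z (c y) + dist (c y) y"
      using dist_triangle[of x y "c x"] dist_triangle[of "c x" y z] dist_triangle[of z y "c y"] by linarith
    also have "\<dots> < 4 * r" using z c(2)[of x] c(2)[of y] by (simp add: dist_commute)
    finally have "dist x y < Min P" using r(3) by simp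
    moreover have "Min P \<le> dist x y" using fP that by (intro Min_le) (auto simp: P_def)
    ultimately show False by simp
  qed
  moreover have "x \<in> cball (c x) r" for x using c(2)[of x] by simp
  ultimately show ?thesis using c(1) r by (intro exI[of _ c] exI[of _ r]) auto
qed

text \<open>A zero is detected on a countable dense set: by continuity there are points near it with
  small values, and conversely points with values tending to 0 accumulate, by compactness, at a
  zero.\<close>

lemma zero_exists_measurable:
  fixes F :: "'w \<Rightarrow> 'a::euclidean_space \<Rightarrow> real"
  assumes K: "compact K"
    and cont: "\<And>w. w \<in> space M \<Longrightarrow> continuous_on K (F w)"
    and meas: "\<And>x. x \<in> K \<Longrightarrow> (\<lambda>w. F w x) \<in> borel_measurable M"
  shows "{w \<in> space M. \<exists>x\<in>K. F w x = 0} \<in> sets M"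
proof -
  obtain T where T: "countable T" "T \<subseteq> K" "K \<subseteq> closure T"
    using separable by blast
  have key: "(\<exists>x\<in>K. F w x = 0) \<longleftrightarrow> (\<forall>n. \<exists>x\<in>T. \<bar>F w x\<bar> < 1 / real (Suc n))" if w: "w \<in> space M" for w
  proof
    assume "\<exists>x\<in>K. F w x = 0"
    then obtain x where x: "x \<in> K" "F w x = 0" by auto
    show "\<forall>n. \<exists>x\<in>T. \<bar>F w x\<bar> < 1 / real (Suc n)"
    proof
      fix n
      obtain d where d: "d > 0" "\<And>y. y \<in> K \<Longrightarrow> dist y x < d \<Longrightarrow> dist (F w y) (F w x) < 1 / real (Suc n)"
        using cont[OF w] x(1) unfolding continuous_on_iff by (metis of_nat_0_less_iff zero_less_Suc zero_less_divide_1_iff)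
      obtain y where "y \<in> T" "dist y x < d" using T(3) x(1) d(1) closure_approachable by blast
      then show "\<exists>x\<in>T. \<bar>F w x\<bar> < 1 / real (Suc n)" using d(2)[of y] T(2) x(2) by (auto simp: dist_real_def)
    qed
  next
    assume R: "\<forall>n. \<exists>x\<in>T. \<bar>F w x\<bar> < 1 / real (Suc n)"
    then obtain t where t: "\<And>n. t n \<in> T" "\<And>n. \<bar>F w (t n)\<bar> < 1 / real (Suc n)" by metis
    have "\<forall>n. t n \<in> K" using t(1) T(2) by auto
    then obtain l s where l: "l \<in> K" "strict_mono s" "(t \<circ> s) \<longlonglongrightarrow> l"
      using K unfolding compact_def by blast
    have "(\<lambda>n. F w (t (s n))) \<longlonglongrightarrow> F w l"
      using continuous_on_tendsto_compose[OF cont[OF w] l(3)[unfolded comp_def] l(1)] \<open>\<forall>n. t n \<in> K\<close> by simp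
    moreover have "(\<lambda>n. F w (t (s n))) \<longlonglongrightarrow> 0"
    proof (rule Lim_null_comparison)
      show "\<forall>\<^sub>F n in sequentially. norm (F w (t (s n))) \<le> 1 / real (Suc n)"
      proof (intro always_eventually allI)
        fix n
        have "\<bar>F w (t (s n))\<bar> < 1 / real (Suc (s n))" by (rule t)
        also have "\<dots> \<le> 1 / real (Suc n)" using seq_suble[OF l(2), of n] by (intro divide_left_mono) auto
        finally show "norm (F w (t (s n))) \<le> 1 / real (Suc n)" by simp
      qed
      show "(\<lambda>n. 1 / real (Suc n)) \<longlonglongrightarrow> 0" using LIMSEQ_inverse_real_of_nat by (simp add: inverse_eq_divide)
    qed
    ultimately show "\<exists>x\<in>K. F w x = 0" using l(1) LIMSEQ_unique by blast
  qed
  have eq: "{w \<in> space M. \<exists>x\<in>K. F w x = 0} =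
      (\<Inter>n. \<Union>x\<in>T. {w \<in> space M. \<bar>F w x\<bar> < 1 / real (Suc n)})"
  proof (rule Set.set_eqI)
    fix w
    have "w \<in> (\<Inter>n. \<Union>x\<in>T. {w \<in> space M. \<bar>F w x\<bar> < 1 / real (Suc n)}) \<longleftrightarrow>
      w \<in> space M \<and> (\<forall>n. \<exists>x\<in>T. \<bar>F w x\<bar> < 1 / real (Suc n))" by blast
    also have "\<dots> \<longleftrightarrow> w \<in> space M \<and> (\<exists>x\<in>K. F w x = 0)" using key[of w] by blast
    finally show "w \<in> {w \<in> space M. \<exists>x\<in>K. F w x = 0} \<longleftrightarrow>
      w \<in> (\<Inter>n. \<Union>x\<in>T. {w \<in> space M. \<bar>F w x\<bar> < 1 / real (Suc n)})" by simp
  qed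
  have "{w \<in> space M. \<bar>F w x\<bar> < 1 / real (Suc n)} \<in> sets M" if "x \<in> T" for x n
  proof -
    have [measurable]: "(\<lambda>w. F w x) \<in> borel_measurable M" using meas T(2) that by blast
    show ?thesis by measurable
  qed
  then have "(\<Union>x\<in>T. {w \<in> space M. \<bar>F w x\<bar> < 1 / real (Suc n)}) \<in> sets M" for n
    by (intro sets.countable_UN'[OF T(1)] image_subsetI)
  then show ?thesis unfolding eq
    by (rule sets.countable_INT[OF image_subsetI UNIV_not_empty])
qed

text \<open>The count is at least \<open>n\<close> iff there are \<open>n\<close> pairwise disjoint balls from a countable family each of
  which contains a zero, and on a compact set the existence of a zero is a countable condition.\<close>
proposition cnt_zeros_measurable:
  fixes F :: "'w \<Rightarrow> 'a::euclidean_space \<Rightarrow> real"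
  assumes K: "compact K"
    and cont: "\<And>w. w \<in> space M \<Longrightarrow> continuous_on K (F w)"
    and meas: "\<And>x. x \<in> K \<Longrightarrow> (\<lambda>w. F w x) \<in> borel_measurable M"
  shows "(\<lambda>w. cnt {x \<in> K. F w x = 0}) \<in> borel_measurable M"
proof -
  obtain D :: "'a set" where D: "countable D" "UNIV \<subseteq> closure D"
    by (rule separable[of "UNIV::'a set"])
  define \<B> where "\<B> = (\<lambda>(c, r). cball c r :: 'a set) ` (D \<times> \<rat>)"
  have cB: "countable \<B>" unfolding \<B>_def by (intro countable_image countable_SIGMA D(1) countable_rat)
  define \<F> where "\<F> = {\<C>. finite \<C> \<and> \<C> \<subseteq> \<B> \<and> disjoint \<C>}"
  have cF: "countable \<F>"
    by (rule countable_subset[OF _ countable_Collect_finite_subset[OF cB]]) (auto simp: \<F>_def)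
  have eq: "cnt X = (SUP \<C>\<in>\<F>. \<Sum>C\<in>\<C>. indicator {Y. Y \<inter> C \<noteq> {}} X)" for X :: "'a set"
  proof (rule antisym)
    show "cnt X \<le> (SUP \<C>\<in>\<F>. \<Sum>C\<in>\<C>. indicator {Y. Y \<inter> C \<noteq> {}} X)"
    proof (rule cnt_leI)
      fix F assume F: "finite F" "F \<subseteq> X"
      have "UNIV = closure D" using D(2) by auto
      from finite_separated_balls[OF F(1) this] obtain c r where
        *: "(\<forall>x\<in>F. c x \<in> D \<and> r \<in> \<rat> \<and> 0 < r \<and> x \<in> cball (c x) r) \<and>
          (\<forall>x\<in>F. \<forall>y\<in>F. x \<noteq> y \<longrightarrow> cball (c x) r \<inter> cball (c y) r = {})"
        by (elim exE)
      have c: "\<And>x. x \<in> F \<Longrightarrow> c x \<in> D \<and> r \<in> \<rat> \<and> 0 < r \<and> x \<in> cball (c x) r"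
        and cd: "\<And>x y. x \<in> F \<Longrightarrow> y \<in> F \<Longrightarrow> x \<noteq> y \<Longrightarrow> cball (c x) r \<inter> cball (c y) r = {}"
        using * by simp_all
      define \<C> where "\<C> = (\<lambda>x. cball (c x) r) ` F"
      have inj: "inj_on (\<lambda>x. cball (c x) r) F"
      proof (rule inj_onI, rule ccontr)
        fix x y assume "x \<in> F" "y \<in> F" "cball (c x) r = cball (c y) r" "x \<noteq> y"
        then show False using c[of x] cd[of x y] by auto
      qed
      have "\<C> \<subseteq> \<B>" unfolding \<C>_def \<B>_def using c by (force simp del: mem_cball)
      moreover have "disjoint \<C>"
      proof (rule pairwiseI)
        fix A B assume "A \<in> \<C>" "B \<in> \<C>" "A \<noteq> B"
        then obtain x y where "x \<in> F" "y \<in> F" "A = cball (c x) r" "B = cball (c y) r" by (auto simp: \<C>_def)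
        then show "disjnt A B" using cd[of x y] \<open>A \<noteq> B\<close> unfolding disjnt_def by blast
      qed
      ultimately have "\<C> \<in> \<F>" using F(1) by (simp add: \<F>_def \<C>_def)
      have "of_nat (card F) = (\<Sum>C\<in>\<C>. 1::ennreal)" by (simp add: \<C>_def card_image[OF inj])
      also have "\<dots> \<le> (\<Sum>C\<in>\<C>. indicator {Y. Y \<inter> C \<noteq> {}} X)"
      proof (rule sum_mono)
        fix C assume "C \<in> \<C>"
        then obtain x where "x \<in> F" "C = cball (c x) r" by (auto simp: \<C>_def)
        then have "X \<inter> C \<noteq> {}" using c[of x] F(2) by blast
        then show "1 \<le> (indicator {Y. Y \<inter> C \<noteq> {}} X :: ennreal)" by simp
      qed
      also have "\<dots> \<le> (SUP \<C>\<in>\<F>. \<Sum>C\<in>\<C>. indicator {Y. Y \<inter> C \<noteq> {}} X)"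
        using \<open>\<C> \<in> \<F>\<close> by (rule SUP_upper)
      finally show "of_nat (card F) \<le> (SUP \<C>\<in>\<F>. \<Sum>C\<in>\<C>. indicator {Y. Y \<inter> C \<noteq> {}} X :: ennreal)" .
    qed
    show "(SUP \<C>\<in>\<F>. \<Sum>C\<in>\<C>. indicator {Y. Y \<inter> C \<noteq> {}} X) \<le> cnt X"
    proof (rule SUP_least)
      fix \<C> assume C: "\<C> \<in> \<F>"
      define \<C>' where "\<C>' = {C \<in> \<C>. X \<inter> C \<noteq> {}}"
      have "\<forall>C\<in>\<C>'. \<exists>x. x \<in> X \<inter> C" by (auto simp: \<C>'_def)
      then obtain h where h: "\<And>C. C \<in> \<C>' \<Longrightarrow> h C \<in> X \<inter> C" by metis
      have fin: "finite \<C>" "finite \<C>'" using C by (auto simp: \<F>_def \<C>'_def)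
      have "inj_on h \<C>'"
      proof (rule inj_onI)
        fix A B assume "A \<in> \<C>'" "B \<in> \<C>'" "h A = h B"
        then have "h A \<in> A \<inter> B" using h by (metis IntE IntI)
        moreover have "disjoint \<C>" using C by (simp add: \<F>_def)
        ultimately show "A = B" using \<open>A \<in> \<C>'\<close> \<open>B \<in> \<C>'\<close> by (auto simp: disjoint_def \<C>'_def)
      qed
      then have "card (h ` \<C>') = card \<C>'" by (rule card_image)
      moreover have "(\<Sum>C\<in>\<C>. indicator {Y. Y \<inter> C \<noteq> {}} X) = (of_nat (card \<C>') :: ennreal)"
        unfolding \<C>'_def using fin(1) by (simp add: indicator_def sum.If_cases Collect_conj_eq Int_commute)
      moreover have "of_nat (card (h ` \<C>')) \<le> cnt X"
        using h fin by (intro cnt_ge_card) auto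
      ultimately show "(\<Sum>C\<in>\<C>. indicator {Y. Y \<inter> C \<noteq> {}} X) \<le> cnt X" by simp
    qed
  qed
  have "(\<lambda>w. indicator {Y. Y \<inter> C \<noteq> {}} {x \<in> K. F w x = 0} :: ennreal) \<in> borel_measurable M" if "C \<in> \<B>" for C
  proof -
    have "{w \<in> space M. \<exists>x\<in>K \<inter> C. F w x = 0} \<in> sets M"
    proof (rule zero_exists_measurable)
      show "compact (K \<inter> C)" using K that by (auto simp: \<B>_def)
      show "continuous_on (K \<inter> C) (F w)" if "w \<in> space M" for w
        using cont[OF that] by (rule continuous_on_subset) auto
    qed (use meas in auto)
    then have "(\<lambda>w. indicator {w \<in> space M. \<exists>x\<in>K \<inter> C. F w x = 0} w :: ennreal) \<in> borel_measurable M"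
      by (rule borel_measurable_indicator)
    then show ?thesis
      by (rule measurable_cong[THEN iffD1, rotated]) (auto simp: indicator_def)
  qed
  then show ?thesis
    unfolding eq using cF
    by (intro borel_measurable_SUP borel_measurable_sum) (auto simp: \<F>_def)
qed

section \<open>The area formula\<close>

lemma continuous_on_det:
  fixes M :: "'a::topological_space \<Rightarrow> real^'n^'n"
  assumes "\<And>i j. continuous_on S (\<lambda>x. M x $ i $ j)"
  shows "continuous_on S (\<lambda>x. det (M x))"
  unfolding Determinants.det_def by (intro continuous_intros assms)

text \<open>The injectivity half of the inverse function theorem. The operator norm of
  \<open>D x - D a\<close> is at most the sum of the absolute entries, which is continuous and
  vanishes at \<open>a\<close>.\<close>

lemma locally_injective_at_regular_point:
  fixes G :: "real^'n \<Rightarrow> real^'n"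
  assumes der: "\<And>x. (G has_derivative (\<lambda>h. D x *v h)) (at x)"
    and cont: "\<And>i j. continuous_on UNIV (\<lambda>x. D x $ i $ j)"
    and reg: "det (D a) \<noteq> 0"
  obtains r where "r > 0" "inj_on G (ball a r)"
proof -
  obtain B where B: "B ** D a = Finite_Cartesian_Product.mat 1"
    using reg invertible_det_nz[of "D a"] invertible_left_inverse by blast
  have small: "\<exists>d>0. \<forall>x. dist a x < d \<longrightarrow> onorm (\<lambda>v. D x *v v - D a *v v) < e" if "e > 0" for e
  proof -
    define b where "b = (\<lambda>x. \<Sum>i\<in>UNIV. \<Sum>j\<in>UNIV. \<bar>(D x - D a) $ i $ j\<bar>)"
    have "continuous_on UNIV b" unfolding b_def by (simp, intro continuous_intros cont)
    then have "isCont b a" by (simp add: continuous_on_eq_continuous_at)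
    then have "\<exists>d>0. \<forall>x. dist x a < d \<longrightarrow> dist (b x) (b a) < e"
      using that unfolding continuous_at_eps_delta by simp
    then obtain d where d: "d > 0" "\<And>x. dist x a < d \<Longrightarrow> dist (b x) (b a) < e"
      by blast
    have "onorm (\<lambda>v. D x *v v - D a *v v) < e" if "dist a x < d" for x
    proof -
      have "onorm (\<lambda>v. D x *v v - D a *v v) = onorm ((*v) (D x - D a))"
        by (intro arg_cong[of _ _ onorm]) (simp add: fun_eq_iff matrix_vector_mult_diff_rdistrib)
      also have "\<dots> \<le> b x" unfolding b_def by (rule onorm_le_matrix_component_sum)
      also have "\<dots> < e" using d(2)[of x] that by (simp add: dist_commute dist_real_def b_def)
      finally show ?thesis .
    qed
    then show ?thesis using d(1) by blast
  qed
  have comp: "(*v) B \<circ> (\<lambda>h. D a *v h) = id"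
    by (simp add: fun_eq_iff matrix_vector_mul_assoc B)
  obtain r where "r > 0" "inj_on G (ball a r)"
    by (rule has_derivative_locally_injective[of a UNIV "(*v) B" "\<lambda>x h. D x *v h" G])
      (use der small comp matrix_vector_mul_bounded_linear in auto)
  then show ?thesis by (rule that)
qed

lemma emeasure_image_inj:
  fixes G :: "real^'n::{finite,wellorder} \<Rightarrow> real^'n::_"
  assumes der: "\<And>x. (G has_derivative (\<lambda>h. D x *v h)) (at x)"
    and cont: "\<And>i j. continuous_on UNIV (\<lambda>x. D x $ i $ j)"
    and A: "A \<in> sets borel" and inj: "inj_on G A"
  shows "G ` A \<in> sets lebesgue"
    and "emeasure lebesgue (G ` A) = (\<integral>\<^sup>+x\<in>A. ennreal \<bar>det (D x)\<bar> \<partial>lborel)"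
proof -
  have Al: "A \<in> sets lebesgue" using A by (simp add: sets_completionI_sets)
  have "G differentiable_on A"
    using der unfolding differentiable_on_def differentiable_def
    by (meson has_derivative_at_withinI)
  then show im: "G ` A \<in> sets lebesgue"
    using Al by (intro differentiable_image_in_sets_lebesgue) auto
  have d: "(G has_derivative (\<lambda>h. D x *v h)) (at x within A)" if "x \<in> A" for x
    using der by (rule has_derivative_at_withinI)
  have mD: "matrix (\<lambda>h. D x *v h) = D x" for x by (rule matrix_of_matrix_vector_mul)
  have meas: "(\<lambda>x. \<bar>det (D x)\<bar>) \<in> borel_measurable borel"
    by (intro borel_measurable_continuous_onI continuous_on_rabs continuous_on_det cont)
  have measA: "(\<lambda>x. indicator A x * \<bar>det (D x)\<bar>) \<in> borel_measurable borel"
    using A meas by (intro borel_measurable_times borel_measurable_indicator) auto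
  have iff: "G ` A \<in> lmeasurable \<longleftrightarrow> (\<lambda>x. \<bar>det (D x)\<bar>) absolutely_integrable_on A"
    using measurable_differentiable_image_alt[OF Al d inj] by (simp add: mD)
  have nneq: "(\<integral>\<^sup>+x\<in>A. ennreal \<bar>det (D x)\<bar> \<partial>lborel) = (\<integral>\<^sup>+x. ennreal (indicator A x * \<bar>det (D x)\<bar>) \<partial>lborel)"
    by (intro nn_integral_cong) (auto simp: indicator_def)
  show "emeasure lebesgue (G ` A) = (\<integral>\<^sup>+x\<in>A. ennreal \<bar>det (D x)\<bar> \<partial>lborel)"
  proof (cases "(\<integral>\<^sup>+x\<in>A. ennreal \<bar>det (D x)\<bar> \<partial>lborel) < \<infinity>")
    case True
    have "integrable lborel (\<lambda>x. indicator A x * \<bar>det (D x)\<bar>)"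
      using True measA unfolding nneq by (intro integrableI_bounded) (auto simp: abs_mult)
    then have il: "integrable lebesgue (\<lambda>x. indicator A x * \<bar>det (D x)\<bar>)"
      using measA by (simp add: integrable_completion)
    then have ai: "(\<lambda>x. \<bar>det (D x)\<bar>) absolutely_integrable_on A"
      by (simp add: set_integrable_def)
    then have lm: "G ` A \<in> lmeasurable" using iff by simp
    have io: "(\<lambda>x. \<bar>det (D x)\<bar>) integrable_on A"
      using ai set_lebesgue_integral_eq_integral(1) by blast
    have "measure lebesgue (G ` A) = integral A (\<lambda>x. \<bar>det (D x)\<bar>)"
      using measure_differentiable_image_eq[OF Al d inj] io by (simp add: mD)
    moreover have "(\<integral>\<^sup>+x\<in>A. ennreal \<bar>det (D x)\<bar> \<partial>lborel) = ennreal (integral A (\<lambda>x. \<bar>det (D x)\<bar>))"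
    proof -
      have "(\<integral>\<^sup>+x\<in>A. ennreal \<bar>det (D x)\<bar> \<partial>lborel) =
        (\<integral>\<^sup>+x. ennreal (indicator A x * \<bar>det (D x)\<bar>) \<partial>lebesgue)"
        by (simp add: nneq nn_integral_completion)
      also have "\<dots> = ennreal (LINT x|lebesgue. indicator A x * \<bar>det (D x)\<bar>)"
        using il by (intro nn_integral_eq_integral) auto
      also have "(LINT x|lebesgue. indicator A x * \<bar>det (D x)\<bar>) = integral A (\<lambda>x. \<bar>det (D x)\<bar>)"
        using set_lebesgue_integral_eq_integral(2)[OF ai] by (simp add: set_lebesgue_integral_def)
      finally show ?thesis .
    qed
    ultimately show ?thesis using emeasure_eq_measure2[OF lm] by simp
  next
    case False
    have "\<not> G ` A \<in> lmeasurable"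
    proof
      assume "G ` A \<in> lmeasurable"
      then have "integrable lebesgue (\<lambda>x. indicator A x * \<bar>det (D x)\<bar>)"
        using iff by (simp add: set_integrable_def)
      then have "(\<integral>\<^sup>+x. ennreal (norm (indicator A x * \<bar>det (D x)\<bar>)) \<partial>lebesgue) < \<infinity>"
        by (simp add: integrable_iff_bounded)
      then show False using False unfolding nneq by (simp add: nn_integral_completion abs_mult)
    qed
    then have "emeasure lebesgue (G ` A) = \<infinity>"
      using im unfolding fmeasurable_def infinity_ennreal_def by (metis (no_types, lifting) mem_Collect_eq top.not_eq_extremum)
    then show ?thesis using False unfolding infinity_ennreal_def by (metis top.not_eq_extremum)
  qed
qed

text \<open>The critical values are negligible by Sard's theorem, and the regular points are covered by countably
  many balls on which the map is injective.\<close>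
proposition area_formula_cnt:
  fixes G :: "real^'n::{finite,wellorder} \<Rightarrow> real^'n::_"
  assumes der: "\<And>x. (G has_derivative (\<lambda>h. D x *v h)) (at x)"
    and cont: "\<And>i j. continuous_on UNIV (\<lambda>x. D x $ i $ j)"
    and A: "A \<in> sets borel"
  shows "(\<integral>\<^sup>+v. cnt {z \<in> A. G z = v} \<partial>lborel) = (\<integral>\<^sup>+z\<in>A. ennreal \<bar>det (D z)\<bar> \<partial>lborel)"
proof -
  define C where "C = {z. det (D z) = 0}"
  have "closed C" unfolding C_def
    by (intro closed_Collect_eq continuous_on_det cont continuous_on_const)
  have neg: "negligible (G ` C)"
  proof (rule baby_Sard)
    show "(G has_derivative (\<lambda>h. D x *v h)) (at x within C)" for x
      using der by (rule has_derivative_at_withinI)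
    show "rank (matrix (\<lambda>h. D x *v h)) < CARD('n)" if "x \<in> C" for x
      using that by (simp add: C_def matrix_of_matrix_vector_mul det_eq_0_rank)
  qed simp
  have "\<exists>r>0. inj_on G (ball a r)" if "a \<in> - C" for a
    using locally_injective_at_regular_point[OF der cont, of a] that by (auto simp: C_def)
  then obtain r where r: "\<And>a. a \<in> - C \<Longrightarrow> r a > 0" "\<And>a. a \<in> - C \<Longrightarrow> inj_on G (ball a (r a))"
    by metis
  \<comment> \<open>The empty set pads the enumeration of the countable subcover, which has to be a
    sequence.\<close>
  define U where "U = insert {} ((\<lambda>a. ball a (r a)) ` (- C))"
  obtain V where V: "V \<subseteq> U" "countable V" "\<Union>V = \<Union>U"
    by (rule Lindelof[of U]) (auto simp: U_def)
  have "- C \<subseteq> \<Union>U" using r(1) by (auto simp: U_def)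
  define W where "W = from_nat_into (insert {} V)"
  have rW: "range W = insert {} V"
    unfolding W_def using V(2) by (intro range_from_nat_into) auto
  have Wo: "open (W n)" and Wi: "inj_on G (W n)" for n
  proof -
    have "W n \<in> insert {} V" using rW by blast
    then have "W n \<in> U" using V(1) by (auto simp: U_def)
    then show "open (W n)" "inj_on G (W n)" using r(2) by (auto simp: U_def)
  qed
  \<comment> \<open>Each value has at most one preimage in each piece, and for a noncritical value
    every preimage in \<open>A\<close> lies in some piece; its count is then a sum of indicators of
    images.\<close>
  define P where "P = (\<lambda>n. disjointed W n \<inter> A - C)"
  have PU: "(\<Union>n. P n) = A - C"
  proof -
    have "(\<Union>n. W n) = \<Union>V" using rW by auto
    then have "- C \<subseteq> (\<Union>n. W n)" using V(3) \<open>- C \<subseteq> \<Union>U\<close> by simp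
    then show ?thesis unfolding P_def using UN_disjointed_eq[of W] by blast
  qed
  have Pd: "disjoint_family P"
    using disjoint_family_disjointed[of W] unfolding P_def disjoint_family_on_def by blast
  have "range W \<subseteq> sets borel" using Wo borel_open by blast
  then have "disjointed W n \<in> sets borel" for n
    using sets.range_disjointed_sets[of W borel] by blast
  then have Pb: "P n \<in> sets borel" for n
    unfolding P_def using A \<open>closed C\<close> by auto
  have Pi: "inj_on G (P n)" for n
    using Wi[of n] by (rule inj_on_subset) (use disjointed_subset[of W n] in \<open>auto simp: P_def\<close>)
  have ae: "AE v in lebesgue. v \<notin> G ` C"
    using neg by (intro AE_not_in) (simp add: negligible_iff_null_sets)
  have cnteq: "cnt {z \<in> A. G z = v} = (\<Sum>n. indicator (G ` P n) v)" if v: "v \<notin> G ` C" for v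
  proof -
    have "{z \<in> A. G z = v} = (\<Union>n. {z \<in> P n. G z = v})"
      using PU v by blast
    then have "cnt {z \<in> A. G z = v} = emeasure (count_space UNIV) (\<Union>n. {z \<in> P n. G z = v})"
      by (simp add: cnt_def)
    also have "\<dots> = (\<Sum>n. emeasure (count_space UNIV) {z \<in> P n. G z = v})"
      using Pd by (intro suminf_emeasure[symmetric]) (auto simp: disjoint_family_on_def)
    also have "\<dots> = (\<Sum>n. indicator (G ` P n) v)"
    proof (rule suminf_cong)
      fix n
      show "emeasure (count_space UNIV) {z \<in> P n. G z = v} = indicator (G ` P n) v"
      proof (cases "v \<in> G ` P n")
        case True
        then obtain z where "z \<in> P n" "G z = v" by auto
        then have "{z \<in> P n. G z = v} = {z}" using Pi[of n] by (auto dest: inj_onD)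
        then show ?thesis using True by simp
      next
        case False
        then have e: "{z \<in> P n. G z = v} = {}" by auto
        show ?thesis unfolding e using False by simp
      qed
    qed
    finally show ?thesis .
  qed
  have "(\<integral>\<^sup>+v. cnt {z \<in> A. G z = v} \<partial>lborel) = (\<integral>\<^sup>+v. cnt {z \<in> A. G z = v} \<partial>lebesgue)"
    by (simp add: nn_integral_completion)
  also have "\<dots> = (\<integral>\<^sup>+v. (\<Sum>n. indicator (G ` P n) v) \<partial>lebesgue)"
    using ae cnteq by (intro nn_integral_cong_AE) auto
  also have "\<dots> = (\<Sum>n. \<integral>\<^sup>+v. indicator (G ` P n) v \<partial>lebesgue)"
    using emeasure_image_inj(1)[OF der cont Pb Pi]
    by (intro nn_integral_suminf borel_measurable_indicator)
  also have "\<dots> = (\<Sum>n. \<integral>\<^sup>+z\<in>P n. ennreal \<bar>det (D z)\<bar> \<partial>lborel)"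
    using emeasure_image_inj[OF der cont Pb Pi] by simp
  also have "\<dots> = (\<integral>\<^sup>+z\<in>(\<Union>n. P n). ennreal \<bar>det (D z)\<bar> \<partial>lborel)"
    using Pb Pd by (intro nn_integral_disjoint_family[symmetric])
      (auto intro!: borel_measurable_continuous_onI continuous_on_rabs continuous_on_det cont measurable_compose[OF _ measurable_ennreal])
  \<comment> \<open>The determinant vanishes on \<open>C\<close>, so the removed points contribute
    nothing.\<close>
  also have "\<dots> = (\<integral>\<^sup>+z\<in>A. ennreal \<bar>det (D z)\<bar> \<partial>lborel)"
    unfolding PU by (intro nn_integral_cong) (auto simp: indicator_def C_def)
  finally show ?thesis .
qed

text \<open>Both sides integrate \<open>w\<close>: one against the measure whose density is the
  count, the other against the image under \<open>G\<close> of the Jacobian measure on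
  \<open>A\<close>. The unweighted formula on the part of \<open>A\<close> lying over a test set
  \<open>E\<close> shows that these measures agree. Compactness of \<open>A\<close> makes the count
  measurable.\<close>

proposition area_formula:
  fixes G :: "real^'n::{finite,wellorder} \<Rightarrow> real^'n::_"
  assumes der: "\<And>x. (G has_derivative (\<lambda>h. D x *v h)) (at x)"
    and cont: "\<And>i j. continuous_on UNIV (\<lambda>x. D x $ i $ j)"
    and A: "compact A" and w [measurable]: "w \<in> borel_measurable borel"
  shows "(\<lambda>v. cnt {z \<in> A. G z = v}) \<in> borel_measurable borel"
    and "(\<integral>\<^sup>+v. w v * cnt {z \<in> A. G z = v} \<partial>lborel) =
      (\<integral>\<^sup>+z\<in>A. w (G z) * ennreal \<bar>det (D z)\<bar> \<partial>lborel)"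
proof -
  have contG: "continuous_on S G" for S
    using der by (meson continuous_at_imp_continuous_on has_derivative_continuous)
  have [measurable]: "G \<in> borel_measurable borel" by (intro borel_measurable_continuous_onI contG)
  have detm [measurable]: "(\<lambda>z. det (D z)) \<in> borel_measurable borel"
    by (intro borel_measurable_continuous_onI continuous_on_det cont)
  have Ab [measurable]: "A \<in> sets borel" using A by (simp add: borel_compact)
  have "(\<lambda>v. cnt {z \<in> A. norm (G z - v) = 0}) \<in> borel_measurable borel"
    by (rule cnt_zeros_measurable[OF A]) (auto intro!: continuous_intros contG)
  then show m [measurable]: "(\<lambda>v. cnt {z \<in> A. G z = v}) \<in> borel_measurable borel" by simp
  have eq: "density lborel (\<lambda>v. cnt {z \<in> A. G z = v}) =
    distr (density lborel (\<lambda>z. indicator A z * ennreal \<bar>det (D z)\<bar>)) borel G" (is "?L = ?R")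
  proof (rule measure_eqI)
    fix E assume "E \<in> sets ?L"
    then have E [measurable]: "E \<in> sets borel" by simp
    have pre: "A \<inter> G -` E \<in> sets borel"
      using measurable_sets[OF \<open>G \<in> borel_measurable borel\<close> E] by auto
    have "emeasure ?L E = (\<integral>\<^sup>+v. cnt {z \<in> A. G z = v} * indicator E v \<partial>lborel)"
      by (simp add: emeasure_density)
    also have "\<dots> = (\<integral>\<^sup>+v. cnt {z \<in> A \<inter> G -` E. G z = v} \<partial>lborel)"
    proof (rule nn_integral_cong)
      fix v
      show "cnt {z \<in> A. G z = v} * indicator E v = cnt {z \<in> A \<inter> G -` E. G z = v}"
      proof (cases "v \<in> E")
        case True
        then have "{z \<in> A \<inter> G -` E. G z = v} = {z \<in> A. G z = v}" by auto
        then show ?thesis using True by simp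
      next
        case False
        then have e: "{z \<in> A \<inter> G -` E. G z = v} = {}" by auto
        show ?thesis unfolding e using False by simp
      qed
    qed
    also have "\<dots> = (\<integral>\<^sup>+z\<in>A \<inter> G -` E. ennreal \<bar>det (D z)\<bar> \<partial>lborel)"
      by (rule area_formula_cnt[OF der cont pre])
    also have "\<dots> = (\<integral>\<^sup>+z. indicator A z * ennreal \<bar>det (D z)\<bar> * indicator (G -` E) z \<partial>lborel)"
      by (intro nn_integral_cong) (auto simp: indicator_def)
    also have "\<dots> = emeasure ?R E"
      using measurable_sets[OF \<open>G \<in> borel_measurable borel\<close> E]
      by (simp add: emeasure_distr emeasure_density)
    finally show "emeasure ?L E = emeasure ?R E" .
  qed simp
  have "(\<integral>\<^sup>+v. w v * cnt {z \<in> A. G z = v} \<partial>lborel) = (\<integral>\<^sup>+v. w v \<partial>?L)"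
    by (subst nn_integral_density) (auto simp: mult.commute)
  also have "\<dots> = (\<integral>\<^sup>+z. w (G z) \<partial>density lborel (\<lambda>z. indicator A z * ennreal \<bar>det (D z)\<bar>))"
    unfolding eq by (subst nn_integral_distr) auto
  also have "\<dots> = (\<integral>\<^sup>+z\<in>A. w (G z) * ennreal \<bar>det (D z)\<bar> \<partial>lborel)"
    by (subst nn_integral_density) (auto intro!: nn_integral_cong simp: mult.commute mult.left_commute)
  finally show "(\<integral>\<^sup>+v. w v * cnt {z \<in> A. G z = v} \<partial>lborel) =
      (\<integral>\<^sup>+z\<in>A. w (G z) * ennreal \<bar>det (D z)\<bar> \<partial>lborel)" .
qed

section \<open>Gaussian vectors\<close>

definition stdN :: "real measure" where
  "stdN = density lborel (\<lambda>x. ennreal (std_normal_density x))"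

lemma sets_stdN [simp, measurable_cong]: "sets stdN = sets borel"
  by (simp add: stdN_def)

lemma space_stdN [simp]: "space stdN = UNIV"
  by (simp add: stdN_def)

lemma prob_space_stdN: "prob_space stdN"
  unfolding stdN_def by (rule prob_space_normal_density) simp

definition gaussN :: "(real^'n::finite) measure" where
  "gaussN = density lborel (\<lambda>v. \<Prod>a\<in>UNIV. ennreal (std_normal_density (v $ a)))"

lemma sets_gaussN [simp, measurable_cong]: "sets gaussN = sets borel"
  by (simp add: gaussN_def)

lemma space_gaussN [simp]: "space gaussN = UNIV"
  by (simp add: gaussN_def)

lemma measurable_vec_lambda_PiM [measurable]:
  "vec_lambda \<in> borel_measurable (PiM (UNIV :: 'n::finite set) (\<lambda>_. borel :: real measure))"
proof (subst borel_measurable_euclidean_space, intro ballI)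
  fix b :: "real^'n" assume "b \<in> Basis"
  then obtain i where b: "b = axis i 1" by (auto simp: Basis_vec_def)
  have "(\<lambda>x. vec_lambda x \<bullet> b) = (\<lambda>x. x i)" by (simp add: b inner_axis fun_eq_iff)
  then show "(\<lambda>x. vec_lambda x \<bullet> b) \<in> borel_measurable (PiM UNIV (\<lambda>_. borel))" by simp
qed

lemma measurable_vec_nth [measurable]: "(\<lambda>x::real^'n::finite. x $ i) \<in> borel_measurable borel"
  by (intro borel_measurable_continuous_onI continuous_intros)

lemma measurable_vecI:
  fixes f :: "'a \<Rightarrow> real^'n::finite"
  assumes "\<And>i. (\<lambda>x. f x $ i) \<in> borel_measurable M"
  shows "f \<in> borel_measurable M"
proof (subst borel_measurable_euclidean_space, intro ballI)
  fix b :: "real^'n" assume "b \<in> Basis"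
  then obtain i where b: "b = axis i 1" by (auto simp: Basis_vec_def)
  show "(\<lambda>x. f x \<bullet> b) \<in> borel_measurable M" using assms[of i] by (simp add: b inner_axis)
qed

lemma prod_Basis_vec: "(\<Prod>b\<in>(Basis :: (real^'n::finite) set). h b) = (\<Prod>i\<in>UNIV. h (axis i 1))"
proof -
  have B: "(Basis :: (real^'n) set) = range (\<lambda>i. axis i 1)" by (auto simp: Basis_vec_def)
  have "inj (\<lambda>i::'n. axis i (1::real))" by (simp add: inj_on_def axis_eq_axis)
  then show ?thesis unfolding B by (subst prod.reindex) simp_all
qed

text \<open>Boxes determine the measure. This opens Lebesgue measure on \<open>real ^ 'n\<close> to
  Fubini one coordinate at a time.\<close>

lemma lborel_vec_eq_PiM:
  "lborel = distr (PiM (UNIV :: 'n::finite set) (\<lambda>_. lborel :: real measure)) borel vec_lambda"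
proof (rule lborel_eqI)
  fix l u :: "real^'n"
  assume lu: "\<And>b. b \<in> Basis \<Longrightarrow> l \<bullet> b \<le> u \<bullet> b"
  have lu': "l $ i \<le> u $ i" for i using lu[of "axis i 1"] by (simp add: inner_axis axis_in_Basis_iff)
  interpret product_sigma_finite "\<lambda>_::'n. lborel :: real measure" ..
  have pre: "vec_lambda -` box l u \<inter> space (PiM UNIV (\<lambda>_. lborel)) = PiE UNIV (\<lambda>i. {l $ i<..<u $ i})"
    by (auto simp: space_PiM mem_box_cart PiE_iff)
  have "emeasure (distr (PiM UNIV (\<lambda>_. lborel)) borel vec_lambda) (box l u) =
    emeasure (PiM UNIV (\<lambda>_. lborel)) (PiE UNIV (\<lambda>i. {l $ i<..<u $ i}))"
    by (subst emeasure_distr) (simp_all only: pre, auto)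
  also have "\<dots> = (\<Prod>i\<in>UNIV. emeasure lborel {l $ i<..<u $ i})"
    by (rule emeasure_PiM) auto
  also have "\<dots> = (\<Prod>i\<in>UNIV. ennreal (u $ i - l $ i))"
    using lu' by simp
  also have "\<dots> = ennreal (\<Prod>i\<in>UNIV. u $ i - l $ i)"
    using lu' by (simp add: prod_ennreal)
  also have "(\<Prod>i\<in>UNIV. u $ i - l $ i) = (\<Prod>b\<in>Basis. (u - l) \<bullet> b)"
    by (simp add: prod_Basis_vec inner_axis)
  finally show "emeasure (distr (PiM UNIV (\<lambda>_. lborel)) borel vec_lambda) (box l u) = (\<Prod>b\<in>Basis. (u - l) \<bullet> b)" .
qed simp

lemma emeasure_gaussN_box:
  fixes A :: "'n::finite \<Rightarrow> real set"
  assumes A [measurable]: "\<And>a. A a \<in> sets borel"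
  shows "emeasure gaussN {v. \<forall>a. v $ a \<in> A a} = (\<Prod>a\<in>UNIV. emeasure stdN (A a))"
proof -
  interpret product_sigma_finite "\<lambda>_::'n. lborel :: real measure" ..
  have "{v. \<forall>a. v $ a \<in> A a} = (\<Inter>a. (\<lambda>v::real^'n. v $ a) -` A a)" by auto
  moreover have "(\<lambda>v::real^'n. v $ a) -` A a \<in> sets borel" for a
    using measurable_sets[OF measurable_vec_nth A, of a a] by simp
  ultimately have S [measurable]: "{v::real^'n. \<forall>a. v $ a \<in> A a} \<in> sets borel"
    by (auto intro!: sets.finite_INT)
  have ind: "indicator {v. \<forall>a. v $ a \<in> A a} v = (\<Prod>a\<in>UNIV. indicator (A a) (v $ a) :: ennreal)" for v :: "real^'n"
    by (auto simp: indicator_def)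
  have "emeasure gaussN {v. \<forall>a. v $ a \<in> A a} =
    (\<integral>\<^sup>+v. (\<Prod>a\<in>UNIV. ennreal (std_normal_density (v $ a)) * indicator (A a) (v $ a)) \<partial>lborel)"
    unfolding gaussN_def by (subst emeasure_density) (auto simp: ind prod.distrib)
  also have "\<dots> = (\<integral>\<^sup>+v. (\<Prod>a\<in>UNIV. ennreal (std_normal_density (v a)) * indicator (A a) (v a))
      \<partial>PiM UNIV (\<lambda>_. lborel))"
    by (subst lborel_vec_eq_PiM, subst nn_integral_distr) auto
  also have "\<dots> = (\<Prod>a\<in>UNIV. \<integral>\<^sup>+x. ennreal (std_normal_density x) * indicator (A a) x \<partial>lborel)"
    by (rule product_nn_integral_prod) auto
  also have "\<dots> = (\<Prod>a\<in>UNIV. emeasure stdN (A a))"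
    unfolding stdN_def by (subst emeasure_density) auto
  finally show ?thesis .
qed

lemma prob_space_gaussN: "prob_space (gaussN :: (real^'n::finite) measure)"
proof
  show "emeasure gaussN (space (gaussN :: (real^'n) measure)) = 1"
    using emeasure_gaussN_box[of "\<lambda>_::'n. UNIV"] prob_space.emeasure_space_1[OF prob_space_stdN] by simp
qed

text \<open>Lets a finite family of independent couplings be read as one Gaussian vector,
  \<open>\<alpha>\<close> naming the coordinate of each.\<close>

lemma gaussN_PiM:
  assumes \<alpha>: "bij_betw \<alpha> I (UNIV :: 'n::finite set)" and fin: "finite I"
  shows "distr (gaussN :: (real^'n) measure) (PiM I (\<lambda>_. stdN)) (\<lambda>v. \<lambda>i\<in>I. v $ \<alpha> i) = PiM I (\<lambda>_. stdN)"
proof -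
  interpret P: product_prob_space "\<lambda>_. stdN"
    by (rule product_prob_spaceI) (rule prob_space_stdN)
  show ?thesis
  proof (rule P.PiM_eqI[OF fin])
    fix A assume A: "\<And>i. i \<in> I \<Longrightarrow> A i \<in> sets stdN"
    define A' where "A' = (\<lambda>a. A (the_inv_into I \<alpha> a))"
    have A': "A' a \<in> sets borel" for a
      using A[of "the_inv_into I \<alpha> a"] bij_betwE[OF bij_betw_the_inv_into[OF \<alpha>]] by (auto simp: A'_def)
    have inv: "the_inv_into I \<alpha> (\<alpha> i) = i" if "i \<in> I" for i
      using \<alpha> that by (simp add: bij_betw_def the_inv_into_f_f)
    have pre: "(\<lambda>v. \<lambda>i\<in>I. v $ \<alpha> i) -` PiE I A \<inter> space gaussN = {v::real^'n. \<forall>a. v $ a \<in> A' a}"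
    proof -
      have "(\<forall>i\<in>I. v $ \<alpha> i \<in> A i) \<longleftrightarrow> (\<forall>a. v $ a \<in> A' a)" for v :: "real^'n"
      proof
        assume L: "\<forall>i\<in>I. v $ \<alpha> i \<in> A i"
        show "\<forall>a. v $ a \<in> A' a"
        proof
          fix a
          obtain i where "i \<in> I" "\<alpha> i = a" using \<alpha> by (metis UNIV_I bij_betw_imp_surj_on imageE)
          then show "v $ a \<in> A' a" using L inv by (auto simp: A'_def)
        qed
      next
        assume "\<forall>a. v $ a \<in> A' a"
        then show "\<forall>i\<in>I. v $ \<alpha> i \<in> A i" using inv by (metis A'_def)
      qed
      then show ?thesis by (auto simp: PiE_iff)
    qed
    have "emeasure (distr gaussN (PiM I (\<lambda>_. stdN)) (\<lambda>v. \<lambda>i\<in>I. v $ \<alpha> i)) (PiE I A) =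
      emeasure gaussN {v::real^'n. \<forall>a. v $ a \<in> A' a}"
    proof (subst emeasure_distr)
      show "(\<lambda>v::real^'n. \<lambda>i\<in>I. v $ \<alpha> i) \<in> gaussN \<rightarrow>\<^sub>M PiM I (\<lambda>_. stdN)"
        by (intro measurable_restrict) auto
      show "PiE I A \<in> sets (PiM I (\<lambda>_. stdN))" using A fin by (intro sets_PiM_I_finite)
    qed (simp only: pre)
    also have "\<dots> = (\<Prod>a\<in>UNIV. emeasure stdN (A' a))" by (rule emeasure_gaussN_box[OF A'])
    also have "\<dots> = (\<Prod>i\<in>I. emeasure stdN (A' (\<alpha> i)))"
      using prod.reindex_bij_betw[OF \<alpha>, of "\<lambda>a. emeasure stdN (A' a)"] by simp
    also have "\<dots> = (\<Prod>i\<in>I. emeasure stdN (A i))" using inv by (intro prod.cong) (auto simp: A'_def)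
    finally show "emeasure (distr gaussN (PiM I (\<lambda>_. stdN)) (\<lambda>v. \<lambda>i\<in>I. v $ \<alpha> i)) (PiE I A) =
      (\<Prod>i\<in>I. emeasure stdN (A i))" .
  qed simp
qed

text \<open>\<open>\<beta>\<close> names the vector and \<open>\<alpha>\<close> the coordinate in
  it, so independent Gaussian vectors are the same as a flat family of independent Gaussians. This
  lets a rotation act on one slot of the tensor of couplings while the other indices are
  frozen.\<close>

lemma PiM_gaussN_unpack:
  fixes \<beta> :: "'i \<Rightarrow> 'k"
  assumes bij: "bij_betw (\<lambda>i. (\<beta> i, \<alpha> i)) I (K \<times> (UNIV :: 'n::finite set))" and fin: "finite I" "finite K"
  shows "distr (PiM K (\<lambda>_. gaussN :: (real^'n) measure)) (PiM I (\<lambda>_. stdN)) (\<lambda>w. \<lambda>i\<in>I. w (\<beta> i) $ \<alpha> i) =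
    PiM I (\<lambda>_. stdN)"
proof -
  interpret P: product_prob_space "\<lambda>_::'i. stdN"
    by (rule product_prob_spaceI) (rule prob_space_stdN)
  interpret G: product_sigma_finite "\<lambda>_::'k. gaussN :: (real^'n) measure"
    by (rule product_sigma_finite.intro) (rule prob_space_imp_sigma_finite, rule prob_space_gaussN)
  define d where "d = the_inv_into I (\<lambda>i. (\<beta> i, \<alpha> i))"
  have dI: "d (j, a) \<in> I" "\<beta> (d (j, a)) = j" "\<alpha> (d (j, a)) = a" if "j \<in> K" for j a
  proof -
    have m: "(j, a) \<in> (\<lambda>i. (\<beta> i, \<alpha> i)) ` I" using bij that by (auto simp: bij_betw_def)
    have i: "inj_on (\<lambda>i. (\<beta> i, \<alpha> i)) I" using bij by (simp add: bij_betw_def)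
    show "d (j, a) \<in> I" unfolding d_def by (rule the_inv_into_into[OF i m]) simp
    show "\<beta> (d (j, a)) = j" "\<alpha> (d (j, a)) = a"
      using f_the_inv_into_f[OF i m] by (auto simp: d_def)
  qed
  have di: "d (\<beta> i, \<alpha> i) = i" if "i \<in> I" for i
    using bij that unfolding d_def by (intro the_inv_into_f_f) (auto simp: bij_betw_def)
  have bK: "\<beta> i \<in> K" if "i \<in> I" for i using bij that by (auto simp: bij_betw_def)
  show ?thesis
  proof (rule P.PiM_eqI[OF fin(1)])
    fix A assume A: "\<And>i. i \<in> I \<Longrightarrow> A i \<in> sets stdN"
    have Ad: "A (d (j, a)) \<in> sets borel" if "j \<in> K" for j a using A dI(1)[OF that] by simp
    have pre: "(\<lambda>w. \<lambda>i\<in>I. w (\<beta> i) $ \<alpha> i) -` PiE I A \<inter> space (PiM K (\<lambda>_. gaussN)) =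
      PiE K (\<lambda>j. {v::real^'n. \<forall>a. v $ a \<in> A (d (j, a))})"
    proof (rule Set.set_eqI)
      fix w :: "'k \<Rightarrow> real^'n"
      have "(\<forall>i\<in>I. w (\<beta> i) $ \<alpha> i \<in> A i) \<longleftrightarrow> (\<forall>j\<in>K. \<forall>a. w j $ a \<in> A (d (j, a)))"
        using dI di bK by metis
      then show "w \<in> (\<lambda>w. \<lambda>i\<in>I. w (\<beta> i) $ \<alpha> i) -` PiE I A \<inter> space (PiM K (\<lambda>_. gaussN)) \<longleftrightarrow>
        w \<in> PiE K (\<lambda>j. {v::real^'n. \<forall>a. v $ a \<in> A (d (j, a))})"
        by (auto simp: PiE_iff space_PiM)
    qed
    have bm: "{v::real^'n. \<forall>a. v $ a \<in> A (d (j, a))} \<in> sets borel" if "j \<in> K" for j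
    proof -
      have "{v::real^'n. \<forall>a. v $ a \<in> A (d (j, a))} = (\<Inter>a. (\<lambda>v. v $ a) -` A (d (j, a)))" by auto
      moreover have "(\<lambda>v::real^'n. v $ a) -` A (d (j, a)) \<in> sets borel" for a
        using measurable_sets[OF measurable_vec_nth Ad[OF that], of a a] by simp
      ultimately show ?thesis by (auto intro!: sets.finite_INT)
    qed
    have "emeasure (distr (PiM K (\<lambda>_. gaussN)) (PiM I (\<lambda>_. stdN)) (\<lambda>w. \<lambda>i\<in>I. w (\<beta> i) $ \<alpha> i)) (PiE I A) =
      emeasure (PiM K (\<lambda>_. gaussN)) (PiE K (\<lambda>j. {v::real^'n. \<forall>a. v $ a \<in> A (d (j, a))}))"
    proof (subst emeasure_distr)
      show "(\<lambda>w. \<lambda>i\<in>I. w (\<beta> i) $ \<alpha> i) \<in> PiM K (\<lambda>_. gaussN :: (real^'n) measure) \<rightarrow>\<^sub>M PiM I (\<lambda>_. stdN)"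
      proof (rule measurable_restrict)
        fix i assume "i \<in> I"
        have "(\<lambda>w. w (\<beta> i)) \<in> PiM K (\<lambda>_. gaussN :: (real^'n) measure) \<rightarrow>\<^sub>M gaussN"
          using bK[OF \<open>i \<in> I\<close>] by (rule measurable_component_singleton)
        then show "(\<lambda>w. w (\<beta> i) $ \<alpha> i) \<in> PiM K (\<lambda>_. gaussN :: (real^'n) measure) \<rightarrow>\<^sub>M stdN"
          by (rule measurable_compose) (simp add: measurable_vec_nth)
      qed
      show "PiE I A \<in> sets (PiM I (\<lambda>_. stdN))" using A fin by (intro sets_PiM_I_finite)
    qed (simp only: pre)
    also have "\<dots> = (\<Prod>j\<in>K. emeasure gaussN {v::real^'n. \<forall>a. v $ a \<in> A (d (j, a))})"
      using fin bm by (intro G.emeasure_PiM) auto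
    also have "\<dots> = (\<Prod>j\<in>K. \<Prod>a\<in>UNIV. emeasure stdN (A (d (j, a))))"
      using Ad by (intro prod.cong refl emeasure_gaussN_box) auto
    also have "\<dots> = (\<Prod>x\<in>K \<times> UNIV. emeasure stdN (A (d x)))"
      by (simp add: prod.cartesian_product)
    also have "\<dots> = (\<Prod>i\<in>I. emeasure stdN (A (d (\<beta> i, \<alpha> i))))"
      using prod.reindex_bij_betw[OF bij, of "\<lambda>x. emeasure stdN (A (d x))"] by simp
    also have "\<dots> = (\<Prod>i\<in>I. emeasure stdN (A i))" using di by simp
    finally show "emeasure (distr (PiM K (\<lambda>_. gaussN)) (PiM I (\<lambda>_. stdN)) (\<lambda>w. \<lambda>i\<in>I. w (\<beta> i) $ \<alpha> i)) (PiE I A) =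
      (\<Prod>i\<in>I. emeasure stdN (A i))" .
  qed simp
qed

text \<open>The density depends on the norm alone, which is the source of all rotation invariance
  below.\<close>

lemma prod_std_normal_density:
  "(\<Prod>a\<in>UNIV. std_normal_density (v $ a)) = (1 / sqrt (2 * pi)) ^ CARD('n) * exp (- (norm v)\<^sup>2 / 2)"
  for v :: "real^'n::finite"
proof -
  have "(norm v)\<^sup>2 = (\<Sum>a\<in>UNIV. (v $ a)\<^sup>2)"
    by (simp add: norm_vec_def L2_set_def sum_nonneg)
  then have "exp (- (norm v)\<^sup>2 / 2) = (\<Prod>a\<in>UNIV. exp (- (v $ a)\<^sup>2 / 2))"
    by (simp add: sum_divide_distrib sum_negf[symmetric] exp_sum)
  then show ?thesis
    by (simp add: std_normal_density_def prod_dividef power_divide)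
qed

lemma lborel_orthogonal_transformation:
  fixes f :: "real^'n::{finite,wellorder} \<Rightarrow> real^'n::_"
  assumes f: "orthogonal_transformation f"
  shows "distr lborel borel f = lborel"
proof (rule lborel_eqI[symmetric])
  fix l u :: "real^'n::_"
  assume lu: "\<And>b. b \<in> Basis \<Longrightarrow> l \<bullet> b \<le> u \<bullet> b"
  have lf: "linear f" using f by (simp add: orthogonal_transformation_def)
  have fm: "f \<in> borel_measurable borel"
    by (intro borel_measurable_continuous_onI linear_continuous_on linear_conv_bounded_linear[THEN iffD1] lf)
  have bij: "bij f" using f orthogonal_transformation_bij by blast
  have g: "orthogonal_transformation (inv_into UNIV f)" using f orthogonal_transformation_inv by blast
  have "f -` box l u = inv_into UNIV f ` box l u" using bij by (simp add: bij_vimage_eq_inv_image)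
  moreover have "inv_into UNIV f ` box l u \<in> lmeasurable" by (rule measurable_orthogonal_image[OF g]) simp
  moreover have "measure lebesgue (inv_into UNIV f ` box l u) = measure lebesgue (box l u)"
    by (rule measure_orthogonal_image[OF g]) simp
  ultimately have "emeasure lebesgue (f -` box l u) = emeasure lebesgue (box l u)"
    by (simp add: emeasure_eq_measure2)
  moreover have "f -` box l u \<in> sets borel" using measurable_sets[OF fm, of "box l u"] by simp
  ultimately have "emeasure lborel (f -` box l u) = emeasure lborel (box l u)"
    by simp
  then show "emeasure (distr lborel borel f) (box l u) = (\<Prod>b\<in>Basis. (u - l) \<bullet> b)"
    using fm lu by (simp add: emeasure_distr emeasure_lborel_box_eq)
qed simp

lemma gaussN_orthogonal_transformation:
  fixes f :: "real^'n::{finite,wellorder} \<Rightarrow> real^'n::_"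
  assumes f: "orthogonal_transformation f"
  shows "distr gaussN gaussN f = gaussN"
proof -
  have lf: "linear f" using f by (simp add: orthogonal_transformation_def)
  have fm [measurable]: "f \<in> borel_measurable borel"
    by (intro borel_measurable_continuous_onI linear_continuous_on linear_conv_bounded_linear[THEN iffD1] lf)
  define h where "h = (\<lambda>v::real^'n::_. \<Prod>a\<in>UNIV. ennreal (std_normal_density (v $ a)))"
  have hm [measurable]: "h \<in> borel_measurable borel" unfolding h_def by measurable
  have hf: "h (f v) = h v" for v
    by (simp add: h_def prod_ennreal prod_std_normal_density orthogonal_transformation_norm[OF f])
  have "distr (density lborel h) borel f = density lborel h"
  proof (rule measure_eqI)
    fix A assume "A \<in> sets (distr (density lborel h) borel f)"
    then have A [measurable]: "A \<in> sets borel" by simp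
    have fA [measurable]: "f -` A \<in> sets borel" using measurable_sets[OF fm A] by simp
    have "emeasure (distr (density lborel h) borel f) A = (\<integral>\<^sup>+v. h v * indicator (f -` A) v \<partial>lborel)"
      by (simp add: emeasure_distr emeasure_density)
    also have "\<dots> = (\<integral>\<^sup>+v. h (f v) * indicator A (f v) \<partial>lborel)"
      by (intro nn_integral_cong) (auto simp: hf indicator_def)
    also have "\<dots> = (\<integral>\<^sup>+v. h v * indicator A v \<partial>distr lborel borel f)"
      by (subst nn_integral_distr) auto
    also have "\<dots> = emeasure (density lborel h) A"
      by (simp add: lborel_orthogonal_transformation[OF f] emeasure_density)
    finally show "emeasure (distr (density lborel h) borel f) A = emeasure (density lborel h) A" .
  qed simp
  moreover have "distr gaussN gaussN f = distr gaussN borel f"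
    by (rule distr_cong) auto
  ultimately show ?thesis by (simp add: gaussN_def h_def[symmetric])
qed

section \<open>Critical points on the unit sphere\<close>

fun mon :: "'n::finite list \<Rightarrow> real^'n \<Rightarrow> real" where
  "mon [] x = 1"
| "mon (a # i) x = x $ a * mon i x"

text \<open>The gradient of \<open>mon\<close>; the recursion is the product rule. Likewise
  \<open>hmon i x h\<close> is the derivative of \<open>gmon i\<close> at \<open>x\<close> in
  direction \<open>h\<close>, the Hessian applied to \<open>h\<close>.\<close>

fun gmon :: "'n::finite list \<Rightarrow> real^'n \<Rightarrow> real^'n" where
  "gmon [] x = 0"
| "gmon (a # i) x = mon i x *\<^sub>R axis a 1 + x $ a *\<^sub>R gmon i x"

fun hmon :: "'n::finite list \<Rightarrow> real^'n \<Rightarrow> real^'n \<Rightarrow> real^'n" where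
  "hmon [] x h = 0"
| "hmon (a # i) x h = (gmon i x \<bullet> h) *\<^sub>R axis a 1 + h $ a *\<^sub>R gmon i x + x $ a *\<^sub>R hmon i x h"

lemma has_derivative_vec_nth': "((\<lambda>x::real^'n::finite. x $ a) has_derivative (\<lambda>h. h $ a)) F"
  by (rule bounded_linear.has_derivative[OF bounded_linear_vec_nth has_derivative_ident])

lemma has_derivative_mon: "(mon i has_derivative (\<lambda>h. gmon i x \<bullet> h)) (at x)"
proof (induction i)
  case (Cons a i)
  have "((\<lambda>x. x $ a * mon i x) has_derivative (\<lambda>h. x $ a * (gmon i x \<bullet> h) + h $ a * mon i x)) (at x)"
    by (rule has_derivative_mult[OF has_derivative_vec_nth' Cons])
  then show ?case
    by (simp add: inner_add_left inner_axis' algebra_simps)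
qed simp

lemma has_derivative_gmon: "(gmon i has_derivative hmon i x) (at x)"
proof (induction i)
  case Nil
  have "gmon [] = (\<lambda>x::real^'n. 0 :: real^'n)" "hmon [] x = (\<lambda>h. 0)" by (auto simp: fun_eq_iff)
  then show ?case by simp
next
  case (Cons a i)
  have "((\<lambda>x. mon i x *\<^sub>R axis a 1 + x $ a *\<^sub>R gmon i x) has_derivative
      (\<lambda>h. (gmon i x \<bullet> h) *\<^sub>R axis a 1 + (x $ a *\<^sub>R hmon i x h + h $ a *\<^sub>R gmon i x))) (at x)"
    by (intro has_derivative_add has_derivative_scaleR_left has_derivative_scaleR[OF has_derivative_vec_nth' Cons]
        has_derivative_mon)
  then show ?case by (simp add: fun_eq_iff[abs_def] algebra_simps cong: arg_cong2[of _ _ _ _ "\<lambda>f g. (f has_derivative g) (at x)"])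
qed

lemma continuous_on_mon [continuous_intros]:
  "continuous_on S f \<Longrightarrow> continuous_on S (\<lambda>x. mon i (f x))"
  by (induction i) (auto intro!: continuous_intros)

lemma continuous_on_gmon [continuous_intros]:
  "continuous_on S f \<Longrightarrow> continuous_on S (\<lambda>x. gmon i (f x))"
  by (induction i) (auto intro!: continuous_intros)

lemma continuous_on_hmon [continuous_intros]:
  "continuous_on S f \<Longrightarrow> continuous_on S g \<Longrightarrow> continuous_on S (\<lambda>x. hmon i (f x) (g x))"
  by (induction i) (auto intro!: continuous_intros)

lemma mon_scale: "mon i (c *\<^sub>R x) = c ^ length i * mon i x"
  by (induction i) auto

lemma gmon_scale: "gmon i (c *\<^sub>R x) = c ^ (length i - 1) *\<^sub>R gmon i x"
proof (induction i)
  case (Cons a i)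
  then show ?case by (cases i) (auto simp: mon_scale algebra_simps)
qed simp

lemma gmon_euler: "gmon i x \<bullet> x = real (length i) * mon i x"
  by (induction i) (auto simp: inner_add_left inner_axis' algebra_simps)

definition homf :: "nat \<Rightarrow> ('n::finite list \<Rightarrow> real) \<Rightarrow> real^'n \<Rightarrow> real" where
  "homf p J x = (\<Sum>i | length i = p. J i * mon i x)"

definition homg :: "nat \<Rightarrow> ('n::finite list \<Rightarrow> real) \<Rightarrow> real^'n \<Rightarrow> real^'n" where
  "homg p J x = (\<Sum>i | length i = p. J i *\<^sub>R gmon i x)"

lemma finite_lists_length [simp]: "finite {i :: 'n::finite list. length i = p}"
  using finite_lists_length_eq[of "UNIV :: 'n set" p] by simp

lemma has_derivative_homf: "(homf p J has_derivative (\<lambda>h. homg p J x \<bullet> h)) (at x)"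
proof -
  have "((\<lambda>x. \<Sum>i | length i = p. J i * mon i x) has_derivative
    (\<lambda>h. \<Sum>i | length i = p. J i * (gmon i x \<bullet> h))) (at x)"
    by (intro has_derivative_sum has_derivative_mult_right has_derivative_mon)
  then show ?thesis by (simp add: homf_def[abs_def] homg_def inner_sum_left)
qed

lemma continuous_on_homf [continuous_intros]:
  "continuous_on S f \<Longrightarrow> continuous_on S (\<lambda>x. homf p J (f x))"
  unfolding homf_def by (intro continuous_intros)

lemma continuous_on_homg [continuous_intros]:
  "continuous_on S f \<Longrightarrow> continuous_on S (\<lambda>x. homg p J (f x))"
  unfolding homg_def by (intro continuous_intros)

lemma homf_scale: "homf p J (c *\<^sub>R x) = c ^ p * homf p J x"
  unfolding homf_def sum_distrib_left by (intro sum.cong) (auto simp: mon_scale)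

lemma homg_scale: "homg p J (c *\<^sub>R x) = c ^ (p - 1) *\<^sub>R homg p J x"
  unfolding homg_def scaleR_sum_right by (intro sum.cong) (auto simp: gmon_scale)

lemma homg_euler: "homg p J x \<bullet> x = real p * homf p J x"
  unfolding homg_def homf_def inner_sum_left sum_distrib_left
  by (intro sum.cong) (auto simp: gmon_euler)

text \<open>By Euler's identity the only possible Lagrange multiplier on the unit sphere is \<open>p\<close> times the
  value of the polynomial.\<close>
definition crit :: "nat \<Rightarrow> ('n::finite list \<Rightarrow> real) \<Rightarrow> real set \<Rightarrow> (real^'n) set" where
  "crit p J B = {x. norm x = 1 \<and> homg p J x = (real p * homf p J x) *\<^sub>R x \<and> homf p J x \<in> B}"

lemma prod_nth_mon: "length i = p \<Longrightarrow> (\<Prod>k<p. x $ (i ! k)) = mon i x"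
proof (induction i arbitrary: p)
  case (Cons a i)
  then obtain q where "p = Suc q" "length i = q" by auto
  with Cons.IH[of q] show ?case by (simp add: prod.lessThan_Suc_shift del: prod.lessThan_Suc)
qed simp

lemma pspin_hamiltonian_eq:
  "pspin_hamiltonian p J \<sigma> = 1 / real CARD('n) powr ((real p - 1) / 2) * homf p J \<sigma>"
  for \<sigma> :: "real^'n::finite"
  unfolding pspin_hamiltonian_def homf_def by (simp add: prod_nth_mon)

text \<open>With \<sigma> = sqrt N x, homogeneity of degree p cancels the factor N^((p-1)/2) except
  for one sqrt N, so the energy N b becomes sqrt N b for the unnormalised polynomial on the unit
  sphere. By Euler's identity the radial part of the gradient is p times the value, so the
  tangential gradient vanishes exactly when the equation in \<open>crit\<close> holds.\<close>

lemma Crt_eq_cnt_crit: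
  fixes J :: "'n::finite list \<Rightarrow> real"
  assumes p: "p \<ge> 1"
  shows "Crt p J B = cnt (crit p J ((\<lambda>b. sqrt (real CARD('n)) * b) ` B))"
proof -
  define c where "c = sqrt (real CARD('n))"
  have c0: "c > 0" by (simp add: c_def)
  have cc: "real CARD('n) = c * c" by (simp add: c_def)
  have "real CARD('n) powr ((real p - 1) / 2) = c ^ (p - 1)"
  proof -
    have "real CARD('n) powr ((real p - 1) / 2) = (real CARD('n) powr (1/2)) powr real (p - 1)"
      using p by (simp add: powr_powr of_nat_diff)
    also have "\<dots> = c ^ (p - 1)"
      using c0 by (simp add: powr_half_sqrt c_def powr_realpow)
    finally show ?thesis .
  qed
  then have H: "pspin_hamiltonian p J \<sigma> = homf p J \<sigma> / c ^ (p - 1)" for \<sigma> :: "real^'n"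
    by (simp add: pspin_hamiltonian_eq)
  have cp: "c ^ p = c * c ^ (p - 1)" using p by (cases p) auto
  have Hx: "pspin_hamiltonian p J (c *\<^sub>R x) = c * homf p J x" for x :: "real^'n"
    using c0 by (simp add: H homf_scale cp)
  have dH: "(pspin_hamiltonian p J has_derivative (\<lambda>h. ((1 / c ^ (p - 1)) *\<^sub>R homg p J \<sigma>) \<bullet> h)) (at \<sigma>)" for \<sigma> :: "real^'n"
  proof -
    have "((\<lambda>\<sigma>. homf p J \<sigma> / c ^ (p - 1)) has_derivative (\<lambda>h. (homg p J \<sigma> \<bullet> h) / c ^ (p - 1))) (at \<sigma>)"
      using has_derivative_mult_left[OF has_derivative_homf[of p J \<sigma>], of "1 / c ^ (p - 1)"] by simp
    then show ?thesis by (simp add: H[abs_def] divide_inverse mult.commute)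
  qed
  have grad: "sphere_gradient (pspin_hamiltonian p J) (c *\<^sub>R x) = homg p J x - (real p * homf p J x) *\<^sub>R x"
    if x: "norm x = 1" for x :: "real^'n"
  proof -
    have xx: "x \<bullet> x = 1" using x by (simp add: dot_square_norm)
    have "c *\<^sub>R x \<noteq> 0" using x c0 by auto
    from sphere_gradient_eq[OF this dH]
    show ?thesis using c0 by (simp add: homg_scale homg_euler xx)
  qed
  have "bij_betw (\<lambda>x. c *\<^sub>R x) (crit p J ((\<lambda>b. c * b) ` B))
    {\<sigma> \<in> sphere 0 (sqrt (real CARD('n))). sphere_gradient (pspin_hamiltonian p J) \<sigma> = 0 \<and>
        pspin_hamiltonian p J \<sigma> \<in> (\<lambda>x. real CARD('n) * x) ` B}"
    (is "bij_betw ?h ?X ?Y")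
  proof (rule bij_betwI[where g = "\<lambda>\<sigma>. (1 / c) *\<^sub>R \<sigma>"])
    show "?h \<in> ?X \<rightarrow> ?Y"
    proof
      fix x assume x: "x \<in> ?X"
      then obtain b where b: "b \<in> B" "homf p J x = c * b" by (auto simp: crit_def)
      have n: "norm x = 1" using x by (simp add: crit_def)
      have "pspin_hamiltonian p J (c *\<^sub>R x) = real CARD('n) * b" using b by (simp add: Hx cc)
      then show "?h x \<in> ?Y" using x b(1) grad[OF n] c0 n by (auto simp: crit_def c_def)
    qed
    show "(\<lambda>\<sigma>. (1 / c) *\<^sub>R \<sigma>) \<in> ?Y \<rightarrow> ?X"
    proof
      fix \<sigma> assume s: "\<sigma> \<in> ?Y"
      define x where "x = (1 / c) *\<^sub>R \<sigma>"
      have sx: "\<sigma> = c *\<^sub>R x" using c0 by (simp add: x_def)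
      have n: "norm x = 1" using s c0 by (simp add: x_def c_def)
      obtain b where b: "b \<in> B" "pspin_hamiltonian p J \<sigma> = real CARD('n) * b" using s by auto
      have "homf p J x = c * b" using b(2) c0 unfolding sx Hx cc by simp
      then show "(1 / c) *\<^sub>R \<sigma> \<in> ?X"
        using s grad[OF n] n b(1) unfolding x_def[symmetric] by (auto simp: crit_def sx)
    qed
  qed (use c0 in auto)
  then show ?thesis
    unfolding Crt_def c_def[symmetric] by (simp add: cnt_def[symmetric] cnt_bij_betw[symmetric] c_def)
qed

text \<open>One nonnegative function, continuous in the point, whose zeros on the unit sphere are
  the critical points with energy in \<open>{a..b}\<close>. It brings critical points under the
  measurability of counts of zeros, and it is the reason for starting from closed intervals.\<close>

definition crit_defect :: "nat \<Rightarrow> ('n::finite list \<Rightarrow> real) \<Rightarrow> real \<Rightarrow> real \<Rightarrow> real^'n \<Rightarrow> real" where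
  "crit_defect p J a b x = norm (homg p J x - (real p * homf p J x) *\<^sub>R x) +
    (max 0 (a - homf p J x) + max 0 (homf p J x - b))"

lemma crit_defect_nonneg: "crit_defect p J a b x \<ge> 0"
  unfolding crit_defect_def by (intro add_nonneg_nonneg) auto

lemma crit_eq_defect: "x \<in> crit p J {a..b} \<longleftrightarrow> norm x = 1 \<and> crit_defect p J a b x = 0"
proof -
  have "crit_defect p J a b x = 0 \<longleftrightarrow> homg p J x = (real p * homf p J x) *\<^sub>R x \<and> homf p J x \<in> {a..b}"
    unfolding crit_defect_def by (subst add_nonneg_eq_0_iff, simp, simp, subst add_nonneg_eq_0_iff) auto
  then show ?thesis by (auto simp: crit_def)
qed

lemma continuous_on_crit_defect [continuous_intros]:
  "continuous_on S f \<Longrightarrow> continuous_on S (\<lambda>x. crit_defect p J a b (f x))"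
  unfolding crit_defect_def by (intro continuous_intros)

lemma measurable_crit_defect:
  assumes J: "\<And>i. length i = p \<Longrightarrow> (\<lambda>w. J w i) \<in> borel_measurable M"
  shows "(\<lambda>w. crit_defect p (J w) a b x) \<in> borel_measurable M"
proof -
  have [measurable]: "(\<lambda>w. homf p (J w) x) \<in> borel_measurable M"
    unfolding homf_def using J by (intro borel_measurable_sum borel_measurable_times) auto
  have [measurable]: "(\<lambda>w. homg p (J w) x) \<in> borel_measurable M"
    unfolding homg_def using J by (intro borel_measurable_sum borel_measurable_scaleR) auto
  show ?thesis unfolding crit_defect_def by measurable
qed

lemma cnt_crit_measurable:
  fixes J :: "'w \<Rightarrow> 'n::finite list \<Rightarrow> real"
  assumes J: "\<And>i. length i = p \<Longrightarrow> (\<lambda>w. J w i) \<in> borel_measurable M"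
    and K: "closed K"
  shows "(\<lambda>w. cnt (crit p (J w) {a..b} \<inter> K)) \<in> borel_measurable M"
proof -
  have "crit p (J w) {a..b} \<inter> K = {x \<in> sphere 0 1 \<inter> K. crit_defect p (J w) a b x = 0}" for w
    by (auto simp: crit_eq_defect)
  moreover have "(\<lambda>w. cnt {x \<in> sphere 0 1 \<inter> K. crit_defect p (J w) a b x = 0}) \<in> borel_measurable M"
    using K by (intro cnt_zeros_measurable compact_Int_closed measurable_crit_defect J)
      (auto intro!: continuous_intros)
  ultimately show ?thesis by simp
qed

section \<open>Rotation invariance\<close>

definition gam :: "nat \<Rightarrow> ('n::finite list \<Rightarrow> real) measure" where
  "gam p = PiM {i. length i = p} (\<lambda>_. stdN)"

lemma prob_space_gam: "prob_space (gam p)"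
  unfolding gam_def by (intro prob_space_PiM prob_space_stdN)

lemma measurable_gam_component [simp]:
  "length i = p \<Longrightarrow> (\<lambda>J. J i) \<in> borel_measurable (gam p)"
  unfolding gam_def by (rule measurable_compose[OF measurable_component_singleton]) (auto simp: stdN_def)

lemma sum_lists_Suc:
  "(\<Sum>i | length i = Suc q. h i) = (\<Sum>a\<in>UNIV. \<Sum>j | length j = q. h (a # j))"
  for h :: "'n::finite list \<Rightarrow> 'b::comm_monoid_add"
proof -
  have "(\<Sum>a\<in>UNIV. \<Sum>j | length j = q. h (a # j)) = (\<Sum>(a, j)\<in>UNIV \<times> {j. length j = q}. h (a # j))"
    by (simp add: sum.cartesian_product)
  also have "\<dots> = (\<Sum>i | length i = Suc q. h i)"
    by (rule sum.reindex_bij_witness[of _ "\<lambda>i. (hd i, tl i)" "\<lambda>(a, j). a # j"])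
      (auto simp: length_Suc_conv)
  finally show ?thesis ..
qed

lemma sum_lists_Suc_snoc:
  "(\<Sum>i | length i = Suc q. h i) = (\<Sum>a\<in>UNIV. \<Sum>j | length j = q. h (j @ [a]))"
  for h :: "'n::finite list \<Rightarrow> 'b::comm_monoid_add"
proof -
  have "(\<Sum>a\<in>UNIV. \<Sum>j | length j = q. h (j @ [a])) = (\<Sum>(a, j)\<in>UNIV \<times> {j. length j = q}. h (j @ [a]))"
    by (simp add: sum.cartesian_product)
  also have "\<dots> = (\<Sum>i | length i = Suc q. h i)"
    by (rule sum.reindex_bij_witness[of _ "\<lambda>i. (last i, butlast i)" "\<lambda>(a, j). j @ [a]"])
      (auto simp: append_butlast_last_id[symmetric] simp del: append_butlast_last_id, (metis append_butlast_last_id length_0_conv nat.distinct(1))+)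
  finally show ?thesis ..
qed

fun vmon :: "'n::finite list \<Rightarrow> (real^'n) list \<Rightarrow> real" where
  "vmon (a # i) (x # xs) = x $ a * vmon i xs"
| "vmon _ _ = 1"

text \<open>The multilinear form whose diagonal is \<open>homf\<close>. Separate arguments make it
  possible to rotate one slot at a time.\<close>

definition mlin :: "('n::finite list \<Rightarrow> real) \<Rightarrow> (real^'n) list \<Rightarrow> real" where
  "mlin J xs = (\<Sum>i | length i = length xs. J i * vmon i xs)"

lemma vmon_snoc: "length i = length xs \<Longrightarrow> vmon (i @ [a]) (xs @ [x]) = vmon i xs * x $ a"
  by (induction i xs rule: list_induct2) auto

lemma vmon_replicate: "vmon i (replicate (length i) x) = mon i x"
  by (induction i) auto

lemma homf_mlin: "homf p J x = mlin J (replicate p x)"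
  unfolding homf_def mlin_def using vmon_replicate[of _ x] by (intro sum.cong) auto

text \<open>Transforms the first slot of the tensor \<open>J\<close> and moves it to the end, so that the \<open>p\<close>-th iterate
  transforms all slots.\<close>
definition rot_shift :: "nat \<Rightarrow> (real^'n \<Rightarrow> real^'n) \<Rightarrow> ('n::finite list \<Rightarrow> real) \<Rightarrow> 'n list \<Rightarrow> real" where
  "rot_shift p g J = (\<lambda>i\<in>{i. length i = p}. g (\<chi> a. J (a # butlast i)) $ last i)"

text \<open>Moving \<open>g\<close> across the inner product in the first slot turns it into its
  adjoint \<open>f\<close>, acting on the argument. The transformed index has become the last one,
  hence the place of \<open>z\<close> at the end of the list.\<close>

lemma mlin_rot_shift:
  fixes f g :: "real^'n::finite \<Rightarrow> real^'n"
  assumes adj: "\<And>v z. g v \<bullet> z = v \<bullet> f z"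
  shows "mlin (rot_shift (Suc (length ys)) g J) (ys @ [z]) = mlin J (f z # ys)"
proof -
  have "mlin (rot_shift (Suc (length ys)) g J) (ys @ [z]) =
    (\<Sum>a\<in>UNIV. \<Sum>j | length j = length ys. g (\<chi> a. J (a # j)) $ a * (vmon j ys * z $ a))"
    unfolding mlin_def
    by (simp add: sum_lists_Suc_snoc rot_shift_def, intro sum.cong refl) (simp add: vmon_snoc)
  also have "\<dots> = (\<Sum>j | length j = length ys. vmon j ys * (g (\<chi> a. J (a # j)) \<bullet> z))"
    by (subst sum.swap) (simp add: inner_vec_def sum_distrib_left mult_ac)
  also have "\<dots> = (\<Sum>j | length j = length ys. vmon j ys * ((\<chi> a. J (a # j)) \<bullet> f z))"
    by (simp add: adj)
  also have "\<dots> = (\<Sum>a\<in>UNIV. \<Sum>j | length j = length ys. J (a # j) * vmon (a # j) (f z # ys))"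
    by (subst sum.swap) (simp add: inner_vec_def sum_distrib_left mult_ac)
  also have "\<dots> = mlin J (f z # ys)"
    unfolding mlin_def by (simp add: sum_lists_Suc)
  finally show ?thesis .
qed

text \<open>Reverse induction: the latest shift has its transformed index at the end, so the
  arguments are taken from the end of \<open>zs\<close> and reappear rotated at the front. For
  \<open>ys = []\<close> every slot is rotated once and the order is restored.\<close>

lemma mlin_rot_shift_funpow:
  fixes f g :: "real^'n::finite \<Rightarrow> real^'n"
  assumes adj: "\<And>v z. g v \<bullet> z = v \<bullet> f z"
  shows "length ys + length zs = p \<Longrightarrow> mlin ((rot_shift p g ^^ length zs) J) (ys @ zs) = mlin J (map f zs @ ys)"
proof (induction zs arbitrary: ys rule: rev_induct)
  case (snoc z zs)
  have "mlin ((rot_shift p g ^^ length (zs @ [z])) J) (ys @ zs @ [z]) =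
    mlin (rot_shift (Suc (length (ys @ zs))) g ((rot_shift p g ^^ length zs) J)) ((ys @ zs) @ [z])"
    using snoc.prems by simp
  also have "\<dots> = mlin ((rot_shift p g ^^ length zs) J) ((f z # ys) @ zs)"
    by (subst mlin_rot_shift[OF adj]) simp
  also have "\<dots> = mlin J (map f zs @ (f z # ys))"
    by (rule snoc.IH) (use snoc.prems in simp)
  finally show ?case by simp
qed simp

lemma homf_rot_shift_funpow:
  fixes f g :: "real^'n::finite \<Rightarrow> real^'n"
  assumes adj: "\<And>v z. g v \<bullet> z = v \<bullet> f z"
  shows "homf p ((rot_shift p g ^^ p) J) x = homf p J (f x)"
  using mlin_rot_shift_funpow[OF adj, of "[]" "replicate p x" p J] by (simp add: homf_mlin)

text \<open>Packing undoes unpacking, so it carries the flat law back to the law of independent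
  vectors.\<close>

lemma PiM_gaussN_pack:
  assumes bij: "bij_betw (\<lambda>i. (\<beta> i, \<alpha> i)) I (K \<times> (UNIV :: 'n::finite set))" and fin: "finite I" "finite K"
    and d: "\<And>j a. j \<in> K \<Longrightarrow> d j a \<in> I \<and> \<beta> (d j a) = j \<and> \<alpha> (d j a) = a"
  shows "distr (PiM I (\<lambda>_. stdN)) (PiM K (\<lambda>_. gaussN)) (\<lambda>J. \<lambda>j\<in>K. \<chi> a::'n. J (d j a)) =
    PiM K (\<lambda>_. gaussN :: (real^'n) measure)" (is "distr ?I ?K ?E = _")
proof -
  let ?D = "\<lambda>w::'b \<Rightarrow> real^'n. \<lambda>i\<in>I. w (\<beta> i) $ \<alpha> i"
  have \<beta>K: "\<beta> i \<in> K" if "i \<in> I" for i using bij that by (auto simp: bij_betw_def)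
  have D: "?D \<in> ?K \<rightarrow>\<^sub>M ?I"
    by (intro measurable_restrict measurable_compose[OF measurable_component_singleton[OF \<beta>K]])
      (auto simp: measurable_vec_nth)
  have E: "?E \<in> ?I \<rightarrow>\<^sub>M ?K"
  proof (rule measurable_restrict)
    fix j assume "j \<in> K"
    have "(\<lambda>J. \<chi> a. J (d j a)) \<in> borel_measurable ?I"
    proof (rule measurable_vecI)
      fix a
      have "(\<lambda>J. J (d j a)) \<in> ?I \<rightarrow>\<^sub>M stdN"
        using d[OF \<open>j \<in> K\<close>] by (intro measurable_component_singleton) auto
      then show "(\<lambda>J. (\<chi> a. J (d j a)) $ a) \<in> borel_measurable ?I" by (simp cong: measurable_cong_sets)
    qed
    then show "(\<lambda>J. \<chi> a. J (d j a)) \<in> ?I \<rightarrow>\<^sub>M gaussN" by (simp cong: measurable_cong_sets)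
  qed
  have "distr ?I ?K ?E = distr (distr ?K ?I ?D) ?K ?E"
    by (simp only: PiM_gaussN_unpack[OF bij fin])
  also have "\<dots> = distr ?K ?K (?E \<circ> ?D)" by (rule distr_distr[OF E D])
  also have "\<dots> = distr ?K ?K (\<lambda>w. w)"
  proof (rule distr_cong)
    fix w assume "w \<in> space ?K"
    then have w: "w \<in> extensional K" by (auto simp: space_PiM PiE_iff)
    show "(?E \<circ> ?D) w = w"
    proof
      fix j show "(?E \<circ> ?D) w j = w j"
        using d[of j] w by (cases "j \<in> K") (auto simp: vec_eq_iff extensional_def)
    qed
  qed simp_all
  finally show ?thesis by (simp add: distr_id)
qed

lemma bij_betw_butlast_last:
  "bij_betw (\<lambda>i. (butlast i, last i)) {i :: 'n::finite list. length i = Suc q} ({j. length j = q} \<times> UNIV)"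
  by (rule bij_betwI[where g = "\<lambda>(j, a). j @ [a]"]) (auto intro!: append_butlast_last_id)

lemma bij_betw_tl_hd:
  "bij_betw (\<lambda>i. (tl i, hd i)) {i :: 'n::finite list. length i = Suc q} ({j. length j = q} \<times> UNIV)"
  by (rule bij_betwI[where g = "\<lambda>(j, a). a # j"]) (auto simp: length_Suc_conv)

lemma measurable_orthogonal_transformation:
  fixes f :: "real^'n::finite \<Rightarrow> real^'n"
  assumes "orthogonal_transformation f"
  shows "f \<in> borel_measurable borel"
  using assms unfolding orthogonal_transformation_def
  by (intro borel_measurable_continuous_onI linear_continuous_on linear_conv_bounded_linear[THEN iffD1]) auto

text \<open>One shift packs the couplings by the tail of the index list, rotates each vector so
  obtained, and unpacks with the rotated index at the end. Each of the three respects the Gaussian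
  laws.\<close>

lemma rot_shift_gam:
  fixes g :: "real^'n::{finite,wellorder} \<Rightarrow> real^'n::_"
  assumes g: "orthogonal_transformation g"
  shows "rot_shift (Suc q) g \<in> gam (Suc q) \<rightarrow>\<^sub>M gam (Suc q)" (is ?m)
    and "distr (gam (Suc q)) (gam (Suc q)) (rot_shift (Suc q) g) = gam (Suc q)" (is ?d)
proof -
  let ?I = "PiM {i :: 'n list. length i = Suc q} (\<lambda>_. stdN)"
  let ?K = "PiM {j :: 'n list. length j = q} (\<lambda>_. gaussN :: (real^'n::_) measure)"
  let ?E = "\<lambda>J. \<lambda>j\<in>{j :: 'n list. length j = q}. \<chi> a::'n. (J (a # j) :: real)"
  let ?C = "compose {j :: 'n list. length j = q} g"
  let ?D = "\<lambda>w::'n list \<Rightarrow> real^'n::_. \<lambda>i\<in>{i. length i = Suc q}. w (butlast i) $ last i"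
  have eq: "rot_shift (Suc q) g J = (?D \<circ> (?C \<circ> ?E)) J" for J
    by (auto simp: rot_shift_def compose_def fun_eq_iff)
  have gm: "g \<in> gaussN \<rightarrow>\<^sub>M gaussN"
    using measurable_orthogonal_transformation[OF g] by (simp cong: measurable_cong_sets)
  have E: "?E \<in> ?I \<rightarrow>\<^sub>M ?K"
  proof (rule measurable_restrict)
    fix j :: "'n list" assume j: "j \<in> {j. length j = q}"
    have "(\<lambda>J. \<chi> a. J (a # j)) \<in> borel_measurable ?I"
    proof (rule measurable_vecI)
      fix a
      have "(\<lambda>J. J (a # j)) \<in> ?I \<rightarrow>\<^sub>M stdN"
        using j by (intro measurable_component_singleton) auto
      then show "(\<lambda>J. (\<chi> a. J (a # j)) $ a) \<in> borel_measurable ?I" by (simp cong: measurable_cong_sets)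
    qed
    then show "(\<lambda>J. \<chi> a. J (a # j)) \<in> ?I \<rightarrow>\<^sub>M gaussN" by (simp cong: measurable_cong_sets)
  qed
  have C: "?C \<in> ?K \<rightarrow>\<^sub>M ?K"
    unfolding compose_def
    by (intro measurable_restrict measurable_compose[OF _ gm] measurable_component_singleton)
  have D: "?D \<in> ?K \<rightarrow>\<^sub>M ?I"
    by (intro measurable_restrict measurable_compose[OF measurable_component_singleton])
      (auto simp: measurable_vec_nth)
  have CE: "?C \<circ> ?E \<in> ?I \<rightarrow>\<^sub>M ?K" using E C by (rule measurable_comp)
  have "?D \<circ> (?C \<circ> ?E) \<in> ?I \<rightarrow>\<^sub>M ?I" using CE D by (rule measurable_comp)
  then show ?m unfolding gam_def by (simp add: eq[abs_def] comp_def)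
  have "distr ?I ?I (?D \<circ> (?C \<circ> ?E)) = distr (distr (distr ?I ?K ?E) ?K ?C) ?I ?D"
    by (simp only: distr_distr[OF C E] distr_distr[OF D CE])
  also have "distr ?I ?K ?E = ?K"
    by (rule PiM_gaussN_pack[OF bij_betw_tl_hd]) auto
  also have "distr ?K ?K ?C = ?K"
    using distr_PiM_finite_prob_space'[of "{j :: 'n list. length j = q}" "\<lambda>_. gaussN" "\<lambda>_. gaussN" g]
      prob_space_gaussN gm by (simp add: gaussN_orthogonal_transformation[OF g])
  also have "distr ?K ?I ?D = ?I"
    by (rule PiM_gaussN_unpack[OF bij_betw_butlast_last]) auto
  finally show ?d unfolding gam_def ext[of "rot_shift (Suc q) g", OF eq] .
qed

lemma rot_shift_funpow_gam:
  fixes g :: "real^'n::{finite,wellorder} \<Rightarrow> real^'n::_"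
  assumes g: "orthogonal_transformation g" and p: "p \<ge> 1"
  shows "(rot_shift p g ^^ m) \<in> gam p \<rightarrow>\<^sub>M gam p"
    and "distr (gam p) (gam p) (rot_shift p g ^^ m) = gam p"
proof -
  obtain q where q: "p = Suc q" using p by (cases p) auto
  have *: "(rot_shift p g ^^ m) \<in> gam p \<rightarrow>\<^sub>M gam p \<and> distr (gam p) (gam p) (rot_shift p g ^^ m) = gam p"
  proof (induction m)
    case 0
    show ?case by (auto simp: distr_id2)
  next
    case (Suc m)
    have m: "rot_shift p g \<in> gam p \<rightarrow>\<^sub>M gam p" and d: "distr (gam p) (gam p) (rot_shift p g) = gam p"
      using rot_shift_gam[OF g, of q] by (simp_all add: q)
    have "distr (gam p) (gam p) (rot_shift p g \<circ> (rot_shift p g ^^ m)) =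
      distr (distr (gam p) (gam p) (rot_shift p g ^^ m)) (gam p) (rot_shift p g)"
      using Suc.IH m distr_distr[of "rot_shift p g" "gam p" "gam p" "rot_shift p g ^^ m" "gam p"] by metis
    moreover have "rot_shift p g \<circ> (rot_shift p g ^^ m) \<in> gam p \<rightarrow>\<^sub>M gam p"
      using Suc.IH m by (blast intro: measurable_comp)
    ultimately show ?case using Suc.IH d by (metis funpow.simps(2))
  qed
  then show "(rot_shift p g ^^ m) \<in> gam p \<rightarrow>\<^sub>M gam p"
    and "distr (gam p) (gam p) (rot_shift p g ^^ m) = gam p" by auto
qed

text \<open>By the chain rule the gradient of \<open>homf p J'\<close> at \<open>x\<close> is
  \<open>g\<close> applied to that of \<open>homf p J\<close> at \<open>f x\<close>, and
  \<open>g\<close> is the inverse of \<open>f\<close>; the Lagrange equation is carried over with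
  the same multiplier.\<close>

lemma crit_rot:
  fixes f g :: "real^'n::finite \<Rightarrow> real^'n"
  assumes f: "orthogonal_transformation f" and adj: "\<And>v z. g v \<bullet> z = v \<bullet> f z"
    and h: "\<And>x. homf p J' x = homf p J (f x)"
  shows "x \<in> crit p J' B \<longleftrightarrow> f x \<in> crit p J B"
proof -
  have lf: "linear f" using f by (simp add: orthogonal_transformation_def)
  have fg: "f (g v) = v" for v
  proof -
    obtain w where w: "v = f w" using orthogonal_transformation_surj[OF f] by (metis surjD)
    have "g v \<bullet> z = w \<bullet> z" for z
      using f by (simp add: adj w orthogonal_transformation_def)
    then have "g v = w" by (metis vector_eq_rdot)
    then show ?thesis by (simp add: w)
  qed
  have "(homf p J \<circ> f has_derivative (\<lambda>h. homg p J (f x) \<bullet> h) \<circ> f) (at x)"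
    using lf by (intro diff_chain_at has_derivative_homf bounded_linear_imp_has_derivative linear_conv_bounded_linear[THEN iffD1])
  moreover have "homf p J \<circ> f = homf p J'" using h by (simp add: fun_eq_iff)
  ultimately have "(\<lambda>h. homg p J (f x) \<bullet> h) \<circ> f = (\<lambda>h. homg p J' x \<bullet> h)"
    using has_derivative_unique[OF _ has_derivative_homf] by metis
  then have "homg p J' x \<bullet> z = g (homg p J (f x)) \<bullet> z" for z
    by (simp add: fun_eq_iff adj)
  then have "homg p J' x = g (homg p J (f x))" by (metis vector_eq_rdot)
  then have e: "f (homg p J' x) = homg p J (f x)" by (simp add: fg)
  have inj: "inj f" using orthogonal_transformation_inj[OF f] .
  have "homg p J' x = (real p * homf p J' x) *\<^sub>R x \<longleftrightarrow> f (homg p J' x) = f ((real p * homf p J' x) *\<^sub>R x)"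
    using inj by (simp add: inj_eq)
  also have "\<dots> \<longleftrightarrow> homg p J (f x) = (real p * homf p J (f x)) *\<^sub>R f x"
    by (simp add: e h linear_scale[OF lf])
  finally show ?thesis by (simp add: crit_def h orthogonal_transformation_norm[OF f])
qed

definition cap_mean :: "nat \<Rightarrow> real set \<Rightarrow> real \<Rightarrow> real^'n::finite \<Rightarrow> ennreal" where
  "cap_mean p B \<theta> c = (\<integral>\<^sup>+J. cnt (crit p J B \<inter> {x. c \<bullet> x \<ge> \<theta>}) \<partial>gam p)"

lemma closed_cap [simp]: "closed {x::'a::real_inner. c \<bullet> x \<ge> \<theta>}"
  by (intro closed_Collect_le continuous_intros)

text \<open>A rotation \<open>f\<close> taking \<open>c\<close> to \<open>d\<close> is compensated
  by the law-preserving change of couplings that composes the polynomial with \<open>f\<close>. The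
  critical points in one cap are then mapped bijectively onto those in the other.\<close>

lemma cap_mean_rot:
  fixes c d :: "real^'n::{finite,wellorder}"
  assumes p: "p \<ge> 1" and cd: "norm c = norm d"
  shows "cap_mean p {a..b} \<theta> c = cap_mean p {a..b} \<theta> d"
proof -
  obtain f where f: "orthogonal_transformation f" "f c = d"
    using orthogonal_transformation_exists[OF cd] by blast
  define g where "g = adjoint f"
  have lf: "linear f" using f by (simp add: orthogonal_transformation_def)
  have adj: "g v \<bullet> z = v \<bullet> f z" for v z
    unfolding g_def by (metis adjoint_works[OF lf] inner_commute)
  have g: "orthogonal_transformation g"
  proof -
    have "orthogonal_matrix (matrix f)" using f(1) by (simp add: orthogonal_transformation_matrix)
    then have "orthogonal_matrix (Finite_Cartesian_Product.transpose (matrix f))" by simp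
    moreover have "linear g" unfolding g_def by (rule adjoint_linear[OF lf])
    moreover have "matrix g = Finite_Cartesian_Product.transpose (matrix f)"
      unfolding g_def by (rule matrix_adjoint[OF lf])
    ultimately show ?thesis by (simp add: orthogonal_transformation_matrix)
  qed
  let ?T = "rot_shift p g ^^ p"
  have m: "(\<lambda>J. cnt (crit p J {a..b} \<inter> {x. e \<bullet> x \<ge> \<theta>})) \<in> borel_measurable (gam p)" for e :: "real^'n::_"
    by (rule cnt_crit_measurable) auto
  have "cap_mean p {a..b} \<theta> c = (\<integral>\<^sup>+J. cnt (crit p J {a..b} \<inter> {x. c \<bullet> x \<ge> \<theta>}) \<partial>distr (gam p) (gam p) ?T)"
    by (simp add: cap_mean_def rot_shift_funpow_gam[OF g p])
  also have "\<dots> = (\<integral>\<^sup>+J. cnt (crit p (?T J) {a..b} \<inter> {x. c \<bullet> x \<ge> \<theta>}) \<partial>gam p)"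
    by (rule nn_integral_distr[OF rot_shift_funpow_gam(1)[OF g p]]) (simp add: m)
  also have "\<dots> = (\<integral>\<^sup>+J. cnt (crit p J {a..b} \<inter> {x. d \<bullet> x \<ge> \<theta>}) \<partial>gam p)"
  proof (rule nn_integral_cong)
    fix J :: "'n list \<Rightarrow> real"
    have "bij_betw f (crit p (?T J) {a..b} \<inter> {x. c \<bullet> x \<ge> \<theta>}) (crit p J {a..b} \<inter> {x. d \<bullet> x \<ge> \<theta>})"
      unfolding bij_betw_def
    proof (intro conjI)
      show "inj_on f (crit p (?T J) {a..b} \<inter> {x. c \<bullet> x \<ge> \<theta>})"
        using orthogonal_transformation_inj[OF f(1)] by (rule inj_on_subset) simp
      have i: "d \<bullet> f x = c \<bullet> x" for x using f by (auto simp: orthogonal_transformation_def)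
      show "f ` (crit p (?T J) {a..b} \<inter> {x. c \<bullet> x \<ge> \<theta>}) = crit p J {a..b} \<inter> {x. d \<bullet> x \<ge> \<theta>}" (is "f ` ?X = ?Y")
      proof -
        have "x \<in> ?X \<longleftrightarrow> f x \<in> ?Y" for x
          using crit_rot[OF f(1) adj homf_rot_shift_funpow[OF adj, of p J]] i by auto
        moreover have "surj f" using orthogonal_transformation_surj[OF f(1)] .
        moreover have "f ` (f -` ?Y) = ?Y" using \<open>surj f\<close> by (rule surj_image_vimage_eq)
        ultimately show ?thesis by (metis (no_types, lifting) Set.set_eqI vimage_eq)
      qed
    qed
    then show "cnt (crit p (?T J) {a..b} \<inter> {x. c \<bullet> x \<ge> \<theta>}) = cnt (crit p J {a..b} \<inter> {x. d \<bullet> x \<ge> \<theta>})"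
      by (rule cnt_bij_betw)
  qed
  finally show ?thesis by (simp add: cap_mean_def)
qed

section \<open>The critical equations near a pole\<close>

definition off_pole :: "'n::finite \<Rightarrow> real^'n \<Rightarrow> real^'n" where
  "off_pole k z = z - z $ k *\<^sub>R axis k 1"

text \<open>Central projection uses this point of the tangent plane at the pole. The coordinate
  \<open>z $ k\<close> does not enter and is thereby free to hold the energy.\<close>

definition chart_point :: "'n::finite \<Rightarrow> real^'n \<Rightarrow> real^'n" where
  "chart_point k z = off_pole k z + axis k 1"

text \<open>The couplings \<open>J(a, k, \<dots>, k)\<close> are set to 0. They form the vector that the critical equations are
  solved for.\<close>
definition other_couplings :: "nat \<Rightarrow> 'n \<Rightarrow> ('n::finite list \<Rightarrow> real) \<Rightarrow> 'n list \<Rightarrow> real" where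
  "other_couplings p k J i = (if tl i = replicate (p - 1) k then 0 else J i)"

text \<open>The chart sends \<open>z\<close> to the unit vector along \<open>chart_point k z\<close>, with \<open>z $ k\<close> as its energy. That this vector is
  a critical point of that energy means that the vector of the couplings \<open>J(a, k, \<dots>, k)\<close> equals \<open>crit_map p k J z\<close>.\<close>
definition crit_map :: "nat \<Rightarrow> 'n \<Rightarrow> ('n::finite list \<Rightarrow> real) \<Rightarrow> real^'n \<Rightarrow> real^'n" where
  "crit_map p k J z = (real p * z $ k * norm (chart_point k z) ^ (p - 2)) *\<^sub>R chart_point k z - homg p (other_couplings p k J) (chart_point k z)
     - ((real p - 1) * (z $ k * norm (chart_point k z) ^ p - homf p (other_couplings p k J) (chart_point k z))) *\<^sub>R axis k 1"

lemma off_pole_nth: "off_pole k z $ a = (if a = k then 0 else z $ a)"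
  by (simp add: off_pole_def axis_def)

lemma chart_point_nth: "chart_point k z $ a = (if a = k then 1 else z $ a)"
  by (simp add: chart_point_def off_pole_nth axis_def)

lemma norm_chart_point: "(norm (chart_point k z))\<^sup>2 = 1 + (norm (off_pole k z))\<^sup>2"
proof -
  have "off_pole k z \<bullet> axis k 1 = 0" by (simp add: inner_axis off_pole_nth)
  then show ?thesis
    unfolding chart_point_def power2_norm_eq_inner by (simp add: inner_add_left inner_add_right inner_commute inner_axis_axis)
qed

lemma norm_chart_point_pos: "norm (chart_point k z) > 0" "norm (chart_point k z) \<ge> 1" "chart_point k z \<noteq> 0"
proof -
  show 1: "norm (chart_point k z) \<ge> 1"
    using power2_le_imp_le[of 1 "norm (chart_point k z)"] norm_chart_point[of k z] by simp
  then show "norm (chart_point k z) > 0" by linarith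
  then show "chart_point k z \<noteq> 0" by auto
qed

lemma mon_replicate: "mon (replicate m k) y = (y $ k) ^ m"
  by (induction m) auto

lemma gmon_replicate: "y $ k = 1 \<Longrightarrow> gmon (replicate m k) y = real m *\<^sub>R axis k 1"
  by (induction m) (auto simp: mon_replicate algebra_simps)

lemma sum_lists_split:
  fixes h :: "'n::finite list \<Rightarrow> 'b::real_vector"
  assumes "p \<ge> 1"
  shows "(\<Sum>i | length i = p. J i *\<^sub>R h i) =
    (\<Sum>i | length i = p. other_couplings p k J i *\<^sub>R h i) + (\<Sum>a\<in>UNIV. J (a # replicate (p - 1) k) *\<^sub>R h (a # replicate (p - 1) k))"
proof -
  let ?r = "replicate (p - 1) k"
  let ?I1 = "range (\<lambda>a. a # ?r)"
  have sub: "?I1 \<subseteq> {i. length i = p}" using assms by auto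
  have *: "i \<in> ?I1 \<longleftrightarrow> tl i = ?r" if "length i = p" for i
    using that assms by (cases i) auto
  have "(\<Sum>i | length i = p. J i *\<^sub>R h i) =
    (\<Sum>i | length i = p. other_couplings p k J i *\<^sub>R h i) + (\<Sum>i | length i = p. if i \<in> ?I1 then J i *\<^sub>R h i else 0)"
    unfolding sum.distrib[symmetric] by (intro sum.cong refl) (use * in \<open>auto simp: other_couplings_def\<close>)
  also have "(\<Sum>i | length i = p. if i \<in> ?I1 then J i *\<^sub>R h i else 0) = (\<Sum>i\<in>?I1. J i *\<^sub>R h i)"
    using sub by (subst sum.inter_restrict[symmetric]) (auto simp: Int_absorb1 intro!: sum.cong)
  also have "\<dots> = (\<Sum>a\<in>UNIV. J (a # ?r) *\<^sub>R h (a # ?r))"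
    by (subst sum.reindex) (auto simp: inj_on_def)
  finally show ?thesis .
qed

lemma homf_split:
  assumes "p \<ge> 1" "y $ k = 1" and v: "\<And>a. J (a # replicate (p - 1) k) = v $ a"
  shows "homf p J y = homf p (other_couplings p k J) y + v \<bullet> y"
  using sum_lists_split[OF assms(1), of J "\<lambda>i. mon i y" k] assms(2)
  by (simp add: homf_def v mon_replicate inner_vec_def del: One_nat_def)

text \<open>The term along \<open>axis k 1\<close> comes from differentiating the
  \<open>p - 1\<close> trailing factors \<open>y $ k\<close>, all equal to 1.\<close>

lemma homg_split:
  assumes "p \<ge> 1" "y $ k = 1" and v: "\<And>a. J (a # replicate (p - 1) k) = v $ a"
  shows "homg p J y = homg p (other_couplings p k J) y + v + ((real p - 1) * (v \<bullet> y)) *\<^sub>R axis k 1"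
proof -
  have "(\<Sum>a\<in>UNIV. v $ a *\<^sub>R gmon (a # replicate (p - 1) k) y) =
    (\<Sum>a\<in>UNIV. v $ a *\<^sub>R axis a 1) + (\<Sum>a\<in>UNIV. ((real p - 1) * (v $ a * y $ a)) *\<^sub>R axis k 1)"
    unfolding sum.distrib[symmetric] using assms(1,2)
    by (intro sum.cong refl) (simp add: mon_replicate gmon_replicate scaleR_add_right of_nat_diff mult_ac)
  also have "(\<Sum>a\<in>UNIV. v $ a *\<^sub>R axis a 1) = v"
    by (simp add: Finite_Cartesian_Product.vec_eq_iff axis_def if_distrib[of "\<lambda>x. _ * x"] cong: if_cong)
  also have "(\<Sum>a\<in>UNIV. ((real p - 1) * (v $ a * y $ a)) *\<^sub>R axis k 1) =
      ((real p - 1) * (v \<bullet> y)) *\<^sub>R (axis k 1 :: real^'a)"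
    by (simp add: scaleR_sum_left[symmetric] inner_vec_def sum_distrib_left)
  finally show ?thesis
    using sum_lists_split[OF assms(1), of J "\<lambda>i. gmon i y" k] by (simp add: homg_def v del: One_nat_def)
qed

lemma norm_power_split: "p \<ge> 2 \<Longrightarrow> norm y ^ p = norm y ^ (p - 2) * (y \<bullet> y)"
  by (metis add_diff_inverse_nat dot_square_norm mult.commute not_less power_add)

text \<open>The critical equation is linear in \<open>v\<close> but contains
  \<open>v \<bullet> y\<close> in its component along the pole, where \<open>y\<close> is the chart
  point. Pairing it with \<open>y\<close> and using Euler's identity determines
  \<open>v \<bullet> y\<close>, after which \<open>v\<close> is explicit. The powers of the norm
  appear because \<open>y\<close> is not normalised.\<close>

lemma crit_map_eq_iff:
  assumes p: "p \<ge> 2" and v: "\<And>a. J (a # replicate (p - 1) k) = v $ a"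
  shows "crit_map p k J z = v \<longleftrightarrow>
    homg p J (chart_point k z) = (real p * z $ k * norm (chart_point k z) ^ (p - 2)) *\<^sub>R chart_point k z" (is "?L \<longleftrightarrow> ?R")
    and "crit_map p k J z = v \<Longrightarrow> homf p J (chart_point k z) = z $ k * norm (chart_point k z) ^ p"
proof -
  define y where "y = chart_point k z"
  define t where "t = z $ k"
  define b where "b = (real p * t * norm y ^ (p - 2)) *\<^sub>R y - homg p (other_couplings p k J) y"
  define e where "e = t * norm y ^ p - homf p (other_couplings p k J) y"
  have yk: "y $ k = 1" by (simp add: y_def chart_point_nth)
  have p1: "p \<ge> 1" using p by simp
  have bdy: "b \<bullet> y = real p * e"
    unfolding b_def e_def norm_power_split[OF p] by (simp add: inner_diff_left homg_euler algebra_simps)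
  have G: "crit_map p k J z = b - ((real p - 1) * e) *\<^sub>R axis k 1"
    by (simp add: crit_map_def b_def e_def y_def t_def)
  have R: "?R \<longleftrightarrow> v + ((real p - 1) * (v \<bullet> y)) *\<^sub>R axis k 1 = b"
    using homg_split[OF p1 yk v] by (auto simp: y_def[symmetric] t_def[symmetric] b_def algebra_simps)
  have LR: "v \<bullet> y = e" if ?L
  proof -
    have "v \<bullet> y = b \<bullet> y - (real p - 1) * e * (axis k 1 \<bullet> y)"
      using that unfolding G by (auto simp: inner_diff_left)
    also have "\<dots> = e" by (simp add: bdy inner_axis' yk algebra_simps)
    finally show ?thesis .
  qed
  show "?L \<longleftrightarrow> ?R"
  proof
    assume ?L
    with LR R G show ?R by (metis diff_add_cancel)
  next
    assume ?R
    then have vb: "v + ((real p - 1) * (v \<bullet> y)) *\<^sub>R axis k 1 = b" using R by simp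
    then have "(v + ((real p - 1) * (v \<bullet> y)) *\<^sub>R axis k 1) \<bullet> y = real p * e" using bdy by simp
    then have "real p * (v \<bullet> y) = real p * e"
      by (simp add: inner_add_left inner_axis' yk algebra_simps)
    then have "v \<bullet> y = e" using p by simp
    then show ?L using vb G by (metis add_diff_cancel)
  qed
  show "homf p J (chart_point k z) = z $ k * norm (chart_point k z) ^ p" if ?L
    using LR[OF that] homf_split[OF p1 yk v] by (simp add: e_def y_def t_def)
qed

definition chart_region :: "'n::finite \<Rightarrow> real \<Rightarrow> real \<Rightarrow> real \<Rightarrow> (real^'n) set" where
  "chart_region k a b r = {z. z $ k \<in> {a..b} \<and> norm (off_pole k z) \<le> r}"

lemma chart_point_scale_back:
  assumes "x $ k \<noteq> 0"
  shows "chart_point k (off_pole k ((1 / x $ k) *\<^sub>R x) + s *\<^sub>R axis k 1) = (1 / x $ k) *\<^sub>R x"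
  using assms by (simp add: Finite_Cartesian_Product.vec_eq_iff chart_point_nth off_pole_nth axis_def)

text \<open>A unit vector \<open>x\<close> in the cap has \<open>x $ k > 0\<close>; division by it
  gives the chart point, and the energy of \<open>x\<close> fills the free coordinate. The height 1
  / sqrt(1 + r^2) arises because \<open>axis k 1 \<bullet> x\<close> is the reciprocal of the norm
  of the chart point.\<close>

lemma chart_bij:
  fixes J :: "'n::finite list \<Rightarrow> real"
  assumes p: "p \<ge> 2" and v: "\<And>a. J (a # replicate (p - 1) k) = v $ a" and r: "r \<ge> 0"
  shows "bij_betw (\<lambda>z. (1 / norm (chart_point k z)) *\<^sub>R chart_point k z) {z \<in> chart_region k a b r. crit_map p k J z = v}
    (crit p J {a..b} \<inter> {x. axis k 1 \<bullet> x \<ge> 1 / sqrt (1 + r\<^sup>2)})" (is "bij_betw ?h ?Z ?X")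
proof (rule bij_betwI[where g = "\<lambda>x. off_pole k ((1 / x $ k) *\<^sub>R x) + homf p J x *\<^sub>R axis k 1"])
  have r0: "0 < sqrt (1 + r\<^sup>2)" by (simp add: add_pos_nonneg)
  have cap: "norm (off_pole k z) \<le> r \<longleftrightarrow> 1 / norm (chart_point k z) \<ge> 1 / sqrt (1 + r\<^sup>2)" for z
  proof -
    have "norm (off_pole k z) \<le> r \<longleftrightarrow> (norm (off_pole k z))\<^sup>2 \<le> r\<^sup>2"
      using r by (simp add: power_mono_iff)
    also have "\<dots> \<longleftrightarrow> (norm (chart_point k z))\<^sup>2 \<le> (sqrt (1 + r\<^sup>2))\<^sup>2"
      by (simp add: norm_chart_point)
    also have "\<dots> \<longleftrightarrow> norm (chart_point k z) \<le> sqrt (1 + r\<^sup>2)"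
      using r0 by (intro power_mono_iff) auto
    also have "\<dots> \<longleftrightarrow> 1 / norm (chart_point k z) \<ge> 1 / sqrt (1 + r\<^sup>2)"
      using r0 norm_chart_point_pos(1)[of k z] by (simp add: field_simps)
    finally show ?thesis .
  qed
  have hf: "homf p J (?h z) = z $ k" if "crit_map p k J z = v" for z
    using crit_map_eq_iff(2)[OF p v that] norm_chart_point_pos(1)[of k z] by (simp add: homf_scale power_divide)
  show "?h \<in> ?Z \<rightarrow> ?X"
  proof
    fix z assume z: "z \<in> ?Z"
    then have G: "crit_map p k J z = v" by simp
    let ?n = "norm (chart_point k z)"
    have n: "?n > 0" by (rule norm_chart_point_pos)
    have "homg p J (?h z) = ((1 / ?n) ^ (p - 1) * (real p * z $ k * ?n ^ (p - 2))) *\<^sub>R chart_point k z"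
      using crit_map_eq_iff(1)[OF p v, of z] G by (simp add: homg_scale)
    also have "(1 / ?n) ^ (p - 1) * (real p * z $ k * ?n ^ (p - 2)) = real p * z $ k * (1 / ?n)"
    proof -
      have "p - 1 = Suc (p - 2)" using p by simp
      then show ?thesis using n by (simp add: power_divide field_simps)
    qed
    finally have "homg p J (?h z) = (real p * homf p J (?h z)) *\<^sub>R ?h z"
      by (simp add: hf[OF G])
    moreover have "norm (?h z) = 1" using n by simp
    moreover have "axis k 1 \<bullet> ?h z = 1 / ?n" unfolding inner_axis' by (simp add: chart_point_nth)
    moreover have "homf p J (?h z) \<in> {a..b}" using z hf[OF G] by (simp add: chart_region_def)
    moreover have "1 / ?n \<ge> 1 / sqrt (1 + r\<^sup>2)" using z cap[of z] by (simp add: chart_region_def)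
    ultimately show "?h z \<in> ?X" unfolding crit_def by (intro IntI CollectI conjI) auto
  qed
  show "(\<lambda>x. off_pole k ((1 / x $ k) *\<^sub>R x) + homf p J x *\<^sub>R axis k 1) \<in> ?X \<rightarrow> ?Z"
  proof
    fix x assume x: "x \<in> ?X"
    define z where "z = off_pole k ((1 / x $ k) *\<^sub>R x) + homf p J x *\<^sub>R axis k 1"
    have xk: "x $ k \<ge> 1 / sqrt (1 + r\<^sup>2)" using x by (simp add: inner_axis')
    moreover have "1 / sqrt (1 + r\<^sup>2) > 0" using r0 by simp
    ultimately have xk0: "x $ k > 0" by linarith
    have y: "chart_point k z = (1 / x $ k) *\<^sub>R x" unfolding z_def using xk0 by (intro chart_point_scale_back) simp
    have n: "norm (chart_point k z) = 1 / x $ k" using x xk0 by (simp add: y crit_def)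
    have t: "z $ k = homf p J x" by (simp add: z_def off_pole_nth)
    have "homg p J (chart_point k z) = (1 / x $ k) ^ (p - 1) *\<^sub>R ((real p * homf p J x) *\<^sub>R x)"
      using x by (simp only: y homg_scale) (simp add: crit_def)
    also have "\<dots> = (real p * z $ k * norm (chart_point k z) ^ (p - 2)) *\<^sub>R chart_point k z"
    proof -
      have "p - 1 = Suc (p - 2)" using p by simp
      then have "(1 / x $ k) ^ (p - 1) = (1 / x $ k) ^ (p - 2) * (1 / x $ k)" by (metis mult.commute power_Suc)
      then show ?thesis unfolding n t unfolding y by (simp only: scaleR_scaleR) (simp add: mult_ac)
    qed
    finally have "crit_map p k J z = v" using crit_map_eq_iff(1)[OF p v] by simp
    moreover have "norm (off_pole k z) \<le> r" using cap[of z] xk unfolding n by simp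
    ultimately show "z \<in> ?Z" using x t by (auto simp: chart_region_def crit_def)
  qed
  show "off_pole k ((1 / ?h z $ k) *\<^sub>R ?h z) + homf p J (?h z) *\<^sub>R axis k 1 = z" if "z \<in> ?Z" for z
  proof -
    have "?h z $ k = 1 / norm (chart_point k z)" by (simp add: chart_point_nth)
    then have "(1 / ?h z $ k) *\<^sub>R ?h z = chart_point k z" using norm_chart_point_pos[of k z] by simp
    then show ?thesis using that hf[of z] by (simp add: Finite_Cartesian_Product.vec_eq_iff off_pole_nth chart_point_nth axis_def)
  qed
  show "?h (off_pole k ((1 / x $ k) *\<^sub>R x) + homf p J x *\<^sub>R axis k 1) = x" if x: "x \<in> ?X" for x
  proof -
    have xk: "x $ k \<ge> 1 / sqrt (1 + r\<^sup>2)" using x by (simp add: inner_axis')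
    moreover have "1 / sqrt (1 + r\<^sup>2) > 0" using r0 by simp
    ultimately have xk0: "x $ k > 0" by linarith
    show ?thesis using x xk0 by (simp add: chart_point_scale_back crit_def)
  qed
qed

text \<open>The part of the derivative that is free of couplings; \<open>dQ\<close> is the
  contribution of one monomial. Here \<open>u\<close> is the derivative of the norm of the chart
  point in direction \<open>h\<close>. For \<open>p = 2\<close> the truncated exponent
  \<open>p - 3\<close> is accompanied by the factor \<open>real (p - 2) = 0\<close>.\<close>

definition dP :: "nat \<Rightarrow> 'n::finite \<Rightarrow> real^'n \<Rightarrow> real^'n \<Rightarrow> real^'n" where
  "dP p k z h = (let y = chart_point k z; y' = off_pole k h; t = z $ k; s = h $ k; u = (y \<bullet> y') / norm y in
     (real p * s * norm y ^ (p - 2)) *\<^sub>R y + (real p * t * (real (p - 2) * norm y ^ (p - 3) * u)) *\<^sub>R y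
     + (real p * t * norm y ^ (p - 2)) *\<^sub>R y'
     - ((real p - 1) * (s * norm y ^ p + t * (real p * norm y ^ (p - 1) * u))) *\<^sub>R axis k 1)"

definition dQ :: "nat \<Rightarrow> 'n::finite \<Rightarrow> 'n list \<Rightarrow> real^'n \<Rightarrow> real^'n \<Rightarrow> real^'n" where
  "dQ p k i z h = hmon i (chart_point k z) (off_pole k h) - ((real p - 1) * (gmon i (chart_point k z) \<bullet> off_pole k h)) *\<^sub>R axis k 1"

definition dcrit_map :: "nat \<Rightarrow> 'n \<Rightarrow> ('n::finite list \<Rightarrow> real) \<Rightarrow> real^'n \<Rightarrow> real^'n \<Rightarrow> real^'n" where
  "dcrit_map p k J z h = dP p k z h - (\<Sum>i | length i = p. other_couplings p k J i *\<^sub>R dQ p k i z h)"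

lemma bounded_linear_off_pole: "bounded_linear (off_pole k)"
  unfolding off_pole_def
  by (intro bounded_linear_sub bounded_linear_ident bounded_linear_scaleR_const bounded_linear_vec_nth)

lemma has_derivative_chart_point: "(chart_point k has_derivative off_pole k) F"
  using has_derivative_add[OF bounded_linear.has_derivative[OF bounded_linear_off_pole has_derivative_ident] has_derivative_const]
  by (simp add: chart_point_def[abs_def])

lemma has_derivative_norm_chart_point_power:
  "((\<lambda>z. norm (chart_point k z) ^ m) has_derivative
    (\<lambda>h. real m * norm (chart_point k z) ^ (m - 1) * ((chart_point k z \<bullet> off_pole k h) / norm (chart_point k z)))) (at z)"
proof -
  have "((\<lambda>z. norm (chart_point k z)) has_derivative (\<lambda>h. off_pole k h \<bullet> sgn (chart_point k z))) (at z)"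
    by (rule has_derivative_compose[OF has_derivative_chart_point has_derivative_norm[OF norm_chart_point_pos(3)]])
  from has_derivative_power[OF this, of m]
  show ?thesis by (simp add: sgn_div_norm inner_commute divide_inverse mult_ac)
qed

lemma has_derivative_crit_map: "(crit_map p k J has_derivative dcrit_map p k J z) (at z)"
proof -
  have t: "((\<lambda>z. z $ k) has_derivative (\<lambda>h. h $ k)) (at z)" by (rule has_derivative_vec_nth')
  note N = has_derivative_norm_chart_point_power[of k _ z]
  have g: "((\<lambda>z. gmon i (chart_point k z)) has_derivative (\<lambda>h. hmon i (chart_point k z) (off_pole k h))) (at z)" for i
    by (rule has_derivative_compose[OF has_derivative_chart_point has_derivative_gmon])
  have m: "((\<lambda>z. mon i (chart_point k z)) has_derivative (\<lambda>h. gmon i (chart_point k z) \<bullet> off_pole k h)) (at z)" for i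
    by (rule has_derivative_compose[OF has_derivative_chart_point has_derivative_mon])
  have G: "crit_map p k J = (\<lambda>z. (real p * (z $ k * norm (chart_point k z) ^ (p - 2))) *\<^sub>R chart_point k z
      - (\<Sum>i | length i = p. other_couplings p k J i *\<^sub>R gmon i (chart_point k z))
     - ((real p - 1) * (z $ k * norm (chart_point k z) ^ p - (\<Sum>i | length i = p. other_couplings p k J i * mon i (chart_point k z)))) *\<^sub>R axis k 1)"
    by (simp add: crit_map_def[abs_def] homf_def homg_def mult.assoc)
  have "(crit_map p k J has_derivative (\<lambda>h.
      ((real p * (z $ k * norm (chart_point k z) ^ (p - 2))) *\<^sub>R off_pole k h +
       (real p * (z $ k * (real (p - 2) * norm (chart_point k z) ^ (p - 2 - 1) * ((chart_point k z \<bullet> off_pole k h) / norm (chart_point k z))) +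
          h $ k * norm (chart_point k z) ^ (p - 2))) *\<^sub>R chart_point k z)
      - (\<Sum>i | length i = p. other_couplings p k J i *\<^sub>R hmon i (chart_point k z) (off_pole k h))
      - ((real p - 1) * ((z $ k * (real p * norm (chart_point k z) ^ (p - 1) * ((chart_point k z \<bullet> off_pole k h) / norm (chart_point k z))) +
          h $ k * norm (chart_point k z) ^ p) - (\<Sum>i | length i = p. other_couplings p k J i * (gmon i (chart_point k z) \<bullet> off_pole k h)))) *\<^sub>R axis k 1)) (at z)"
    unfolding G
    by (intro has_derivative_diff has_derivative_scaleR has_derivative_mult_right has_derivative_mult[OF t N]
        has_derivative_sum has_derivative_scaleR_right has_derivative_scaleR_left has_derivative_chart_point g m)
  moreover have "(\<lambda>h. ((real p * (z $ k * norm (chart_point k z) ^ (p - 2))) *\<^sub>R off_pole k h +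
       (real p * (z $ k * (real (p - 2) * norm (chart_point k z) ^ (p - 2 - 1) * ((chart_point k z \<bullet> off_pole k h) / norm (chart_point k z))) +
          h $ k * norm (chart_point k z) ^ (p - 2))) *\<^sub>R chart_point k z)
      - (\<Sum>i | length i = p. other_couplings p k J i *\<^sub>R hmon i (chart_point k z) (off_pole k h))
      - ((real p - 1) * ((z $ k * (real p * norm (chart_point k z) ^ (p - 1) * ((chart_point k z \<bullet> off_pole k h) / norm (chart_point k z))) +
          h $ k * norm (chart_point k z) ^ p) - (\<Sum>i | length i = p. other_couplings p k J i * (gmon i (chart_point k z) \<bullet> off_pole k h)))) *\<^sub>R axis k 1)
    = dcrit_map p k J z" (is "?F = _")
  proof
    fix h
    have e: "(\<Sum>i | length i = p. other_couplings p k J i *\<^sub>R dQ p k i z h) =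
      (\<Sum>i | length i = p. other_couplings p k J i *\<^sub>R hmon i (chart_point k z) (off_pole k h)) -
      ((real p - 1) * (\<Sum>i | length i = p. other_couplings p k J i * (gmon i (chart_point k z) \<bullet> off_pole k h))) *\<^sub>R axis k 1"
      by (simp add: dQ_def scaleR_diff_right sum_subtractf scaleR_sum_left[symmetric] sum_distrib_left mult_ac)
    have p3: "p - 2 - 1 = p - 3" by simp
    show "?F h = dcrit_map p k J z h"
      unfolding dcrit_map_def dP_def Let_def e p3 by (simp add: algebra_simps)
  qed
  ultimately show ?thesis by simp
qed

lemma bounded_linear_dcrit_map: "bounded_linear (dcrit_map p k J z)"
  using has_derivative_crit_map by (rule has_derivative_bounded_linear)

lemma crit_map_has_derivative_matrix: "(crit_map p k J has_derivative (\<lambda>h. matrix (dcrit_map p k J z) *v h)) (at z)"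
proof -
  have "(\<lambda>h. matrix (dcrit_map p k J z) *v h) = dcrit_map p k J z"
    using bounded_linear_dcrit_map[of p k J z] by (simp add: matrix_vector_mul[symmetric] linear_conv_bounded_linear)
  then show ?thesis using has_derivative_crit_map by simp
qed

lemma continuous_on_chart_point [continuous_intros]:
  "continuous_on S f \<Longrightarrow> continuous_on S (\<lambda>x. chart_point k (f x))"
  unfolding chart_point_def off_pole_def by (intro continuous_intros)

lemma continuous_on_dP: "continuous_on S (\<lambda>z. dP p k z h)"
  unfolding dP_def Let_def using norm_chart_point_pos(3) by (intro continuous_intros) auto

lemma continuous_on_dQ: "continuous_on S (\<lambda>z. dQ p k i z h)"
  unfolding dQ_def by (intro continuous_intros)

lemma matrix_nth: "matrix f $ a $ b = f (axis b 1) $ a"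
  by (simp add: matrix_def)

lemma continuous_on_dcrit_map: "continuous_on S (\<lambda>z. matrix (dcrit_map p k J z) $ a $ b)"
  unfolding matrix_nth dcrit_map_def
  by (intro continuous_intros continuous_on_dP continuous_on_dQ)

section \<open>Mean number of critical points in a cap\<close>

text \<open>The Kac-Rice integrand for fixed remaining couplings: the Gaussian density of the solved
  couplings at the value that makes \<open>z\<close> critical, times the Jacobian.\<close>

definition dens :: "nat \<Rightarrow> 'n \<Rightarrow> ('n::finite list \<Rightarrow> real) \<Rightarrow> real^'n \<Rightarrow> ennreal" where
  "dens p k J z = (\<Prod>a\<in>UNIV. ennreal (std_normal_density (crit_map p k J z $ a))) *
     ennreal \<bar>det (matrix (dcrit_map p k J z))\<bar>"

lemma crit_map_dcrit_map_cong:
  assumes "\<And>i. length i = p \<Longrightarrow> tl i \<noteq> replicate (p - 1) k \<Longrightarrow> J i = J' i"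
  shows "crit_map p k J = crit_map p k J'" and "dcrit_map p k J = dcrit_map p k J'"
proof -
  have *: "other_couplings p k J i = other_couplings p k J' i" if "length i = p" for i
    using assms[OF that] by (simp add: other_couplings_def)
  have "homf p (other_couplings p k J) = homf p (other_couplings p k J')" "homg p (other_couplings p k J) = homg p (other_couplings p k J')"
    by (auto simp: homf_def homg_def * intro!: sum.cong ext)
  then show "crit_map p k J = crit_map p k J'" by (simp add: crit_map_def[abs_def])
  have "(\<Sum>i | length i = p. other_couplings p k J i *\<^sub>R dQ p k i z h) = (\<Sum>i | length i = p. other_couplings p k J' i *\<^sub>R dQ p k i z h)"
    for z h by (auto simp: * intro!: sum.cong)
  then show "dcrit_map p k J = dcrit_map p k J'" by (simp add: dcrit_map_def[abs_def])
qed

text \<open>The couplings \<open>J(a, k, \<dots>, k)\<close> do not enter, so averaging over all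
  couplings is the same as averaging over the remaining ones.\<close>

lemma dens_cong:
  assumes "\<And>i. length i = p \<Longrightarrow> tl i \<noteq> replicate (p - 1) k \<Longrightarrow> J i = J' i"
  shows "dens p k J = dens p k J'"
proof -
  have "crit_map p k J = crit_map p k J'" by (rule crit_map_dcrit_map_cong(1)) (rule assms)
  moreover have "dcrit_map p k J = dcrit_map p k J'" by (rule crit_map_dcrit_map_cong(2)) (rule assms)
  ultimately show ?thesis by (simp add: dens_def[abs_def])
qed

lemma measurable_other_couplings: "length i = p \<Longrightarrow> (\<lambda>J. other_couplings p k J i) \<in> borel_measurable (gam p)"
  unfolding other_couplings_def by (cases "tl i = replicate (p - 1) k") auto

lemma measurable_chart_point [measurable]: "chart_point k \<in> borel_measurable borel"
  by (intro borel_measurable_continuous_onI continuous_on_chart_point continuous_on_id)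

lemma measurable_det:
  fixes A :: "'w \<Rightarrow> real^'n^'n"
  assumes "\<And>a b. (\<lambda>w. A w $ a $ b) \<in> borel_measurable M"
  shows "(\<lambda>w. det (A w)) \<in> borel_measurable M"
  unfolding Determinants.det_def using assms
  by (intro borel_measurable_sum borel_measurable_times borel_measurable_prod borel_measurable_const) auto

lemma measurable_crit_map: "(\<lambda>(J, z). crit_map p k J z) \<in> borel_measurable (gam p \<Otimes>\<^sub>M borel)"
proof -
  have [measurable]: "(\<lambda>w. other_couplings p k (fst w) i) \<in> borel_measurable (gam p \<Otimes>\<^sub>M (borel :: (real^'a) measure))"
    if "length i = p" for i
    using that by (intro measurable_compose[OF measurable_fst measurable_other_couplings])
  have [measurable]: "gmon i \<in> borel_measurable borel" "mon i \<in> borel_measurable borel" for i :: "'a list"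
    by (intro borel_measurable_continuous_onI continuous_intros)+
  have 1: "(\<lambda>w. homg p (other_couplings p k (fst w)) (chart_point k (snd w))) \<in> borel_measurable (gam p \<Otimes>\<^sub>M (borel :: (real^'a) measure))"
    unfolding homg_def by (intro borel_measurable_sum borel_measurable_scaleR) auto
  have 2: "(\<lambda>w. homf p (other_couplings p k (fst w)) (chart_point k (snd w))) \<in> borel_measurable (gam p \<Otimes>\<^sub>M (borel :: (real^'a) measure))"
    unfolding homf_def by (intro borel_measurable_sum borel_measurable_times) auto
  show ?thesis
    unfolding crit_map_def split_beta using 1 2 by measurable
qed

lemma measurable_dcrit_map: "(\<lambda>(J, z). matrix (dcrit_map p k J z) $ a $ b) \<in> borel_measurable (gam p \<Otimes>\<^sub>M borel)"
proof -
  have [measurable]: "(\<lambda>w. other_couplings p k (fst w) i) \<in> borel_measurable (gam p \<Otimes>\<^sub>M (borel :: (real^'a) measure))"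
    if "length i = p" for i
    using that by (intro measurable_compose[OF measurable_fst measurable_other_couplings])
  have [measurable]: "(\<lambda>z. dP p k z h) \<in> borel_measurable borel" for h :: "real^'a"
    by (intro borel_measurable_continuous_onI continuous_on_dP)
  have [measurable]: "(\<lambda>z. dQ p k i z h) \<in> borel_measurable borel" for i and h :: "real^'a"
    by (intro borel_measurable_continuous_onI continuous_on_dQ)
  have "(\<lambda>w. \<Sum>i | length i = p. other_couplings p k (fst w) i *\<^sub>R dQ p k i (snd w) (axis b 1))
      \<in> borel_measurable (gam p \<Otimes>\<^sub>M (borel :: (real^'a) measure))"
    by (intro borel_measurable_sum borel_measurable_scaleR) auto
  then show ?thesis unfolding split_beta matrix_nth dcrit_map_def by measurable
qed

lemma measurable_dens: "(\<lambda>(J, z). dens p k J z) \<in> borel_measurable (gam p \<Otimes>\<^sub>M borel)"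
proof -
  have "(\<lambda>w. det (case w of (J, z) \<Rightarrow> matrix (dcrit_map p k J z))) \<in> borel_measurable (gam p \<Otimes>\<^sub>M (borel :: (real^'a) measure))"
    by (rule measurable_det) (use measurable_dcrit_map in \<open>simp add: case_prod_beta'\<close>)
  then have [measurable]: "(\<lambda>w. det (matrix (dcrit_map p k (fst w) (snd w)))) \<in> borel_measurable (gam p \<Otimes>\<^sub>M (borel :: (real^'a) measure))"
    by (simp add: split_beta)
  have [measurable]: "(\<lambda>w. crit_map p k (fst w) (snd w)) \<in> borel_measurable (gam p \<Otimes>\<^sub>M (borel :: (real^'a) measure))"
    using measurable_crit_map by (simp add: case_prod_beta')
  show ?thesis unfolding dens_def split_beta by measurable
qed

lemma compact_chart_region: "compact (chart_region k a b r)"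
proof -
  have "bounded (chart_region k a b r)"
  proof (rule boundedI)
    fix z assume "z \<in> chart_region k a b r"
    then have z: "\<bar>z $ k\<bar> \<le> \<bar>a\<bar> + \<bar>b\<bar>" "norm (off_pole k z) \<le> r" by (auto simp: chart_region_def)
    have "norm z = norm (off_pole k z + z $ k *\<^sub>R axis k 1)" by (simp add: off_pole_def)
    also have "\<dots> \<le> norm (off_pole k z) + norm (z $ k *\<^sub>R axis k (1::real))" by (rule norm_triangle_ineq)
    finally show "norm z \<le> r + (\<bar>a\<bar> + \<bar>b\<bar>)" using z by simp
  qed
  moreover have "closed (chart_region k a b r)"
    unfolding chart_region_def off_pole_def atLeastAtMost_iff
    by (intro closed_Collect_conj closed_Collect_le continuous_intros)
  ultimately show ?thesis by (simp add: compact_eq_bounded_closed)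
qed

text \<open>Fubini, with the couplings \<open>J(a, k, \<dots>, k)\<close> gathered into a Gaussian
  vector \<open>v\<close> that is independent of the remaining couplings \<open>J0\<close>.\<close>

lemma gam_split:
  fixes F :: "('n::finite list \<Rightarrow> real) \<Rightarrow> ennreal" and k :: 'n
  assumes p: "p \<ge> 1" and F: "F \<in> borel_measurable (gam p)"
  defines "I1 \<equiv> range (\<lambda>a. a # replicate (p - 1) k)"
  defines "I0 \<equiv> {i :: 'n list. length i = p} - I1"
  shows "(\<integral>\<^sup>+J. F J \<partial>gam p) = (\<integral>\<^sup>+J0. \<integral>\<^sup>+v. F (merge I0 I1 (J0, \<lambda>i\<in>I1. v $ hd i)) \<partial>gaussN \<partial>PiM I0 (\<lambda>_. stdN))"
proof -
  interpret product_sigma_finite "\<lambda>_::'n list. stdN"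
    by (rule product_sigma_finite.intro) (rule prob_space_imp_sigma_finite, rule prob_space_stdN)
  have U: "I0 \<union> I1 = {i. length i = p}" using p by (auto simp: I0_def I1_def)
  have fin: "finite I0" "finite I1" by (auto simp: I0_def I1_def)
  have F': "F \<in> borel_measurable (PiM (I0 \<union> I1) (\<lambda>_. stdN))" using F by (simp add: gam_def U)
  have bij: "bij_betw hd I1 UNIV"
    by (rule bij_betwI[where g = "\<lambda>a. a # replicate (p - 1) k"]) (auto simp: I1_def)
  have "(\<integral>\<^sup>+J. F J \<partial>gam p) = (\<integral>\<^sup>+J0. \<integral>\<^sup>+x. F (merge I0 I1 (J0, x)) \<partial>PiM I1 (\<lambda>_. stdN) \<partial>PiM I0 (\<lambda>_. stdN))"
    unfolding gam_def U[symmetric] by (rule product_nn_integral_fold[OF _ fin F']) (auto simp: I0_def)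
  also have "\<dots> = (\<integral>\<^sup>+J0. \<integral>\<^sup>+v. F (merge I0 I1 (J0, \<lambda>i\<in>I1. v $ hd i)) \<partial>gaussN \<partial>PiM I0 (\<lambda>_. stdN))"
  proof (rule nn_integral_cong)
    fix J0 assume J0: "J0 \<in> space (PiM I0 (\<lambda>_. stdN))"
    have m: "(\<lambda>x. F (merge I0 I1 (J0, x))) \<in> borel_measurable (PiM I1 (\<lambda>_. stdN))"
      by (rule measurable_compose[OF measurable_Pair1' [OF J0] measurable_compose[OF measurable_merge F']])
    have "(\<integral>\<^sup>+x. F (merge I0 I1 (J0, x)) \<partial>PiM I1 (\<lambda>_. stdN)) =
      (\<integral>\<^sup>+x. F (merge I0 I1 (J0, x)) \<partial>distr (gaussN :: (real^'n) measure) (PiM I1 (\<lambda>_. stdN)) (\<lambda>v. \<lambda>i\<in>I1. v $ hd i))"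
      by (simp only: gaussN_PiM[OF bij fin(2)])
    also have "\<dots> = (\<integral>\<^sup>+v. F (merge I0 I1 (J0, \<lambda>i\<in>I1. v $ hd i)) \<partial>gaussN)"
    proof (rule nn_integral_distr)
      show "(\<lambda>v::real^'n. \<lambda>i\<in>I1. v $ hd i) \<in> gaussN \<rightarrow>\<^sub>M PiM I1 (\<lambda>_. stdN)"
        by (intro measurable_restrict) auto
    qed (use m in simp)
    finally show "(\<integral>\<^sup>+x. F (merge I0 I1 (J0, x)) \<partial>PiM I1 (\<lambda>_. stdN)) =
      (\<integral>\<^sup>+v. F (merge I0 I1 (J0, \<lambda>i\<in>I1. v $ hd i)) \<partial>gaussN)" .
  qed
  finally show ?thesis .
qed

text \<open>With the remaining couplings fixed, the number of critical points in the cap is the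
  number of preimages of \<open>v\<close> under a fixed map. Averaging over \<open>v\<close> is then
  the area formula with the Gaussian density as weight.\<close>

lemma cap_mean_eq_dens:
  fixes k :: "'n::{finite,wellorder}"
  assumes p: "p \<ge> 2" and r: "r \<ge> 0"
  shows "cap_mean p {a..b} (1 / sqrt (1 + r\<^sup>2)) (axis k 1) =
    (\<integral>\<^sup>+J. (\<integral>\<^sup>+z\<in>chart_region k a b r. dens p k J z \<partial>lborel) \<partial>gam p)"
proof -
  define I1 where "I1 = range (\<lambda>a. a # replicate (p - 1) k)"
  define I0 where "I0 = {i :: 'n list. length i = p} - I1"
  have p1: "p \<ge> 1" using p by simp
  define \<theta> where "\<theta> = 1 / sqrt (1 + r\<^sup>2)"
  define \<Psi> where "\<Psi> = (\<lambda>J. \<integral>\<^sup>+z\<in>chart_region k a b r. dens p k J z \<partial>lborel)"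
  have [measurable]: "chart_region k a b r \<in> sets borel" using compact_chart_region by (rule borel_compact)
  have \<Psi>m: "\<Psi> \<in> borel_measurable (gam p)"
  proof -
    have "(\<lambda>(J, z). dens p k J z) \<in> borel_measurable (gam p \<Otimes>\<^sub>M (lborel :: (real^'n::_) measure))"
      using measurable_dens by (simp cong: measurable_cong_sets)
    then have "(\<lambda>(J, z). dens p k J z * indicator (chart_region k a b r) z) \<in> borel_measurable (gam p \<Otimes>\<^sub>M (lborel :: (real^'n::_) measure))"
      unfolding split_beta by measurable
    then show ?thesis unfolding \<Psi>_def by (rule lborel.borel_measurable_nn_integral)
  qed
  have mem: "i \<in> I1 \<longleftrightarrow> tl i = replicate (p - 1) k" if "length i = p" for i
    using that p by (cases i) (auto simp: I1_def)
  have \<Psi>c: "\<Psi> (merge I0 I1 (J0, x)) = \<Psi> J0" for J0 x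
  proof -
    have "dens p k (merge I0 I1 (J0, x)) = dens p k J0"
      by (rule dens_cong) (use mem in \<open>auto simp: merge_def I0_def\<close>)
    then show ?thesis by (simp add: \<Psi>_def)
  qed
  have Fm: "(\<lambda>J. cnt (crit p J {a..b} \<inter> {x. axis k 1 \<bullet> x \<ge> \<theta>})) \<in> borel_measurable (gam p)"
    by (rule cnt_crit_measurable) auto
  have inner: "(\<integral>\<^sup>+v. cnt (crit p (merge I0 I1 (J0, \<lambda>i\<in>I1. v $ hd i)) {a..b} \<inter> {x. axis k 1 \<bullet> x \<ge> \<theta>}) \<partial>gaussN) = \<Psi> J0" for J0
  proof -
    define h where "h = (\<lambda>v::real^'n::_. \<Prod>a\<in>UNIV. ennreal (std_normal_density (v $ a)))"
    have hm [measurable]: "h \<in> borel_measurable borel" unfolding h_def by measurable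
    have c: "cnt (crit p (merge I0 I1 (J0, \<lambda>i\<in>I1. v $ hd i)) {a..b} \<inter> {x. axis k 1 \<bullet> x \<ge> \<theta>}) =
      cnt {z \<in> chart_region k a b r. crit_map p k J0 z = v}" for v
    proof -
      let ?J = "merge I0 I1 (J0, \<lambda>i\<in>I1. v $ hd i)"
      have "?J (a # replicate (p - 1) k) = v $ a" for a
        using p by (auto simp: merge_def I0_def I1_def)
      from cnt_bij_betw[OF chart_bij[OF p this r]]
      have "cnt {z \<in> chart_region k a b r. crit_map p k ?J z = v} = cnt (crit p ?J {a..b} \<inter> {x. axis k 1 \<bullet> x \<ge> \<theta>})"
        unfolding \<theta>_def .
      moreover have "crit_map p k ?J = crit_map p k J0"
        by (rule crit_map_dcrit_map_cong) (use mem in \<open>auto simp: merge_def I0_def\<close>)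
      ultimately show ?thesis by simp
    qed
    note af = area_formula[OF crit_map_has_derivative_matrix[of p k J0] continuous_on_dcrit_map compact_chart_region[of k a b r] hm]
    have "(\<integral>\<^sup>+v. cnt {z \<in> chart_region k a b r. crit_map p k J0 z = v} \<partial>gaussN) =
      (\<integral>\<^sup>+v. h v * cnt {z \<in> chart_region k a b r. crit_map p k J0 z = v} \<partial>lborel)"
      unfolding gaussN_def h_def[symmetric] using af(1) by (intro nn_integral_density) auto
    also have "\<dots> = \<Psi> J0"
      unfolding af(2) by (simp add: \<Psi>_def dens_def h_def)
    finally show ?thesis unfolding c .
  qed
  have "cap_mean p {a..b} \<theta> (axis k 1) = (\<integral>\<^sup>+J0. \<Psi> J0 \<partial>PiM I0 (\<lambda>_. stdN))"
    unfolding cap_mean_def gam_split[OF p1 Fm, of k] I1_def[symmetric] I0_def[symmetric]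
    unfolding inner ..
  \<comment> \<open>The solved couplings are put back: the integrand is constant in them and their
    law has mass 1.\<close>
  also have "\<dots> = (\<integral>\<^sup>+J. \<Psi> J \<partial>gam p)"
    unfolding gam_split[OF p1 \<Psi>m, of k] I1_def[symmetric] I0_def[symmetric] \<Psi>c
    using prob_space.emeasure_space_1[OF prob_space_gaussN[where 'n = 'n]] by simp
  finally show ?thesis by (simp add: \<theta>_def \<Psi>_def)
qed

text \<open>Maps the region over the cap of radius 1 onto the one over the cap of radius \<open>r\<close>, keeping the energy.\<close>
definition squeeze :: "'n::finite \<Rightarrow> real \<Rightarrow> real^'n \<Rightarrow> real^'n" where
  "squeeze k r z = r *\<^sub>R off_pole k z + z $ k *\<^sub>R axis k 1"

lemma squeeze_nth: "squeeze k r z $ a = (if a = k then z $ k else r * z $ a)"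
  by (simp add: squeeze_def off_pole_nth axis_def)

text \<open>The energy coordinate is kept, so only \<open>CARD('n) - 1\<close> directions are
  scaled.\<close>

lemma nn_integral_squeeze:
  fixes f :: "real^'n::finite \<Rightarrow> ennreal"
  assumes r: "r > 0" and f: "f \<in> borel_measurable borel"
  shows "(\<integral>\<^sup>+z. f z \<partial>lborel) = ennreal (r ^ (CARD('n) - 1)) * (\<integral>\<^sup>+z. f (squeeze k r z) \<partial>lborel)"
proof -
  define c where "c = (\<lambda>j::real^'n. if j = axis k 1 then 1 else r)"
  have T: "0 + (\<Sum>j\<in>Basis. (c j * (x \<bullet> j)) *\<^sub>R j) = squeeze k r x" for x :: "real^'n"
  proof (rule euclidean_eqI)
    fix b :: "real^'n" assume b: "b \<in> Basis"
    then obtain a where a: "b = axis a 1" by (auto simp: Basis_vec_def)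
    have "(0 + (\<Sum>j\<in>Basis. (c j * (x \<bullet> j)) *\<^sub>R j)) \<bullet> b = c b * (x \<bullet> b)"
      using b by (simp add: inner_sum_left inner_Basis if_distrib cong: if_cong)
    also have "\<dots> = squeeze k r x \<bullet> b"
      by (auto simp: a inner_axis squeeze_nth c_def axis_eq_axis)
    finally show "(0 + (\<Sum>j\<in>Basis. (c j * (x \<bullet> j)) *\<^sub>R j)) \<bullet> b = squeeze k r x \<bullet> b" .
  qed
  have "(\<Prod>j\<in>Basis. \<bar>c j\<bar>) = (\<Prod>a\<in>UNIV. if a = k then 1 else r)"
    using r by (simp add: prod_Basis_vec c_def axis_eq_axis if_distrib cong: if_cong)
  also have "\<dots> = (\<Prod>a\<in>UNIV - {k}. r)"
    by (subst prod.remove[of UNIV k]) (auto intro!: prod.cong)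
  also have "\<dots> = r ^ (CARD('n) - 1)" by simp
  finally have P: "(\<Prod>j\<in>Basis. \<bar>c j\<bar>) = r ^ (CARD('n) - 1)" .
  have L: "lborel = density (distr lborel borel (squeeze k r)) (\<lambda>_. ennreal (r ^ (CARD('n) - 1)))"
    using lborel_affine_euclidean[of c 0] r unfolding T P by (simp add: c_def)
  have sm: "squeeze k r \<in> borel_measurable borel"
    unfolding squeeze_def off_pole_def by (intro borel_measurable_continuous_onI continuous_intros)
  have "(\<integral>\<^sup>+z. f z \<partial>lborel) = (\<integral>\<^sup>+z. f z \<partial>density (distr lborel borel (squeeze k r)) (\<lambda>_. ennreal (r ^ (CARD('n) - 1))))"
    by (subst L) simp
  also have "\<dots> = (\<integral>\<^sup>+z. ennreal (r ^ (CARD('n) - 1)) * f z \<partial>distr lborel borel (squeeze k r))"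
    using f by (intro nn_integral_density) auto
  also have "\<dots> = (\<integral>\<^sup>+z. ennreal (r ^ (CARD('n) - 1)) * f (squeeze k r z) \<partial>lborel)"
    using f sm by (subst nn_integral_distr) auto
  also have "\<dots> = ennreal (r ^ (CARD('n) - 1)) * (\<integral>\<^sup>+z. f (squeeze k r z) \<partial>lborel)"
    using f sm by (intro nn_integral_cmult) (auto intro: measurable_compose)
  finally show ?thesis .
qed

lemma squeeze_chart_region:
  assumes "r > 0"
  shows "squeeze k r z \<in> chart_region k a b r \<longleftrightarrow> z \<in> chart_region k a b 1"
proof -
  have "off_pole k (squeeze k r z) = r *\<^sub>R off_pole k z"
    by (simp add: Finite_Cartesian_Product.vec_eq_iff off_pole_nth squeeze_nth)
  then show ?thesis using assms by (simp add: chart_region_def squeeze_nth)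
qed

lemma squeeze_chart_region_1:
  assumes "0 \<le> r" "r \<le> 1" "z \<in> chart_region k a b 1"
  shows "squeeze k r z \<in> chart_region k a b 1"
proof -
  have "off_pole k (squeeze k r z) = r *\<^sub>R off_pole k z"
    by (simp add: Finite_Cartesian_Product.vec_eq_iff off_pole_nth squeeze_nth)
  moreover have "r * norm (off_pole k z) \<le> 1 * 1"
    using assms by (intro mult_mono) (auto simp: chart_region_def)
  ultimately show ?thesis using assms by (simp add: chart_region_def squeeze_nth)
qed

text \<open>Completing the square gives the mean of \<open>exp (d * x)\<close>; the absolute value
  is handled by adding both signs. Exponential moments provide the majorant for dominated
  convergence.\<close>

lemma nn_integral_exp_stdN: "(\<integral>\<^sup>+x. ennreal (exp (c * \<bar>x\<bar>)) \<partial>stdN) < \<infinity>"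
proof -
  have e: "(\<integral>\<^sup>+x. ennreal (exp (d * x)) \<partial>stdN) = ennreal (exp (d\<^sup>2 / 2))" for d
  proof -
    interpret D: prob_space "density lborel (normal_density d 1)" by (rule prob_space_normal_density) simp
    have "(\<integral>\<^sup>+x. ennreal (exp (d * x)) \<partial>stdN) = (\<integral>\<^sup>+x. ennreal (std_normal_density x) * ennreal (exp (d * x)) \<partial>lborel)"
      unfolding stdN_def by (rule nn_integral_density) auto
    also have "\<dots> = (\<integral>\<^sup>+x. ennreal (exp (d\<^sup>2 / 2)) * ennreal (normal_density d 1 x) \<partial>lborel)"
    proof (rule nn_integral_cong)
      fix x :: real
      have "exp (- x\<^sup>2 / 2) * exp (d * x) = exp (d\<^sup>2 / 2) * exp (- (x - d)\<^sup>2 / 2)"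
        by (simp add: mult_exp_exp field_simps power2_eq_square)
      then have "std_normal_density x * exp (d * x) = exp (d\<^sup>2 / 2) * normal_density d 1 x"
        by (simp add: std_normal_density_def normal_density_def)
      then show "ennreal (std_normal_density x) * ennreal (exp (d * x)) = ennreal (exp (d\<^sup>2 / 2)) * ennreal (normal_density d 1 x)"
        by (simp add: ennreal_mult[symmetric])
    qed
    also have "\<dots> = ennreal (exp (d\<^sup>2 / 2)) * (\<integral>\<^sup>+x. ennreal (normal_density d 1 x) \<partial>lborel)"
      by (rule nn_integral_cmult) auto
    also have "(\<integral>\<^sup>+x. ennreal (normal_density d 1 x) \<partial>lborel) = 1"
      using D.emeasure_space_1 by (simp add: emeasure_density)
    finally show ?thesis by simp
  qed
  have "(\<integral>\<^sup>+x. ennreal (exp (c * \<bar>x\<bar>)) \<partial>stdN) \<le> (\<integral>\<^sup>+x. ennreal (exp (c * x)) + ennreal (exp ((- c) * x)) \<partial>stdN)"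
  proof (rule nn_integral_mono)
    fix x :: real
    have "exp (c * \<bar>x\<bar>) \<le> exp (c * x) + exp (- c * x)" by (cases "x \<ge> 0") auto
    then show "ennreal (exp (c * \<bar>x\<bar>)) \<le> ennreal (exp (c * x)) + ennreal (exp (- c * x))"
      by (simp add: ennreal_plus[symmetric] del: ennreal_plus)
  qed
  also have "\<dots> = (\<integral>\<^sup>+x. ennreal (exp (c * x)) \<partial>stdN) + (\<integral>\<^sup>+x. ennreal (exp ((- c) * x)) \<partial>stdN)"
    by (rule nn_integral_add) measurable
  also have "\<dots> < \<infinity>" unfolding e by simp
  finally show ?thesis .
qed

lemma nn_integral_exp_gam: "(\<integral>\<^sup>+J. ennreal (exp (c * (\<Sum>i | length i = p. \<bar>J i\<bar>))) \<partial>(gam p :: ('n::finite list \<Rightarrow> real) measure)) < \<infinity>"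
proof -
  interpret product_sigma_finite "\<lambda>_::'n list. stdN"
    by (rule product_sigma_finite.intro) (rule prob_space_imp_sigma_finite, rule prob_space_stdN)
  have "(\<integral>\<^sup>+J. ennreal (exp (c * (\<Sum>i | length i = p. \<bar>J i\<bar>))) \<partial>(gam p :: ('n list \<Rightarrow> real) measure)) =
    (\<integral>\<^sup>+J. (\<Prod>i\<in>{i :: 'n list. length i = p}. ennreal (exp (c * \<bar>J i\<bar>))) \<partial>(gam p :: ('n list \<Rightarrow> real) measure))"
    by (simp add: sum_distrib_left exp_sum prod_ennreal)
  also have "\<dots> = (\<Prod>i\<in>{i :: 'n list. length i = p}. \<integral>\<^sup>+x. ennreal (exp (c * \<bar>x\<bar>)) \<partial>stdN)"
    unfolding gam_def by (rule product_nn_integral_prod) (simp, measurable)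
  also have "\<dots> < \<infinity>"
    using nn_integral_exp_stdN[of c] by (simp add: power_less_top_ennreal)
  finally show ?thesis .
qed

lemma abs_det_le:
  fixes A :: "real^'n^'n"
  assumes "\<And>a b. \<bar>A $ a $ b\<bar> \<le> B"
  shows "\<bar>det A\<bar> \<le> fact CARD('n) * B ^ CARD('n)"
proof -
  have "\<bar>det A\<bar> \<le> (\<Sum>q | q permutes (UNIV :: 'n set). \<bar>of_int (sign q) * (\<Prod>i\<in>UNIV. A $ i $ q i)\<bar>)"
    unfolding Determinants.det_def by (rule sum_abs)
  also have "\<dots> \<le> (\<Sum>q | q permutes (UNIV :: 'n set). B ^ CARD('n))"
  proof (rule sum_mono)
    fix q :: "'n \<Rightarrow> 'n"
    have "\<bar>of_int (sign q) * (\<Prod>i\<in>UNIV. A $ i $ q i)\<bar> = (\<Prod>i\<in>UNIV. \<bar>A $ i $ q i\<bar>)"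
      by (simp add: abs_mult abs_prod sign_def)
    also have "\<dots> \<le> (\<Prod>i\<in>(UNIV :: 'n set). B)"
      by (rule prod_mono) (use assms in auto)
    finally show "\<bar>of_int (sign q) * (\<Prod>i\<in>UNIV. A $ i $ q i)\<bar> \<le> B ^ CARD('n)" by simp
  qed
  also have "\<dots> = fact CARD('n) * B ^ CARD('n)"
    by (simp add: card_permutations[OF refl])
  finally show ?thesis .
qed

lemma std_normal_density_le_1: "std_normal_density x \<le> 1"
proof -
  have "1 * 1 \<le> 2 * pi" using pi_gt3 by (intro mult_mono) auto
  then have "1 \<le> sqrt (2 * pi)" by simp
  then have "exp (- x\<^sup>2 / 2) / sqrt (2 * pi) \<le> 1 / 1" by (intro frac_le) auto
  then show ?thesis by (simp add: std_normal_density_def)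
qed

text \<open>On the compact region the entries of the Jacobian matrix are affine in the couplings
  with bounded coefficients, hence at most \<open>B (1 + S) \<le> B exp S\<close> with
  \<open>S\<close> the sum of the absolute couplings. The resulting exponential bound on the
  determinant factors over the couplings and has finite mean; the Gaussian weight is at most
  1.\<close>

lemma dens_le:
  fixes k :: "'n::finite"
  shows "\<exists>C \<ge> 0. \<forall>J. \<forall>z\<in>chart_region k a b 1. dens p k J z \<le>
    ennreal (C * exp (real CARD('n) * (\<Sum>i | length i = p. \<bar>J i\<bar>)))"
proof -
  let ?K = "chart_region k a b 1"
  define Q where "Q = (\<lambda>z. (\<Sum>c\<in>UNIV. \<Sum>d\<in>UNIV. \<bar>dP p k z (axis c 1) $ d\<bar> + (\<Sum>i | length i = p. \<bar>dQ p k i z (axis c 1) $ d\<bar>)))"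
  have "continuous_on ?K Q" unfolding Q_def
    by (intro continuous_intros continuous_on_dP continuous_on_dQ)
  then have "bounded (Q ` ?K)" by (intro compact_imp_bounded compact_continuous_image compact_chart_region)
  then obtain B where B: "\<And>z. z \<in> ?K \<Longrightarrow> \<bar>Q z\<bar> \<le> B" "B > 0" unfolding bounded_pos by auto
  have entry: "\<bar>dP p k z (axis c 1) $ d\<bar> \<le> B \<and> (\<forall>i. length i = p \<longrightarrow> \<bar>dQ p k i z (axis c 1) $ d\<bar> \<le> B)" if z: "z \<in> ?K" for z c d
  proof -
    let ?q = "\<lambda>c d. \<bar>dP p k z (axis c 1) $ d\<bar> + (\<Sum>i | length i = p. \<bar>dQ p k i z (axis c 1) $ d\<bar>)"
    have "?q c d \<le> (\<Sum>d\<in>UNIV. ?q c d)"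
      by (rule member_le_sum) (auto intro!: add_nonneg_nonneg sum_nonneg)
    also have "\<dots> \<le> (\<Sum>c\<in>UNIV. \<Sum>d\<in>UNIV. ?q c d)"
      by (rule member_le_sum) (auto intro!: add_nonneg_nonneg sum_nonneg)
    also have "\<dots> \<le> B" using B(1)[OF z] by (simp add: Q_def)
    finally have q: "?q c d \<le> B" .
    have s0: "0 \<le> (\<Sum>i | length i = p. \<bar>dQ p k i z (axis c 1) $ d\<bar>)" by (intro sum_nonneg) auto
    have s1: "\<bar>dQ p k i z (axis c 1) $ d\<bar> \<le> B" if "length i = p" for i
    proof -
      have "\<bar>dQ p k i z (axis c 1) $ d\<bar> \<le> (\<Sum>i | length i = p. \<bar>dQ p k i z (axis c 1) $ d\<bar>)"
        using that by (intro member_le_sum) auto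
      then show ?thesis using q abs_ge_zero[of "dP p k z (axis c 1) $ d"] by linarith
    qed
    moreover have "\<bar>dP p k z (axis c 1) $ d\<bar> \<le> B" using q s0 by linarith
    ultimately show ?thesis by simp
  qed
  let ?N = "CARD('n)"
  have "dens p k J z \<le> ennreal ((fact ?N * B ^ ?N) * exp (real ?N * (\<Sum>i | length i = p. \<bar>J i\<bar>)))" if z: "z \<in> ?K" for J z
  proof -
    define S where "S = (\<Sum>i | length i = p. \<bar>J i\<bar>)"
    have S0: "0 \<le> S" unfolding S_def by (intro sum_nonneg) auto
    have "\<bar>matrix (dcrit_map p k J z) $ d $ c\<bar> \<le> B * exp S" for c d
    proof -
      have "\<bar>matrix (dcrit_map p k J z) $ d $ c\<bar> \<le> \<bar>dP p k z (axis c 1) $ d\<bar> + \<bar>\<Sum>i | length i = p. other_couplings p k J i * dQ p k i z (axis c 1) $ d\<bar>"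
        unfolding matrix_nth dcrit_map_def by simp
      also have "\<bar>\<Sum>i | length i = p. other_couplings p k J i * dQ p k i z (axis c 1) $ d\<bar> \<le> (\<Sum>i | length i = p. \<bar>J i\<bar> * B)"
        by (rule order_trans[OF sum_abs sum_mono])
          (use entry[OF z] B(2) in \<open>auto simp: abs_mult other_couplings_def intro!: mult_mono\<close>)
      also have "\<bar>dP p k z (axis c 1) $ d\<bar> \<le> B" using entry[OF z] by simp
      finally have "\<bar>matrix (dcrit_map p k J z) $ d $ c\<bar> \<le> B + (\<Sum>i | length i = p. \<bar>J i\<bar> * B)" by simp
      also have "\<dots> = B * (1 + S)" by (simp add: S_def sum_distrib_left distrib_left mult.commute)
      also have "\<dots> \<le> B * exp S" using B(2) by (intro mult_left_mono) (auto simp: exp_ge_add_one_self)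
      finally show ?thesis .
    qed
    from abs_det_le[OF this]
    have d: "\<bar>det (matrix (dcrit_map p k J z))\<bar> \<le> (fact ?N * B ^ ?N) * exp (real ?N * S)"
      by (simp add: power_mult_distrib exp_of_nat_mult[symmetric] mult_ac)
    have "(\<Prod>a\<in>UNIV. ennreal (std_normal_density (crit_map p k J z $ a))) \<le> 1"
      using std_normal_density_le_1 by (intro prod_le_1) (auto simp: ennreal_le_1)
    then have "dens p k J z \<le> 1 * ennreal \<bar>det (matrix (dcrit_map p k J z))\<bar>"
      unfolding dens_def by (rule mult_right_mono) simp
    also have "\<dots> \<le> ennreal ((fact ?N * B ^ ?N) * exp (real ?N * S))"
      using d by (simp add: ennreal_leI)
    finally show ?thesis by (simp add: S_def)
  qed
  moreover have "0 \<le> fact ?N * B ^ ?N" using B(2) by simp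
  ultimately show ?thesis by blast
qed

section \<open>Shrinking caps\<close>

text \<open>For \<open>r > 0\<close> this is the mean number in a cap divided by r^(N-1), pulled
  back to a region independent of \<open>r\<close>. At \<open>r = 0\<close> all chart points are the
  pole itself.\<close>

definition cap_integral :: "nat \<Rightarrow> 'n::finite \<Rightarrow> real \<Rightarrow> real \<Rightarrow> real \<Rightarrow> ennreal" where
  "cap_integral p k a b r = (\<integral>\<^sup>+J. (\<integral>\<^sup>+z\<in>chart_region k a b 1. dens p k J (squeeze k r z) \<partial>lborel) \<partial>gam p)"

lemma measurable_squeeze [measurable]: "squeeze k r \<in> borel_measurable borel"
  unfolding squeeze_def off_pole_def by (intro borel_measurable_continuous_onI continuous_intros)

lemma chart_region_borel [measurable]: "chart_region k a b r \<in> sets borel"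
  using compact_chart_region by (rule borel_compact)

lemma measurable_dens_squeeze:
  "(\<lambda>w. dens p k (fst w) (squeeze k r (snd w)) * indicator (chart_region k a b s) (snd w))
    \<in> borel_measurable (gam p \<Otimes>\<^sub>M lborel)"
proof -
  have m: "(\<lambda>w. (fst w, squeeze k r (snd w))) \<in> gam p \<Otimes>\<^sub>M lborel \<rightarrow>\<^sub>M gam p \<Otimes>\<^sub>M borel"
    by measurable
  have [measurable]: "(\<lambda>w. dens p k (fst w) (squeeze k r (snd w))) \<in> borel_measurable (gam p \<Otimes>\<^sub>M lborel)"
    using measurable_compose[OF m measurable_dens[of p k]] by simp
  show ?thesis by measurable
qed

lemma measurable_dens_inner:
  "(\<lambda>J. \<integral>\<^sup>+z\<in>chart_region k a b s. dens p k J (squeeze k r z) \<partial>lborel) \<in> borel_measurable (gam p)"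
  using lborel.borel_measurable_nn_integral[of "\<lambda>J z. dens p k J (squeeze k r z) * indicator (chart_region k a b s) z" "gam p"]
    measurable_dens_squeeze[where p=p and k=k and a=a and b=b and s=s and r=r] by (simp add: case_prod_beta')

lemma dens_borel [measurable]: "dens p k J \<in> borel_measurable borel"
proof -
  have "(\<lambda>z. det (matrix (dcrit_map p k J z))) \<in> borel_measurable borel"
    by (intro borel_measurable_continuous_onI continuous_on_det continuous_on_dcrit_map)
  moreover have "crit_map p k J \<in> borel_measurable borel"
    using has_derivative_crit_map has_derivative_continuous
    by (intro borel_measurable_continuous_onI continuous_at_imp_continuous_on ballI) blast
  ultimately show ?thesis unfolding dens_def[abs_def] by measurable
qed

lemma cap_mean_eq_cap_integral:
  fixes k :: "'n::{finite,wellorder}"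
  assumes p: "p \<ge> 2" and r: "r > 0"
  shows "cap_mean p {a..b} (1 / sqrt (1 + r\<^sup>2)) (axis k 1) = ennreal (r ^ (CARD('n) - 1)) * cap_integral p k a b r"
proof -
  have eq: "(\<integral>\<^sup>+z\<in>chart_region k a b r. dens p k J z \<partial>lborel) =
    ennreal (r ^ (CARD('n) - 1)) * (\<integral>\<^sup>+z\<in>chart_region k a b 1. dens p k J (squeeze k r z) \<partial>lborel)" for J
  proof -
    have "(\<integral>\<^sup>+z\<in>chart_region k a b r. dens p k J z \<partial>lborel) =
      ennreal (r ^ (CARD('n) - 1)) * (\<integral>\<^sup>+z. dens p k J (squeeze k r z) * indicator (chart_region k a b r) (squeeze k r z) \<partial>lborel)"
      by (rule nn_integral_squeeze[OF r]) measurable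
    also have "(\<lambda>z. dens p k J (squeeze k r z) * indicator (chart_region k a b r) (squeeze k r z)) =
      (\<lambda>z. dens p k J (squeeze k r z) * indicator (chart_region k a b 1) z)"
      using squeeze_chart_region[OF r, of k _ a b] by (auto simp: indicator_def)
    finally show ?thesis .
  qed
  have "cap_mean p {a..b} (1 / sqrt (1 + r\<^sup>2)) (axis k 1) =
    (\<integral>\<^sup>+J. ennreal (r ^ (CARD('n) - 1)) * (\<integral>\<^sup>+z\<in>chart_region k a b 1. dens p k J (squeeze k r z) \<partial>lborel) \<partial>gam p)"
    using cap_mean_eq_dens[OF p, of r a b k] r by (simp add: eq)
  then show ?thesis
    unfolding cap_integral_def
    using nn_integral_cmult[OF measurable_dens_inner[where p=p and k=k and a=a and b=b and s=1 and r=r]] by simp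
qed

lemma continuous_on_dens: "continuous_on UNIV (dens p k J)"
proof -
  have "dens p k J = (\<lambda>z. ennreal ((\<Prod>a\<in>UNIV. std_normal_density (crit_map p k J z $ a)) * \<bar>det (matrix (dcrit_map p k J z))\<bar>))"
    by (simp add: fun_eq_iff dens_def prod_ennreal ennreal_mult prod_nonneg)
  moreover have "continuous_on UNIV (crit_map p k J)"
    using has_derivative_crit_map has_derivative_continuous
    by (intro continuous_at_imp_continuous_on ballI) blast
  ultimately show ?thesis
    unfolding std_normal_density_def
    by (auto intro!: continuous_on_ennreal continuous_intros continuous_on_det continuous_on_dcrit_map)
qed

lemma finite_lborel_chart_region: "emeasure lborel (chart_region k a b r) < \<infinity>"
  by (intro emeasure_bounded_finite compact_imp_bounded compact_chart_region)

text \<open>Squeezing by \<open>r\<close> in [0, 1] stays in the region of radius 1, so one majorant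
  serves all these \<open>r\<close>. It gives finiteness as well as dominated convergence.\<close>

lemma cap_integral_bound:
  fixes k :: "'n::finite"
  shows "\<exists>W. W \<in> borel_measurable (gam p \<Otimes>\<^sub>M lborel) \<and> integral\<^sup>N (gam p \<Otimes>\<^sub>M lborel) W < \<infinity> \<and>
    (\<forall>r\<in>{0..1}. \<forall>w. dens p k (fst w) (squeeze k r (snd w)) * indicator (chart_region k a b 1) (snd w) \<le> W w)"
proof -
  obtain C where C: "C \<ge> 0" "\<And>J z. z \<in> chart_region k a b 1 \<Longrightarrow> dens p k J z \<le>
    ennreal (C * exp (real CARD('n) * (\<Sum>i | length i = p. \<bar>J i\<bar>)))"
    using dens_le[where p=p and k=k and a=a and b=b] by blast
  define e where "e = (\<lambda>J :: 'n list \<Rightarrow> real. ennreal (exp (real CARD('n) * (\<Sum>i | length i = p. \<bar>J i\<bar>))))"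
  have [measurable]: "e \<in> borel_measurable (gam p)"
  proof -
    have "(\<lambda>J :: 'n list \<Rightarrow> real. \<Sum>i | length i = p. \<bar>J i\<bar>) \<in> borel_measurable (gam p)"
      by (intro borel_measurable_sum borel_measurable_abs) simp
    then show ?thesis unfolding e_def by measurable
  qed
  define W where "W = (\<lambda>w. ennreal C * e (fst w) * indicator (chart_region k a b 1) (snd w))"
  have "W \<in> borel_measurable (gam p \<Otimes>\<^sub>M lborel)" unfolding W_def by measurable
  moreover have "integral\<^sup>N (gam p \<Otimes>\<^sub>M lborel) W < \<infinity>"
  proof -
    have "integral\<^sup>N (gam p \<Otimes>\<^sub>M lborel) W = (\<integral>\<^sup>+J. \<integral>\<^sup>+z. W (J, z) \<partial>lborel \<partial>gam p)"
      by (rule lborel.nn_integral_fst[symmetric]) fact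
    also have "\<dots> = (\<integral>\<^sup>+J. ennreal C * e J * emeasure lborel (chart_region k a b 1) \<partial>gam p)"
      unfolding W_def by (simp add: nn_integral_cmult)
    also have "\<dots> = ennreal C * (\<integral>\<^sup>+J. e J \<partial>gam p) * emeasure lborel (chart_region k a b 1)"
      by (simp add: nn_integral_multc nn_integral_cmult)
    also have "\<dots> < \<infinity>"
      using nn_integral_exp_gam[where 'n='n and c="real CARD('n)" and p=p] finite_lborel_chart_region[of k a b 1]
      by (simp add: e_def ennreal_mult_less_top)
    finally show ?thesis .
  qed
  moreover have "dens p k (fst w) (squeeze k r (snd w)) * indicator (chart_region k a b 1) (snd w) \<le> W w"
    if r: "r \<in> {0..1}" for r w
  proof (cases "snd w \<in> chart_region k a b 1")
    case True
    then have "squeeze k r (snd w) \<in> chart_region k a b 1" using r by (intro squeeze_chart_region_1) auto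
    from C(2)[OF this, of "fst w"] show ?thesis
      using True C(1) by (simp add: W_def e_def ennreal_mult)
  qed (simp add: W_def)
  ultimately show ?thesis by blast
qed

lemma cap_integral_eq_pair:
  "cap_integral p k a b r = (\<integral>\<^sup>+w. dens p k (fst w) (squeeze k r (snd w)) * indicator (chart_region k a b 1) (snd w) \<partial>(gam p \<Otimes>\<^sub>M lborel))"
  unfolding cap_integral_def using lborel.nn_integral_fst[OF measurable_dens_squeeze[where p=p and k=k and a=a and b=b and s=1 and r=r]] by simp

lemma cap_integral_finite:
  assumes "0 \<le> r" "r \<le> 1"
  shows "cap_integral p k a b r < \<infinity>"
proof -
  obtain W where W: "integral\<^sup>N (gam p \<Otimes>\<^sub>M lborel) W < \<infinity>"
    "\<forall>r\<in>{0..1}. \<forall>w. dens p k (fst w) (squeeze k r (snd w)) * indicator (chart_region k a b 1) (snd w) \<le> W w"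
    using cap_integral_bound[where p=p and k=k and a=a and b=b] by blast
  have "cap_integral p k a b r \<le> integral\<^sup>N (gam p \<Otimes>\<^sub>M lborel) W"
    unfolding cap_integral_eq_pair using W(2) assms by (intro nn_integral_mono) auto
  then show ?thesis using W(1) by (rule le_less_trans)
qed

lemma cap_integral_tendsto: "(\<lambda>n. cap_integral p k a b (1 / real (Suc n))) \<longlonglongrightarrow> cap_integral p k a b 0"
proof -
  obtain W where W: "W \<in> borel_measurable (gam p \<Otimes>\<^sub>M lborel)" "integral\<^sup>N (gam p \<Otimes>\<^sub>M lborel) W < \<infinity>"
    "\<forall>r\<in>{0..1}. \<forall>w. dens p k (fst w) (squeeze k r (snd w)) * indicator (chart_region k a b 1) (snd w) \<le> W w"
    using cap_integral_bound[where p=p and k=k and a=a and b=b] by blast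
  show ?thesis unfolding cap_integral_eq_pair
  proof (rule nn_integral_dominated_convergence[OF measurable_dens_squeeze measurable_dens_squeeze W(1) _ W(2)])
    show "AE w in gam p \<Otimes>\<^sub>M lborel. dens p k (fst w) (squeeze k (1 / real (Suc n)) (snd w)) *
        indicator (chart_region k a b 1) (snd w) \<le> W w" for n
      using W(3) by (intro AE_I2) auto
    show "AE w in gam p \<Otimes>\<^sub>M lborel. (\<lambda>n. dens p k (fst w) (squeeze k (1 / real (Suc n)) (snd w)) *
        indicator (chart_region k a b 1) (snd w)) \<longlonglongrightarrow> dens p k (fst w) (squeeze k 0 (snd w)) * indicator (chart_region k a b 1) (snd w)"
    proof (intro AE_I2)
      fix w :: "('a list \<Rightarrow> real) \<times> (real^'a)"
      have "(\<lambda>n. 1 / real (Suc n)) \<longlonglongrightarrow> 0"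
        using LIMSEQ_inverse_real_of_nat by (simp add: inverse_eq_divide)
      then have "(\<lambda>n. squeeze k (1 / real (Suc n)) (snd w)) \<longlonglongrightarrow> squeeze k 0 (snd w)"
        unfolding squeeze_def by (intro tendsto_intros)
      then have "(\<lambda>n. dens p k (fst w) (squeeze k (1 / real (Suc n)) (snd w))) \<longlonglongrightarrow> dens p k (fst w) (squeeze k 0 (snd w))"
        using continuous_on_tendsto_compose[OF continuous_on_dens[of p k "fst w"]] by simp
      then show "(\<lambda>n. dens p k (fst w) (squeeze k (1 / real (Suc n)) (snd w)) * indicator (chart_region k a b 1) (snd w))
        \<longlonglongrightarrow> dens p k (fst w) (squeeze k 0 (snd w)) * indicator (chart_region k a b 1) (snd w)"
        by (cases "snd w \<in> chart_region k a b 1") auto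
    qed
  qed
qed

text \<open>This is \<open>\<kappa>\<^sub>p(t)\<close>, the mean of the density on the axis of the chart.\<close>
definition kdens :: "nat \<Rightarrow> 'n::finite \<Rightarrow> real \<Rightarrow> ennreal" where
  "kdens p k t = (\<integral>\<^sup>+J. dens p k J (t *\<^sub>R axis k 1) \<partial>gam p)"

lemma kdens_borel [measurable]: "kdens p k \<in> borel_measurable borel"
proof -
  interpret G: prob_space "gam p :: ('a list \<Rightarrow> real) measure" by (rule prob_space_gam)
  have [measurable]: "(\<lambda>t::real. t *\<^sub>R axis k (1::real)) \<in> borel_measurable borel"
    by (intro borel_measurable_continuous_onI continuous_intros)
  have "(\<lambda>w. (snd w, fst w *\<^sub>R axis k 1)) \<in> borel \<Otimes>\<^sub>M gam p \<rightarrow>\<^sub>M gam p \<Otimes>\<^sub>M (borel :: (real^'a) measure)"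
    by measurable
  from measurable_compose[OF this measurable_dens[of p k]]
  have "(\<lambda>(t, J). dens p k J (t *\<^sub>R axis k 1)) \<in> borel_measurable (borel \<Otimes>\<^sub>M gam p)"
    by (simp add: case_prod_beta')
  then show ?thesis unfolding kdens_def[abs_def] by (rule G.borel_measurable_nn_integral)
qed

text \<open>The volume of the unit ball in \<open>CARD('n) - 1\<close> dimensions, written as that
  of a slab of height 1. It is the same for every \<open>p\<close> and cancels in the
  comparison.\<close>

definition slab_vol :: "'n::finite \<Rightarrow> ennreal" where
  "slab_vol k = emeasure lborel (chart_region k 0 1 1)"

text \<open>Fubini with the energy as outer variable. The inner volume \<open>V\<close> does not
  depend on \<open>h\<close>, \<open>a\<close> and \<open>b\<close>; the constant 1 on [0, 1]
  identifies it.\<close>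

lemma nn_integral_slab:
  fixes k :: "'n::finite"
  assumes h [measurable]: "h \<in> borel_measurable borel"
  shows "(\<integral>\<^sup>+z\<in>chart_region k a b 1. h (z $ k) \<partial>lborel) = slab_vol k * (\<integral>\<^sup>+t\<in>{a..b}. h t \<partial>lborel)"
proof -
  interpret product_sigma_finite "\<lambda>_::'n. lborel :: real measure" ..
  define V where "V = (\<integral>\<^sup>+x. indicator {x. norm (off_pole k (vec_lambda (x(k := 0)))) \<le> 1} x \<partial>PiM (UNIV - {k}) (\<lambda>_::'n. lborel :: real measure))"
  have *: "(\<integral>\<^sup>+z\<in>chart_region k a b 1. g (z $ k) \<partial>lborel) = V * (\<integral>\<^sup>+t\<in>{a..b}. g t \<partial>lborel)"
    if g [measurable]: "g \<in> borel_measurable borel" for g a b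
  proof -
    define I where "I = insert k (UNIV - {k})"
    have I: "UNIV = I" by (auto simp: I_def)
    have e: "vec_lambda (x(k := t)) \<in> chart_region k a b 1 \<longleftrightarrow> t \<in> {a..b} \<and> norm (off_pole k (vec_lambda (x(k := 0)))) \<le> 1"
      for x and t :: real
    proof -
      have "off_pole k (vec_lambda (x(k := t))) = off_pole k (vec_lambda (x(k := 0)))"
        by (simp add: Finite_Cartesian_Product.vec_eq_iff off_pole_nth)
      then show ?thesis by (simp add: chart_region_def)
    qed
    have "(\<integral>\<^sup>+z\<in>chart_region k a b 1. g (z $ k) \<partial>lborel) =
      (\<integral>\<^sup>+x. g (x k) * indicator (chart_region k a b 1) (vec_lambda x) \<partial>PiM UNIV (\<lambda>_. lborel))"
      by (subst lborel_vec_eq_PiM, subst nn_integral_distr) auto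
    also have "\<dots> = (\<integral>\<^sup>+x. g (x k) * indicator (chart_region k a b 1) (vec_lambda x) \<partial>PiM (insert k (UNIV - {k})) (\<lambda>_. lborel))"
      using I unfolding I_def by simp
    also have "\<dots> = (\<integral>\<^sup>+t. \<integral>\<^sup>+x. g ((x(k := t)) k) * indicator (chart_region k a b 1) (vec_lambda (x(k := t)))
        \<partial>PiM (UNIV - {k}) (\<lambda>_. lborel) \<partial>lborel)"
    proof (rule product_nn_integral_insert_rev)
      have "(\<lambda>x. g (x k) * indicator (chart_region k a b 1) (vec_lambda x)) \<in> borel_measurable (PiM UNIV (\<lambda>_. lborel))"
        by measurable
      then show "(\<lambda>x. g (x k) * indicator (chart_region k a b 1) (vec_lambda x)) \<in> borel_measurable (PiM (insert k (UNIV - {k})) (\<lambda>_. lborel))"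
        using I unfolding I_def by simp
    qed auto
    also have "\<dots> = (\<integral>\<^sup>+t. \<integral>\<^sup>+x. (g t * indicator {a..b} t) * indicator {x. norm (off_pole k (vec_lambda (x(k := 0)))) \<le> 1} x
        \<partial>PiM (UNIV - {k}) (\<lambda>_. lborel) \<partial>lborel)"
      by (intro nn_integral_cong) (auto simp: e indicator_def)
    also have "\<dots> = (\<integral>\<^sup>+t. (g t * indicator {a..b} t) * V \<partial>lborel)"
    proof (rule nn_integral_cong)
      fix t :: real
      have "{x \<in> space (PiM (UNIV - {k}) (\<lambda>_::'n. lborel :: real measure)). norm (off_pole k (vec_lambda (x(k := 0)))) \<le> 1}
          \<in> sets (PiM (UNIV - {k}) (\<lambda>_. lborel))"
      proof -
        have "(\<lambda>x. off_pole k (vec_lambda (x(k := 0)))) \<in> borel_measurable (PiM (UNIV - {k}) (\<lambda>_::'n. lborel :: real measure))"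
        proof (rule measurable_vecI)
          fix i
          have "(\<lambda>x. x i) \<in> borel_measurable (PiM (UNIV - {k}) (\<lambda>_::'n. lborel :: real measure))" if "i \<noteq> k"
            using measurable_component_singleton[of i "UNIV - {k}" "\<lambda>_. lborel :: real measure"] that by simp
          then show "(\<lambda>x. off_pole k (vec_lambda (x(k := 0))) $ i) \<in> borel_measurable (PiM (UNIV - {k}) (\<lambda>_::'n. lborel :: real measure))"
            by (cases "i = k") (simp_all add: off_pole_nth)
        qed
        then show ?thesis by measurable
      qed
      then have m: "(\<lambda>x. indicator {x. norm (off_pole k (vec_lambda (x(k := 0)))) \<le> 1} x :: ennreal)
          \<in> borel_measurable (PiM (UNIV - {k}) (\<lambda>_::'n. lborel :: real measure))"
        by (subst borel_measurable_indicator_iff) (auto simp: Int_def conj_commute)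
      show "(\<integral>\<^sup>+x. (g t * indicator {a..b} t) * indicator {x. norm (off_pole k (vec_lambda (x(k := 0)))) \<le> 1} x
        \<partial>PiM (UNIV - {k}) (\<lambda>_. lborel)) = (g t * indicator {a..b} t) * V"
        unfolding V_def by (rule nn_integral_cmult[OF m])
    qed
    also have "\<dots> = V * (\<integral>\<^sup>+t\<in>{a..b}. g t \<partial>lborel)"
      by (subst nn_integral_multc) (auto simp: mult.commute)
    finally show ?thesis .
  qed
  have "slab_vol k = V"
    using *[of "\<lambda>_. 1" 0 1] by (simp add: slab_vol_def)
  then show ?thesis using *[OF h] by simp
qed

lemma slab_vol_bounds: "0 < slab_vol k" "slab_vol k < \<infinity>"
proof -
  show "slab_vol k < \<infinity>" unfolding slab_vol_def by (rule finite_lborel_chart_region)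
  have sub: "ball ((1/2) *\<^sub>R axis k 1) (1/2) \<subseteq> chart_region k 0 1 1"
  proof
    fix z assume "z \<in> ball ((1/2) *\<^sub>R axis k (1::real)) (1/2)"
    then have d: "norm (z - (1/2) *\<^sub>R axis k 1) < 1/2" by (simp add: dist_norm norm_minus_commute)
    have "\<bar>(z - (1/2) *\<^sub>R axis k 1) $ k\<bar> < 1/2" using component_le_norm_cart[of "z - (1/2) *\<^sub>R axis k 1" k] d by linarith
    then have "\<bar>z $ k - 1/2\<bar> < 1/2" by (simp add: axis_def)
    then have 1: "z $ k \<in> {0..1}" unfolding abs_less_iff atLeastAtMost_iff by linarith
    have "off_pole k z = (z - (1/2) *\<^sub>R axis k 1) - ((z - (1/2) *\<^sub>R axis k 1) $ k) *\<^sub>R axis k 1"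
      by (simp add: Finite_Cartesian_Product.vec_eq_iff off_pole_nth axis_def)
    then have "norm (off_pole k z) \<le> norm (z - (1/2) *\<^sub>R axis k 1) + norm (((z - (1/2) *\<^sub>R axis k 1) $ k) *\<^sub>R axis k (1::real))"
      by (metis norm_triangle_ineq4)
    also have "\<dots> \<le> 1/2 + 1/2" using d \<open>\<bar>(z - (1/2) *\<^sub>R axis k 1) $ k\<bar> < 1/2\<close> by (intro add_mono) auto
    finally show "z \<in> chart_region k 0 1 1" using 1 by (simp add: chart_region_def)
  qed
  have "0 < emeasure lborel (ball ((1/2) *\<^sub>R axis k (1::real)) (1/2))"
    by (simp add: emeasure_ball unit_ball_vol_pos)
  also have "\<dots> \<le> slab_vol k" unfolding slab_vol_def using sub by (intro emeasure_mono) auto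
  finally show "0 < slab_vol k" .
qed

lemma cap_integral_0: "cap_integral p k a b 0 = slab_vol k * (\<integral>\<^sup>+t\<in>{a..b}. kdens p k t \<partial>lborel)"
proof -
  interpret G: prob_space "gam p :: ('a list \<Rightarrow> real) measure" by (rule prob_space_gam)
  interpret P: pair_sigma_finite "gam p :: ('a list \<Rightarrow> real) measure" "lborel :: (real^'a) measure" ..
  have "cap_integral p k a b 0 = (\<integral>\<^sup>+z. (\<integral>\<^sup>+J. dens p k J (squeeze k 0 z) * indicator (chart_region k a b 1) z \<partial>gam p) \<partial>lborel)"
    unfolding cap_integral_def using P.Fubini[OF measurable_dens_squeeze[where p=p and k=k and a=a and b=b and s=1 and r=0]] by simp
  also have "\<dots> = (\<integral>\<^sup>+z\<in>chart_region k a b 1. kdens p k (z $ k) \<partial>lborel)"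
  proof (rule nn_integral_cong)
    fix z
    have s: "squeeze k 0 z = z $ k *\<^sub>R axis k 1" by (simp add: squeeze_def)
    show "(\<integral>\<^sup>+J. dens p k J (squeeze k 0 z) * indicator (chart_region k a b 1) z \<partial>gam p) = kdens p k (z $ k) * indicator (chart_region k a b 1) z"
      by (cases "z \<in> chart_region k a b 1") (auto simp: kdens_def s)
  qed
  also have "\<dots> = slab_vol k * (\<integral>\<^sup>+t\<in>{a..b}. kdens p k t \<partial>lborel)"
    by (rule nn_integral_slab) measurable
  finally show ?thesis .
qed

section \<open>Comparing two values of p\<close>

definition Ecrit :: "nat \<Rightarrow> ('n::finite) itself \<Rightarrow> real set \<Rightarrow> ennreal" where
  "Ecrit p _ B = (\<integral>\<^sup>+J. cnt (crit p J B :: (real^'n) set) \<partial>gam p)"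

lemma cnt_crit_Int_gam_measurable:
  "closed K \<Longrightarrow> (\<lambda>J. cnt (crit p J {a..b} \<inter> K)) \<in> borel_measurable (gam p)"
  by (rule cnt_crit_measurable) simp_all

lemma cnt_crit_gam_measurable: "(\<lambda>J. cnt (crit p J {a..b})) \<in> borel_measurable (gam p)"
  using cnt_crit_Int_gam_measurable[of UNIV p a b] by simp

lemma cnt_UN_le: "finite I \<Longrightarrow> cnt (\<Union>i\<in>I. X i) \<le> (\<Sum>i\<in>I. cnt (X i))"
  unfolding cnt_def by (rule emeasure_subadditive_finite) auto

lemma cap_mean_finite:
  fixes c :: "real^'n::{finite,wellorder}"
  assumes p: "p \<ge> 2" and c: "norm c = 1" and r: "0 < r" "r \<le> 1"
  shows "cap_mean p {a..b} (1 / sqrt (1 + r\<^sup>2)) c < \<infinity>"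
proof -
  have "cap_mean p {a..b} (1 / sqrt (1 + r\<^sup>2)) c = cap_mean p {a..b} (1 / sqrt (1 + r\<^sup>2)) (axis undefined 1 :: real^'n::_)"
    using p c by (intro cap_mean_rot) auto
  also have "\<dots> < \<infinity>"
    unfolding cap_mean_eq_cap_integral[OF p r(1)] using cap_integral_finite[where r=r and p=p and k="undefined::'n" and a=a and b=b] r
    by (simp add: ennreal_mult_less_top)
  finally show ?thesis .
qed

text \<open>By compactness finitely many caps of the height belonging to \<open>r = 1\<close> cover
  the sphere, and each has a finite mean.\<close>

lemma Ecrit_finite:
  assumes p: "p \<ge> 2"
  shows "Ecrit p TYPE('n::{finite,wellorder}) {a..b} < \<infinity>"
proof -
  define \<theta> :: real where "\<theta> = 1 / sqrt (1 + 1\<^sup>2)"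
  have \<theta>: "\<theta> < 1" by (simp add: \<theta>_def)
  have "compact (sphere 0 1 :: (real^'n::_) set)" by simp
  moreover have "\<And>c. c \<in> sphere 0 1 \<Longrightarrow> open {x::real^'n::_. \<theta> < c \<bullet> x}"
    by (intro open_Collect_less continuous_intros)
  moreover have "sphere 0 1 \<subseteq> (\<Union>c\<in>sphere 0 1. {x::real^'n::_. \<theta> < c \<bullet> x})"
  proof
    fix x :: "real^'n::_" assume "x \<in> sphere 0 1"
    then have "x \<bullet> x = 1" by (simp add: dot_square_norm)
    then show "x \<in> (\<Union>c\<in>sphere 0 1. {x. \<theta> < c \<bullet> x})" using \<theta> \<open>x \<in> sphere 0 1\<close> by (auto intro!: bexI[of _ x])
  qed
  ultimately obtain D where D: "D \<subseteq> sphere 0 1" "finite D" "sphere 0 1 \<subseteq> (\<Union>c\<in>D. {x::real^'n::_. \<theta> < c \<bullet> x})"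
    by (rule compactE_image)
  have "Ecrit p TYPE('n) {a..b} \<le> (\<integral>\<^sup>+J. (\<Sum>c\<in>D. cnt (crit p J {a..b} \<inter> {x. c \<bullet> x \<ge> \<theta>})) \<partial>gam p)"
    unfolding Ecrit_def
  proof (rule nn_integral_mono)
    fix J :: "'n list \<Rightarrow> real"
    have "crit p J {a..b} \<subseteq> (\<Union>c\<in>D. crit p J {a..b} \<inter> {x. c \<bullet> x \<ge> \<theta>})"
      using D(3) by (force simp: crit_def)
    then show "cnt (crit p J {a..b}) \<le> (\<Sum>c\<in>D. cnt (crit p J {a..b} \<inter> {x. c \<bullet> x \<ge> \<theta>}))"
      by (rule order_trans[OF cnt_mono cnt_UN_le[OF D(2)]])
  qed
  also have "\<dots> = (\<Sum>c\<in>D. cap_mean p {a..b} \<theta> c)"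
    unfolding cap_mean_def by (rule nn_integral_sum) (simp add: cnt_crit_Int_gam_measurable)
  also have "\<dots> < \<infinity>"
    unfolding \<theta>_def using D(1,2) p cap_mean_finite[of p _ 1 a b] by (auto simp: subset_iff)
  finally show ?thesis .
qed

lemma AE_finite_crit:
  assumes p: "p \<ge> 2"
  shows "AE J in gam p. finite (crit p J {a..b} :: (real^'n::{finite,wellorder}) set)"
proof -
  have "AE J in gam p. cnt (crit p J {a..b} :: (real^'n::_) set) \<noteq> \<infinity>"
    using Ecrit_finite[OF p, where 'n='n and a=a and b=b] unfolding Ecrit_def
    by (intro nn_integral_noteq_infinite cnt_crit_gam_measurable) auto
  then show ?thesis by (rule AE_mp) (intro AE_I2 impI, metis cnt_infinite)
qed

lemma cnt_SIGMA:
  assumes "finite X"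
  shows "cnt {(x, y). x \<in> X \<and> y \<in> Y x} = (\<Sum>x\<in>X. cnt (Y x))"
proof -
  have "{(x, y). x \<in> X \<and> y \<in> Y x} = (\<Union>x\<in>X. Pair x ` Y x)" by auto
  then have "cnt {(x, y). x \<in> X \<and> y \<in> Y x} = (\<Sum>x\<in>X. cnt (Pair x ` Y x))"
    unfolding cnt_def using assms
    by (simp add: sum_emeasure[symmetric] disjoint_family_on_def) (subst sum_emeasure, auto simp: disjoint_family_on_def)
  also have "\<dots> = (\<Sum>x\<in>X. cnt (Y x))"
    by (intro sum.cong refl cnt_bij_betw[symmetric, of "Pair _"]) (auto simp: bij_betw_def inj_on_def)
  finally show ?thesis .
qed

definition crit_pairs where
  "crit_pairs p q J J' a b a' b' \<theta> =
    {(x, y). x \<in> crit p J {a..b} \<and> y \<in> crit q J' {a'..b'} \<and> x \<bullet> y \<ge> \<theta>}"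

lemma measurable_cnt_crit_pairs:
  "(\<lambda>w. cnt (crit_pairs p q (fst w) (snd w) a b a' b' \<theta> :: ((real^'n::finite) \<times> (real^'n)) set)) \<in> borel_measurable (gam p \<Otimes>\<^sub>M gam q)"
proof -
  let ?K = "sphere 0 1 \<times> sphere 0 1 \<inter> {z::(real^'n) \<times> (real^'n). fst z \<bullet> snd z \<ge> \<theta>}"
  define F where "F = (\<lambda>w (z::(real^'n) \<times> (real^'n)). crit_defect p (fst w) a b (fst z) + crit_defect q (snd w) a' b' (snd z))"
  have "crit_pairs p q (fst w) (snd w) a b a' b' \<theta> = {z \<in> ?K. F w z = 0}" for w
    by (auto simp: crit_pairs_def F_def crit_eq_defect add_nonneg_eq_0_iff crit_defect_nonneg)
  moreover have "(\<lambda>w. cnt {z \<in> ?K. F w z = 0}) \<in> borel_measurable (gam p \<Otimes>\<^sub>M gam q)"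
  proof (rule cnt_zeros_measurable)
    show "compact ?K"
      by (intro compact_Int_closed compact_Times closed_Collect_le continuous_intros) auto
    show "continuous_on ?K (F w)" for w
      unfolding F_def by (intro continuous_intros)
    show "(\<lambda>w. F w z) \<in> borel_measurable (gam p \<Otimes>\<^sub>M gam q)" for z
      unfolding F_def
      by (intro borel_measurable_add measurable_crit_defect)
        (auto intro: measurable_compose[OF measurable_fst] measurable_compose[OF measurable_snd])
  qed
  ultimately show ?thesis by simp
qed

text \<open>Given a finite critical set for \<open>J\<close>, the pairs are counted by summing over
  its points \<open>x\<close> the number of critical points for \<open>J'\<close> in the cap around
  \<open>x\<close>; the mean of that number over \<open>J'\<close> is the same for all
  \<open>x\<close>.\<close>

lemma crit_pairs_mean:
  assumes p: "p \<ge> 2" and q: "q \<ge> 2"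
  shows "(\<integral>\<^sup>+J. \<integral>\<^sup>+J'. cnt (crit_pairs p q J J' a b a' b' \<theta> :: ((real^'n::{finite,wellorder}) \<times> (real^'n::_)) set) \<partial>gam q \<partial>gam p) =
    Ecrit p TYPE('n) {a..b} * cap_mean q {a'..b'} \<theta> (axis k 1 :: real^'n::_)"
proof -
  have "(\<integral>\<^sup>+J. \<integral>\<^sup>+J'. cnt (crit_pairs p q J J' a b a' b' \<theta> :: ((real^'n::_) \<times> (real^'n::_)) set) \<partial>gam q \<partial>gam p) =
    (\<integral>\<^sup>+J. cnt (crit p J {a..b} :: (real^'n::_) set) * cap_mean q {a'..b'} \<theta> (axis k 1 :: real^'n::_) \<partial>gam p)"
  proof (rule nn_integral_cong_AE, rule AE_mp[OF AE_finite_crit[OF p, of a b]], intro AE_I2 impI)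
    fix J :: "'n list \<Rightarrow> real"
    assume fin: "finite (crit p J {a..b})"
    have "(\<integral>\<^sup>+J'. cnt (crit_pairs p q J J' a b a' b' \<theta> :: ((real^'n::_) \<times> (real^'n::_)) set) \<partial>gam q) =
      (\<integral>\<^sup>+J'. (\<Sum>x\<in>crit p J {a..b}. cnt (crit q J' {a'..b'} \<inter> {y. x \<bullet> y \<ge> \<theta>})) \<partial>gam q)"
      by (intro nn_integral_cong) (simp add: cnt_SIGMA[OF fin, symmetric] crit_pairs_def)
    also have "\<dots> = (\<Sum>x\<in>crit p J {a..b}. cap_mean q {a'..b'} \<theta> x)"
      unfolding cap_mean_def by (rule nn_integral_sum) (simp add: cnt_crit_Int_gam_measurable)
    also have "\<dots> = (\<Sum>x\<in>crit p J {a..b}. cap_mean q {a'..b'} \<theta> (axis k 1))"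
      using q by (intro sum.cong refl cap_mean_rot) (auto simp: crit_def)
    also have "\<dots> = cnt (crit p J {a..b}) * cap_mean q {a'..b'} \<theta> (axis k 1)"
      using fin by (simp add: cnt_finite)
    finally show "(\<integral>\<^sup>+J'. cnt (crit_pairs p q J J' a b a' b' \<theta>) \<partial>gam q) =
      cnt (crit p J {a..b}) * cap_mean q {a'..b'} \<theta> (axis k 1)" .
  qed
  also have "\<dots> = Ecrit p TYPE('n) {a..b} * cap_mean q {a'..b'} \<theta> (axis k 1 :: real^'n::_)"
    unfolding Ecrit_def by (rule nn_integral_multc) (rule cnt_crit_gam_measurable)
  finally show ?thesis .
qed

lemma Ecrit_cap_mean:
  fixes k :: "'n::{finite,wellorder}"
  assumes p: "p \<ge> 2" and q: "q \<ge> 2"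
  shows "Ecrit p TYPE('n) {a..b} * cap_mean q {a'..b'} \<theta> (axis k 1) =
    Ecrit q TYPE('n) {a'..b'} * cap_mean p {a..b} \<theta> (axis k 1)"
proof -
  interpret P: prob_space "gam p :: ('n list \<Rightarrow> real) measure" by (rule prob_space_gam)
  interpret Q: prob_space "gam q :: ('n list \<Rightarrow> real) measure" by (rule prob_space_gam)
  interpret PQ: pair_sigma_finite "gam p :: ('n list \<Rightarrow> real) measure" "gam q :: ('n list \<Rightarrow> real) measure" ..
  let ?C = "\<lambda>p q J J' a b a' b'. cnt (crit_pairs p q J J' a b a' b' \<theta> :: ((real^'n::_) \<times> (real^'n::_)) set)"
  have sw: "?C p q J J' a b a' b' = ?C q p J' J a' b' a b" for J J'
    by (rule cnt_bij_betw[of prod.swap])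
      (rule bij_betwI[where g = prod.swap], auto simp: crit_pairs_def inner_commute)
  have "Ecrit p TYPE('n) {a..b} * cap_mean q {a'..b'} \<theta> (axis k 1) =
    (\<integral>\<^sup>+J. \<integral>\<^sup>+J'. ?C p q J J' a b a' b' \<partial>gam q \<partial>gam p)"
    by (rule crit_pairs_mean[OF p q, symmetric])
  also have "\<dots> = (\<integral>\<^sup>+J'. \<integral>\<^sup>+J. ?C p q J J' a b a' b' \<partial>gam p \<partial>gam q)"
    using PQ.Fubini[OF measurable_cnt_crit_pairs[of p q a b a' b' \<theta>]] by simp
  also have "\<dots> = Ecrit q TYPE('n) {a'..b'} * cap_mean p {a..b} \<theta> (axis k 1)"
    unfolding sw by (rule crit_pairs_mean[OF q p])
  finally show ?thesis .
qed

text \<open>Once the common power of \<open>r\<close> is cancelled, the symmetric identity for caps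
  passes to the limit of vanishing radius. Finiteness of \<open>Ecrit\<close> makes multiplication
  by it continuous, and the slab volume cancels.\<close>

proposition Ecrit_kdens_proportional:
  fixes k :: "'n::{finite,wellorder}"
  assumes p: "p \<ge> 2" and q: "q \<ge> 2"
  shows "Ecrit p TYPE('n) {a..b} * (\<integral>\<^sup>+t\<in>{a'..b'}. kdens q k t \<partial>lborel) =
    Ecrit q TYPE('n) {a'..b'} * (\<integral>\<^sup>+t\<in>{a..b}. kdens p k t \<partial>lborel)"
proof -
  have eq: "Ecrit p TYPE('n) {a..b} * cap_integral q k a' b' r = Ecrit q TYPE('n) {a'..b'} * cap_integral p k a b r"
    if r: "r > 0" for r
  proof -
    define c where "c = ennreal (r ^ (CARD('n) - 1))"
    have c: "c \<noteq> 0" "c \<noteq> \<infinity>" using r by (auto simp: c_def)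
    have "c * (Ecrit p TYPE('n) {a..b} * cap_integral q k a' b' r) = c * (Ecrit q TYPE('n) {a'..b'} * cap_integral p k a b r)"
      using Ecrit_cap_mean[OF p q, where a=a and b=b and a'=a' and b'=b' and \<theta>="1 / sqrt (1 + r\<^sup>2)" and k=k]
      unfolding cap_mean_eq_cap_integral[OF p r] cap_mean_eq_cap_integral[OF q r] c_def[symmetric]
      by (simp add: mult_ac)
    then show ?thesis using c by (simp add: ennreal_mult_cancel_left)
  qed
  have "(\<lambda>n. Ecrit p TYPE('n) {a..b} * cap_integral q k a' b' (1 / real (Suc n))) \<longlonglongrightarrow> Ecrit p TYPE('n) {a..b} * cap_integral q k a' b' 0"
    using Ecrit_finite[OF p, where 'n='n and a=a and b=b] by (intro ennreal_tendsto_cmult cap_integral_tendsto) auto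
  moreover have "(\<lambda>n. Ecrit q TYPE('n) {a'..b'} * cap_integral p k a b (1 / real (Suc n))) \<longlonglongrightarrow> Ecrit q TYPE('n) {a'..b'} * cap_integral p k a b 0"
    using Ecrit_finite[OF q, where 'n='n and a=a' and b=b'] by (intro ennreal_tendsto_cmult cap_integral_tendsto) auto
  ultimately have "Ecrit p TYPE('n) {a..b} * cap_integral q k a' b' 0 = Ecrit q TYPE('n) {a'..b'} * cap_integral p k a b 0"
    using eq by (intro LIMSEQ_unique) auto
  then have "slab_vol k * (Ecrit p TYPE('n) {a..b} * (\<integral>\<^sup>+t\<in>{a'..b'}. kdens q k t \<partial>lborel)) =
    slab_vol k * (Ecrit q TYPE('n) {a'..b'} * (\<integral>\<^sup>+t\<in>{a..b}. kdens p k t \<partial>lborel))"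
    unfolding cap_integral_0 by (simp add: mult_ac)
  then show ?thesis using slab_vol_bounds[of k] by (auto simp: ennreal_mult_cancel_left)
qed

lemma kdens_integral_finite:
  fixes k :: "'n::{finite,wellorder}"
  shows "(\<integral>\<^sup>+t\<in>{a..b}. kdens p k t \<partial>lborel) < \<infinity>"
proof -
  have "slab_vol k * (\<integral>\<^sup>+t\<in>{a..b}. kdens p k t \<partial>lborel) < \<infinity>"
    using cap_integral_finite[of 0 p k a b] by (simp add: cap_integral_0)
  then show ?thesis using slab_vol_bounds(1)[of k] by (auto simp: ennreal_mult_less_top)
qed

section \<open>The density at the pole\<close>

text \<open>At the pole, the derivatives up to second order of a monomial in directions orthogonal to the pole depend
  only on the multiset of its indices other than \<open>k\<close>, so the couplings are grouped by that multiset.\<close>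
definition key :: "'n \<Rightarrow> 'n list \<Rightarrow> 'n multiset" where
  "key k i = mset (filter (\<lambda>x. x \<noteq> k) i)"

lemma key_simps [simp]: "key k [] = {#}" "key k (x # i) = (if x = k then key k i else add_mset x (key k i))"
  by (auto simp: key_def)

lemma axis_nth: "axis k x $ a = (if a = k then x else 0)"
  by (simp add: axis_def)

lemma mon_pole: "mon i (axis k 1) = of_bool (key k i = {#})"
  by (induction i) (auto simp: axis_nth)

lemma gmon_pole: "a \<noteq> k \<Longrightarrow> gmon i (axis k 1) $ a = of_bool (key k i = {#a#})"
  by (induction i) (auto simp: axis_nth mon_pole)

lemma gmon_pole_k: "gmon i (axis k 1) $ k = real (length i) * mon i (axis k 1)"
  using gmon_euler[of i "axis k 1"] by (simp add: inner_axis)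

text \<open>A second derivative in tangential directions \<open>a\<close>, \<open>b\<close> survives
  at the pole only if the indices other than \<open>k\<close> are exactly \<open>a\<close> and
  \<open>b\<close>. The value 2 for \<open>a = b\<close> is the second derivative of a
  square.\<close>

lemma hmon_pole:
  "a \<noteq> k \<Longrightarrow> b \<noteq> k \<Longrightarrow> hmon i (axis k 1) (axis b 1) $ a = (if key k i = {#a, b#} then 1 + of_bool (a = b) else 0)"
proof (induction i)
  case (Cons x i)
  have 1: "gmon i (axis k 1) \<bullet> axis b 1 = of_bool (key k i = {#b#})"
    using Cons.prems by (simp add: inner_axis gmon_pole)
  have "hmon (x # i) (axis k 1) (axis b 1) $ a =
    of_bool (x = a \<and> key k i = {#b#}) + of_bool (x = b \<and> key k i = {#a#}) + of_bool (x = k) * hmon i (axis k 1) (axis b 1) $ a"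
    using Cons.prems by (simp add: 1 gmon_pole axis_nth)
  also have "\<dots> = (if key k (x # i) = {#a, b#} then 1 + of_bool (a = b) else 0)"
  proof (cases "x = k")
    case False
    have "add_mset x (key k i) = {#a, b#} \<longleftrightarrow> (x = a \<and> key k i = {#b#}) \<or> (x = b \<and> key k i = {#a#})"
      by (auto simp: add_eq_conv_ex)
    then show ?thesis using False by auto
  qed (use Cons in auto)
  finally show ?case .
qed simp

text \<open>Euler's identity for the gradient, whose degree of homogeneity is one less than that of
  the monomial.\<close>

lemma hmon_pole_k:
  "h $ k = 0 \<Longrightarrow> hmon i (axis k 1) h $ k = (real (length i) - 1) * (gmon i (axis k 1) \<bullet> h)"
proof (induction i)
  case (Cons x i)
  show ?case
  proof (cases "x = k")
    case True
    then show ?thesis using Cons by (simp add: inner_add_left inner_axis' algebra_simps axis_nth)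
  next
    case False
    then show ?thesis using Cons
      by (simp add: inner_add_left inner_axis' gmon_pole_k axis_nth)
  qed
qed simp

text \<open>The couplings that are solved for are sent to the key \<open>{#}\<close>, so a group
  with nonempty key contains remaining couplings only.\<close>

definition gsum :: "nat \<Rightarrow> 'n::finite \<Rightarrow> ('n list \<Rightarrow> real) \<Rightarrow> 'n multiset \<Rightarrow> real" where
  "gsum p k J \<kappa> = (\<Sum>i\<in>{i \<in> {i. length i = p}. (if tl i = replicate (p - 1) k then {#} else key k i) = \<kappa>}. J i)"

lemma gsum_eq: "\<kappa> \<noteq> {#} \<Longrightarrow> (\<Sum>i | length i = p. other_couplings p k J i * of_bool (key k i = \<kappa>)) = gsum p k J \<kappa>"
  unfolding gsum_def by (rule sum.mono_neutral_cong_right) (auto simp: other_couplings_def)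

text \<open>The derivative of the chart map at the pole. Off row and column \<open>k\<close> it is minus the Hessian on the
  sphere, with \<open>s = p t\<close> coming from the Lagrange multiplier.\<close>
definition pole_hessian :: "'n::finite \<Rightarrow> real \<Rightarrow> ('n multiset \<Rightarrow> real) \<Rightarrow> real^'n^'n" where
  "pole_hessian k s Y = (\<chi> a b. if a = k \<and> b = k then 1 else if a = k \<or> b = k then 0
     else s * of_bool (a = b) - (1 + of_bool (a = b)) * Y {#a, b#})"

lemma chart_point_pole: "chart_point k (t *\<^sub>R axis k 1) = axis k 1"
  by (simp add: Finite_Cartesian_Product.vec_eq_iff chart_point_nth axis_nth)

lemma off_pole_axis: "off_pole k (axis b 1) = (if b = k then 0 else axis b 1)"
  by (auto simp: Finite_Cartesian_Product.vec_eq_iff off_pole_nth axis_nth)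

lemma other_couplings_mon_pole: "p \<ge> 1 \<Longrightarrow> length i = p \<Longrightarrow> other_couplings p k J i * mon i (axis k 1) = 0"
proof -
  assume p: "p \<ge> 1" and i: "length i = p"
  have "tl i = replicate (p - 1) k" if "key k i = {#}"
  proof -
    have "\<forall>x\<in>set i. x = k" using that by (auto simp: key_def filter_empty_conv)
    then have "i = replicate p k" using i by (metis replicate_eqI)
    then show ?thesis by simp
  qed
  then show ?thesis by (auto simp: mon_pole other_couplings_def)
qed

text \<open>The pole is critical of energy \<open>t\<close> iff \<open>J(k, \<dots>, k)\<close>
  equals \<open>t\<close> and each tangential derivative, which is
  \<open>J(a, k, \<dots>, k)\<close> plus the group sum of \<open>{#a#}\<close>, vanishes.\<close>

lemma crit_map_pole:
  assumes p: "p \<ge> 2"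
  shows "crit_map p k J (t *\<^sub>R axis k 1) $ a = (if a = k then t else - gsum p k J {#a#})"
proof -
  have f0: "homf p (other_couplings p k J) (axis k 1) = 0"
    unfolding homf_def using p other_couplings_mon_pole[of p _ k J] by (intro sum.neutral) auto
  have gk: "homg p (other_couplings p k J) (axis k 1) $ k = 0"
    using homg_euler[of p "other_couplings p k J" "axis k 1"] f0 by (simp add: inner_axis)
  have ga: "homg p (other_couplings p k J) (axis k 1) $ a = gsum p k J {#a#}" if "a \<noteq> k"
    using that gsum_eq[of "{#a#}" p k J] by (simp add: homg_def gmon_pole del: sum_mult_of_bool_eq)
  show ?thesis
    unfolding crit_map_def chart_point_pole by (cases "a = k") (auto simp: f0 gk ga axis_nth algebra_simps)
qed

text \<open>A change of \<open>z $ k\<close> affects the energy alone, which gives column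
  \<open>k\<close>. In the other columns the entry of row \<open>k\<close> cancels by Euler's
  identity for the gradient.\<close>

lemma dcrit_map_pole:
  assumes p: "p \<ge> 2"
  shows "matrix (dcrit_map p k J (t *\<^sub>R axis k 1)) = pole_hessian k (real p * t) (gsum p k J)"
proof -
  have tk: "(t *\<^sub>R axis k (1::real)) $ k = t" by (simp add: axis_nth)
  have "matrix (dcrit_map p k J (t *\<^sub>R axis k 1)) $ a $ b = pole_hessian k (real p * t) (gsum p k J) $ a $ b" for a b
  proof (cases "b = k")
    case True
    have "dP p k (t *\<^sub>R axis k 1) (axis b 1) = axis k 1"
      using True unfolding dP_def Let_def chart_point_pole off_pole_axis tk by (simp add: axis_nth algebra_simps)
    moreover have "dQ p k i (t *\<^sub>R axis k 1) (axis b 1) = 0" for i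
    proof -
      have "hmon i x 0 = 0" for x :: "real^'a" by (induction i) auto
      then show ?thesis using True by (simp add: dQ_def off_pole_axis)
    qed
    ultimately show ?thesis using True by (simp add: matrix_nth dcrit_map_def pole_hessian_def axis_nth)
  next
    case False
    have P: "dP p k (t *\<^sub>R axis k 1) (axis b 1) = (real p * t) *\<^sub>R axis b 1"
      using False unfolding dP_def Let_def chart_point_pole off_pole_axis tk
      by (simp add: inner_axis_axis axis_nth)
    have Q: "dQ p k i (t *\<^sub>R axis k 1) (axis b 1) $ a =
      (if a = k then 0 else (1 + of_bool (a = b)) * of_bool (key k i = {#a, b#}))" if "length i = p" for i
      using False that hmon_pole_k[of "axis b 1" k i] hmon_pole[of a k b i]
      unfolding dQ_def chart_point_pole off_pole_axis by (auto simp: axis_nth)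
    have "(\<Sum>i | length i = p. other_couplings p k J i * dQ p k i (t *\<^sub>R axis k 1) (axis b 1) $ a) =
      (if a = k then 0 else (1 + of_bool (a = b)) * gsum p k J {#a, b#})"
    proof -
      have "(\<Sum>i | length i = p. other_couplings p k J i * dQ p k i (t *\<^sub>R axis k 1) (axis b 1) $ a) =
        (\<Sum>i | length i = p. (if a = k then 0 else 1 + of_bool (a = b)) * (other_couplings p k J i * of_bool (key k i = {#a, b#})))"
        by (rule sum.cong[OF refl]) (use Q in auto)
      also have "\<dots> = (if a = k then 0 else 1 + of_bool (a = b)) * gsum p k J {#a, b#}"
        unfolding sum_distrib_left[symmetric] by (subst gsum_eq) auto
      finally show ?thesis by simp
    qed
    then show ?thesis using False
      by (simp add: matrix_nth dcrit_map_def P pole_hessian_def) (auto simp: axis_nth)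
  qed
  then show ?thesis by (simp add: Finite_Cartesian_Product.vec_eq_iff)
qed

lemma dens_pole:
  fixes k :: "'n::finite"
  assumes p: "p \<ge> 2"
  shows "dens p k J (t *\<^sub>R axis k 1) = ennreal (std_normal_density t) *
    (\<Prod>a\<in>UNIV - {k}. ennreal (std_normal_density (gsum p k J {#a#}))) * ennreal \<bar>det (pole_hessian k (real p * t) (gsum p k J))\<bar>"
proof -
  have "(\<Prod>a\<in>UNIV. ennreal (std_normal_density (crit_map p k J (t *\<^sub>R axis k 1) $ a))) =
    ennreal (std_normal_density t) * (\<Prod>a\<in>UNIV - {k}. ennreal (std_normal_density (gsum p k J {#a#})))"
    by (subst prod.remove[of UNIV k]) (auto simp: crit_map_pole[OF p] std_normal_density_def intro!: prod.cong)
  then show ?thesis by (simp add: dens_def dcrit_map_pole[OF p])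
qed

section \<open>Laws of the grouped sums\<close>

definition normN :: "real \<Rightarrow> real measure" where
  "normN v = density lborel (\<lambda>x. ennreal (normal_density 0 (sqrt v) x))"

lemma sets_normN [simp, measurable_cong]: "sets (normN v) = sets borel"
  by (simp add: normN_def)

lemma space_normN [simp]: "space (normN v) = UNIV"
  by (simp add: normN_def)

lemma prob_space_normN: "v > 0 \<Longrightarrow> prob_space (normN v)"
  unfolding normN_def by (rule prob_space_normal_density) simp

text \<open>Sums over disjoint groups of independent couplings are independent, and the variance of
  each is the size of its group; the factor \<open>c\<close> enters squared.\<close>

lemma distr_group_sums:
  fixes g :: "'i \<Rightarrow> 'k" and c :: "'k \<Rightarrow> real"
  assumes I: "finite I" and K: "finite K" "\<And>\<kappa>. \<kappa> \<in> K \<Longrightarrow> {i \<in> I. g i = \<kappa>} \<noteq> {}"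
    and c: "\<And>\<kappa>. \<kappa> \<in> K \<Longrightarrow> c \<kappa> \<noteq> 0"
  shows "distr (PiM I (\<lambda>_. stdN)) (PiM K (\<lambda>_. borel)) (\<lambda>J. \<lambda>\<kappa>\<in>K. c \<kappa> * (\<Sum>i\<in>{i \<in> I. g i = \<kappa>}. J i)) =
    PiM K (\<lambda>\<kappa>. normN ((c \<kappa>)\<^sup>2 * real (card {i \<in> I. g i = \<kappa>})))"
proof -
  let ?M = "PiM I (\<lambda>_::'i. stdN)"
  let ?S = "\<lambda>\<kappa> J. \<Sum>i\<in>{i \<in> I. g i = \<kappa>}. J i :: real"
  let ?Y = "\<lambda>\<kappa> J. c \<kappa> * ?S \<kappa> J"
  interpret M: prob_space ?M by (intro prob_space_PiM prob_space_stdN)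
  have comp: "(\<lambda>J. J i) \<in> borel_measurable ?M" if "i \<in> I" for i
    using measurable_component_singleton[OF that, of "\<lambda>_. stdN"] by (simp cong: measurable_cong_sets)
  have Ym: "?Y \<kappa> \<in> borel_measurable ?M" for \<kappa>
    by (intro borel_measurable_times borel_measurable_const borel_measurable_sum comp) auto
  show ?thesis
  proof (cases "K = {}")
    case True
    \<comment> \<open>Without groups both laws live on a one-point space; this occurs in dimension
      1, where there are no tangential directions. The summand \<open>of_bool\<close> makes all
      variances positive, so that the factors are probability measures.\<close>
    interpret product_sigma_finite "\<lambda>\<kappa>. normN (real (card {i \<in> I. g i = \<kappa>}) + of_bool (card {i \<in> I. g i = \<kappa>} = 0))"
      by (rule product_sigma_finite.intro) (intro prob_space_imp_sigma_finite prob_space_normN, auto)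
    have "distr ?M (PiM {} (\<lambda>_. borel)) (\<lambda>J. \<lambda>\<kappa>\<in>{}. ?Y \<kappa> J) =
      PiM {} (\<lambda>\<kappa>. normN (real (card {i \<in> I. g i = \<kappa>}) + of_bool (card {i \<in> I. g i = \<kappa>} = 0)))"
      by (rule PiM_eqI) (auto simp: PiM_empty emeasure_distr M.emeasure_space_1 restrict_def)
    then show ?thesis unfolding True by (simp add: PiM_empty)
  next
    case False
    then have I0: "I \<noteq> {}" using K by auto
    have di: "distr ?M borel (\<lambda>J. J i) = stdN" if "i \<in> I" for i
      using distr_PiM_component[of I "\<lambda>_. stdN" i] that prob_space_stdN
      by (simp cong: distr_cong)
    have ind: "M.indep_vars (\<lambda>_. borel) (\<lambda>i J. J i) I"
    proof (subst M.indep_vars_iff_distr_eq_PiM'[OF I0])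
      show "(\<lambda>J. J i) \<in> borel_measurable ?M" if "i \<in> I" for i by (rule comp[OF that])
      have "distr ?M (PiM I (\<lambda>i. borel)) (\<lambda>x. \<lambda>i\<in>I. x i) = distr ?M ?M (\<lambda>x. x)"
        by (rule distr_cong) (auto simp: space_PiM PiE_iff extensional_restrict intro!: sets_PiM_cong)
      also have "\<dots> = ?M" by simp
      also have "?M = PiM I (\<lambda>i. distr ?M borel (\<lambda>x. x i))"
        using di by (intro PiM_cong) auto
      finally show "distr ?M (PiM I (\<lambda>i. borel)) (\<lambda>x. \<lambda>i\<in>I. x i) = PiM I (\<lambda>i. distr ?M borel (\<lambda>x. x i))" .
    qed
    have dd: "distributed ?M lborel (\<lambda>J. J i) (normal_density 0 1)" if "i \<in> I" for i
    proof -
      have "distr ?M lborel (\<lambda>J. J i) = distr ?M borel (\<lambda>J. J i)" by (rule distr_cong) auto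
      then show ?thesis using comp[OF that] di[OF that] unfolding distributed_def by (simp add: stdN_def)
    qed
    have Yd: "distr ?M borel (?Y \<kappa>) = normN ((c \<kappa>)\<^sup>2 * real (card {i \<in> I. g i = \<kappa>}))" if "\<kappa> \<in> K" for \<kappa>
    proof -
      have "distributed ?M lborel (\<lambda>x. \<Sum>i\<in>{i \<in> I. g i = \<kappa>}. x i)
          (normal_density (\<Sum>i\<in>{i \<in> I. g i = \<kappa>}. 0) (sqrt (\<Sum>i\<in>{i \<in> I. g i = \<kappa>}. 1\<^sup>2)))"
        using I K(2)[OF that] dd by (intro M.sum_indep_normal M.indep_vars_subset[OF ind]) auto
      then have "distributed ?M lborel (?S \<kappa>) (normal_density 0 (sqrt (real (card {i \<in> I. g i = \<kappa>}))))"
        by simp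
      from M.normal_density_affine[OF this, of "c \<kappa>" 0]
      have "distributed ?M lborel (?Y \<kappa>) (normal_density 0 (sqrt ((c \<kappa>)\<^sup>2 * real (card {i \<in> I. g i = \<kappa>}))))"
        using c[OF that] I K(2)[OF that] by (simp add: real_sqrt_mult card_gt_0_iff)
      moreover have "distr ?M lborel (?Y \<kappa>) = distr ?M borel (?Y \<kappa>)" by (rule distr_cong) auto
      ultimately show ?thesis by (simp add: distributed_def normN_def)
    qed
    have "M.indep_vars (\<lambda>\<kappa>. PiM {i \<in> I. g i = \<kappa>} (\<lambda>_. borel)) (\<lambda>\<kappa> J. restrict (\<lambda>i. J i) {i \<in> I. g i = \<kappa>}) K"
      by (rule M.indep_vars_restrict[OF ind]) (auto simp: disjoint_family_on_def)
    from M.indep_vars_compose2[OF this, of "\<lambda>\<kappa> x. c \<kappa> * (\<Sum>i\<in>{i \<in> I. g i = \<kappa>}. x i)" "\<lambda>_. borel"]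
    have "M.indep_vars (\<lambda>_. borel) (\<lambda>\<kappa> J. c \<kappa> * (\<Sum>i\<in>{i \<in> I. g i = \<kappa>}. restrict (\<lambda>i. J i) {i \<in> I. g i = \<kappa>} i)) K"
      by (simp add: borel_measurable_sum measurable_component_singleton)
    then have "M.indep_vars (\<lambda>_. borel) ?Y K" by simp
    then have "distr ?M (PiM K (\<lambda>_. borel)) (\<lambda>J. \<lambda>\<kappa>\<in>K. ?Y \<kappa> J) = PiM K (\<lambda>\<kappa>. distr ?M borel (?Y \<kappa>))"
      using M.indep_vars_iff_distr_eq_PiM'[OF False, where X = ?Y and M' = "\<lambda>_. borel"] Ym by blast
    also have "\<dots> = PiM K (\<lambda>\<kappa>. normN ((c \<kappa>)\<^sup>2 * real (card {i \<in> I. g i = \<kappa>})))"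
      using Yd by (intro PiM_cong) auto
    finally show ?thesis .
  qed
qed

section \<open>Dependence of the density on p\<close>

text \<open>Counts all index lists of a key, which has a simple recursion over the first index;
  \<open>gcard\<close> below leaves out, for nonempty keys, the lists whose couplings are solved
  for.\<close>

definition kcount :: "nat \<Rightarrow> 'n::finite \<Rightarrow> 'n multiset \<Rightarrow> real" where
  "kcount p k \<kappa> = (\<Sum>i | length i = p. of_bool (key k i = \<kappa>))"

lemma kcount_0 [simp]: "kcount 0 k \<kappa> = of_bool (\<kappa> = {#})"
  by (auto simp: kcount_def)

lemma kcount_Suc:
  "kcount (Suc p) k \<kappa> = kcount p k \<kappa> + (\<Sum>x\<in>UNIV - {k}. \<Sum>j | length j = p. of_bool (add_mset x (key k j) = \<kappa>))"
  unfolding kcount_def sum_lists_Suc by (subst sum.remove[of UNIV k]) auto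

lemma kcount_empty: "kcount p k {#} = 1"
  by (induction p) (auto simp: kcount_Suc)

lemma kcount_single: "a \<noteq> k \<Longrightarrow> kcount p k {#a#} = real p"
proof (induction p)
  case (Suc p)
  have "(\<Sum>x\<in>UNIV - {k}. \<Sum>j | length j = p. of_bool (add_mset x (key k j) = {#a#}) :: real) =
    (\<Sum>x\<in>UNIV - {k}. if x = a then kcount p k {#} else 0)"
    by (intro sum.cong refl) (auto simp: kcount_def)
  also have "\<dots> = 1" using Suc.prems by (simp add: kcount_empty)
  finally show ?case using Suc by (simp add: kcount_Suc)
qed simp

text \<open>The two tangential indices can be placed in p(p-1) ways, half as many when they are
  equal.\<close>

lemma kcount_pair:
  assumes "a \<noteq> k" "b \<noteq> k"
  shows "kcount p k {#a, b#} = real p * (real p - 1) / (1 + of_bool (a = b))"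
proof (induction p)
  case (Suc p)
  have "(\<Sum>x\<in>UNIV - {k}. \<Sum>j | length j = p. of_bool (add_mset x (key k j) = {#a, b#}) :: real) =
    (\<Sum>x\<in>UNIV - {k}. (if x = a then kcount p k {#b#} else 0) + (if x = b then of_bool (a \<noteq> b) * kcount p k {#a#} else 0))"
  proof (intro sum.cong refl)
    fix x
    have "(add_mset x \<kappa> = {#a, b#}) \<longleftrightarrow> (x = a \<and> \<kappa> = {#b#}) \<or> (x = b \<and> \<kappa> = {#a#})" for \<kappa>
      by (auto simp: add_eq_conv_ex)
    then show "(\<Sum>j | length j = p. of_bool (add_mset x (key k j) = {#a, b#}) :: real) =
      (if x = a then kcount p k {#b#} else 0) + (if x = b then of_bool (a \<noteq> b) * kcount p k {#a#} else 0)"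
      by (cases "x = a"; cases "x = b") (auto simp: kcount_def)
  qed
  also have "\<dots> = real p + of_bool (a \<noteq> b) * real p"
    using assms by (simp add: sum.distrib kcount_single)
  finally show ?case using Suc by (auto simp: kcount_Suc field_simps)
qed simp

definition gcard :: "nat \<Rightarrow> 'n::finite \<Rightarrow> 'n multiset \<Rightarrow> nat" where
  "gcard p k \<kappa> = card {i \<in> {i. length i = p}. (if tl i = replicate (p - 1) k then {#} else key k i) = \<kappa>}"

lemma gcard_kcount:
  assumes "\<kappa> \<noteq> {#}"
  shows "real (gcard p k \<kappa>) = kcount p k \<kappa> - (\<Sum>i | length i = p. of_bool (tl i = replicate (p - 1) k \<and> key k i = \<kappa>))"
proof -
  have "real (gcard p k \<kappa>) = (\<Sum>i | length i = p. of_bool ((if tl i = replicate (p - 1) k then {#} else key k i) = \<kappa>))"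
    unfolding gcard_def by (simp add: Int_def del: Collect_conj_eq)
  also have "\<dots> = (\<Sum>i | length i = p. of_bool (key k i = \<kappa>) - of_bool (tl i = replicate (p - 1) k \<and> key k i = \<kappa>))"
    using assms by (intro sum.cong) auto
  finally show ?thesis by (simp add: sum_subtractf kcount_def)
qed

lemma key_tl_replicate: "tl i = replicate m k \<Longrightarrow> key k i = (if i = [] \<or> hd i = k then {#} else {#hd i#})"
  by (cases i) (auto simp: key_def)

text \<open>Of the \<open>p\<close> positions for the index \<open>a\<close>, the first belongs to
  the solved coupling \<open>J(a, k, \<dots>, k)\<close>.\<close>

lemma gcard_single:
  assumes "a \<noteq> k" "p \<ge> 1"
  shows "real (gcard p k {#a#}) = real p - 1"
proof -
  have "(\<Sum>i | length i = p. of_bool (tl i = replicate (p - 1) k \<and> key k i = {#a#}) :: real) =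
    (\<Sum>i\<in>{a # replicate (p - 1) k}. 1)"
  proof (rule sum.mono_neutral_cong_right)
    show "\<forall>i\<in>{i. length i = p} - {a # replicate (p - 1) k}. of_bool (tl i = replicate (p - 1) k \<and> key k i = {#a#}) = (0::real)"
    proof
      fix i assume i: "i \<in> {i. length i = p} - {a # replicate (p - 1) k}"
      then show "of_bool (tl i = replicate (p - 1) k \<and> key k i = {#a#}) = (0::real)"
        using assms by (cases i) (auto simp: key_def)
    qed
  qed (use assms in \<open>auto simp: key_def\<close>)
  then show ?thesis using assms by (simp add: gcard_kcount kcount_single)
qed

lemma gcard_pair:
  assumes "a \<noteq> k" "b \<noteq> k"
  shows "real (gcard p k {#a, b#}) = real p * (real p - 1) / (1 + of_bool (a = b))"
proof -
  have "(\<Sum>i | length i = p. of_bool (tl i = replicate (p - 1) k \<and> key k i = {#a, b#}) :: real) = 0"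
    by (intro sum.neutral) (auto simp: key_tl_replicate)
  then show ?thesis using assms by (simp add: gcard_kcount kcount_pair)
qed

text \<open>The keys on which the tangential gradient depends; \<open>K2\<close> holds those of the
  tangential Hessian. Their disjointness makes gradient and Hessian at the pole independent.\<close>

definition K1 :: "'n::finite \<Rightarrow> 'n multiset set" where
  "K1 k = (\<lambda>a. {#a#}) ` (UNIV - {k})"

definition K2 :: "'n::finite \<Rightarrow> 'n multiset set" where
  "K2 k = (\<lambda>(a, b). {#a, b#}) ` ((UNIV - {k}) \<times> (UNIV - {k}))"

lemma finite_K [simp]: "finite (K1 k)" "finite (K2 k)"
  by (simp_all add: K1_def K2_def)

lemma K_disjoint: "K1 k \<inter> K2 k = {}"
  by (auto simp: K1_def K2_def)

lemma gcard_pos: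
  assumes p: "p \<ge> 2" and \<kappa>: "\<kappa> \<in> K1 k \<union> K2 k"
  shows "gcard p k \<kappa> > 0"
proof -
  have "real p * (real p - 1) > 0" using p by simp
  then have "real (gcard p k \<kappa>) > 0"
  proof -
    from \<kappa> consider a where "a \<noteq> k" "\<kappa> = {#a#}" | a b where "a \<noteq> k" "b \<noteq> k" "\<kappa> = {#a, b#}"
      unfolding K1_def K2_def by auto
    then show ?thesis
    proof cases
      case 1
      then show ?thesis using p gcard_single[of a k p] by simp
    next
      case 2
      then show ?thesis using \<open>real p * (real p - 1) > 0\<close> gcard_pair[of a k b p] by simp
    qed
  qed
  then show ?thesis by simp
qed

text \<open>The value \<open>normN 1\<close> on empty groups is junk: it makes all factors probability measures.\<close>
definition grpN :: "nat \<Rightarrow> 'n::finite \<Rightarrow> 'n multiset \<Rightarrow> real measure" where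
  "grpN p k \<kappa> = (if gcard p k \<kappa> > 0 then normN (real (gcard p k \<kappa>)) else normN 1)"

lemma prob_space_grpN: "prob_space (grpN p k \<kappa>)"
  by (simp add: grpN_def prob_space_normN)

lemma sets_grpN [simp, measurable_cong]: "sets (grpN p k \<kappa>) = sets borel"
  by (simp add: grpN_def)

lemma distr_gsum:
  assumes p: "p \<ge> 2"
  shows "distr (gam p) (PiM (K1 k \<union> K2 k) (\<lambda>_. borel)) (\<lambda>J. \<lambda>\<kappa>\<in>K1 k \<union> K2 k. gsum p k J \<kappa>) = PiM (K1 k \<union> K2 k) (grpN p k)"
proof -
  let ?g = "\<lambda>i. if tl i = replicate (p - 1) k then {#} else key k i"
  have "distr (PiM {i. length i = p} (\<lambda>_. stdN)) (PiM (K1 k \<union> K2 k) (\<lambda>_. borel)) (\<lambda>J. \<lambda>\<kappa>\<in>K1 k \<union> K2 k. 1 * (\<Sum>i\<in>{i \<in> {i. length i = p}. ?g i = \<kappa>}. J i)) =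
    PiM (K1 k \<union> K2 k) (\<lambda>\<kappa>. normN (1\<^sup>2 * real (card {i \<in> {i. length i = p}. ?g i = \<kappa>})))"
  proof (rule distr_group_sums)
    show "{i \<in> {i. length i = p}. ?g i = \<kappa>} \<noteq> {}" if "\<kappa> \<in> K1 k \<union> K2 k" for \<kappa>
      using gcard_pos[OF p that] unfolding gcard_def by (metis card.empty less_irrefl)
  qed auto
  also have "\<dots> = PiM (K1 k \<union> K2 k) (grpN p k)"
  proof (rule PiM_cong[OF refl])
    fix \<kappa> assume "\<kappa> \<in> K1 k \<union> K2 k"
    from gcard_pos[OF p this] show "normN (1\<^sup>2 * real (card {i \<in> {i. length i = p}. ?g i = \<kappa>})) = grpN p k \<kappa>"
      unfolding grpN_def gcard_def[symmetric] by simp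
  qed
  finally show ?thesis by (simp add: gam_def gsum_def)
qed

text \<open>This is the density at 0 of a sum of independent centred Gaussians of variances
  \<open>v\<close> and 1. For \<open>v = p - 1\<close> it is the density at 0 of a tangential
  derivative, whose variance is \<open>p\<close>.\<close>

lemma nn_integral_std_normN:
  assumes v: "v > 0"
  shows "(\<integral>\<^sup>+x. ennreal (std_normal_density x) \<partial>normN v) = ennreal (1 / sqrt (2 * pi * (v + 1)))"
proof -
  \<comment> \<open>Up to a constant the product of the two densities is the centred density of
    variance \<open>w\<close>, where \<open>1 / w = 1 / v + 1\<close>.\<close>
  define w where "w = v / (v + 1)"
  have w: "w > 0" using v by (simp add: w_def)
  interpret D: prob_space "density lborel (normal_density 0 (sqrt w))" by (rule prob_space_normal_density) (use w in simp)
  have "(\<integral>\<^sup>+x. ennreal (std_normal_density x) \<partial>normN v) =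
    (\<integral>\<^sup>+x. ennreal (normal_density 0 (sqrt v) x) * ennreal (std_normal_density x) \<partial>lborel)"
    unfolding normN_def by (rule nn_integral_density) auto
  also have "\<dots> = (\<integral>\<^sup>+x. ennreal (1 / sqrt (2 * pi * (v + 1))) * ennreal (normal_density 0 (sqrt w) x) \<partial>lborel)"
  proof (rule nn_integral_cong)
    fix x :: real
    have e: "- x\<^sup>2 / (2 * v) + - x\<^sup>2 / 2 = - x\<^sup>2 / (2 * w)" using v by (simp add: w_def field_simps)
    have s: "1 / sqrt (2 * pi * v) * (1 / sqrt (2 * pi)) = 1 / sqrt (2 * pi * (v + 1)) * (1 / sqrt (2 * pi * w))"
      using v by (simp add: w_def real_sqrt_mult[symmetric] real_sqrt_divide[symmetric] divide_simps)
    have "normal_density 0 (sqrt v) x * std_normal_density x =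
      (1 / sqrt (2 * pi * v) * (1 / sqrt (2 * pi))) * exp (- x\<^sup>2 / (2 * v) + - x\<^sup>2 / 2)"
      unfolding exp_add using v by (simp add: normal_density_def std_normal_density_def)
    also have "\<dots> = 1 / sqrt (2 * pi * (v + 1)) * normal_density 0 (sqrt w) x"
      unfolding s e using w by (simp add: normal_density_def)
    finally show "ennreal (normal_density 0 (sqrt v) x) * ennreal (std_normal_density x) =
      ennreal (1 / sqrt (2 * pi * (v + 1))) * ennreal (normal_density 0 (sqrt w) x)"
      using v by (simp add: ennreal_mult[symmetric])
  qed
  also have "\<dots> = ennreal (1 / sqrt (2 * pi * (v + 1))) * (\<integral>\<^sup>+x. ennreal (normal_density 0 (sqrt w) x) \<partial>lborel)"
    by (rule nn_integral_cmult) auto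
  also have "(\<integral>\<^sup>+x. ennreal (normal_density 0 (sqrt w) x) \<partial>lborel) = 1"
    using D.emeasure_space_1 by (simp add: emeasure_density)
  finally show ?thesis by simp
qed

definition detmean :: "nat \<Rightarrow> 'n::finite \<Rightarrow> real \<Rightarrow> ennreal" where
  "detmean p k s = (\<integral>\<^sup>+Y. ennreal \<bar>det (pole_hessian k s Y)\<bar> \<partial>PiM (K2 k) (grpN p k))"

lemma pole_hessian_cong: "(\<And>\<kappa>. \<kappa> \<in> K2 k \<Longrightarrow> Y \<kappa> = Y' \<kappa>) \<Longrightarrow> pole_hessian k s Y = pole_hessian k s Y'"
  by (auto simp: pole_hessian_def Finite_Cartesian_Product.vec_eq_iff K2_def)

lemma measurable_pole_hessian:
  fixes k :: "'n::finite"
  assumes "\<And>\<kappa>. \<kappa> \<in> K2 k \<Longrightarrow> (\<lambda>w. Y w \<kappa>) \<in> borel_measurable M"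
  shows "(\<lambda>w. det (pole_hessian k s (Y w))) \<in> borel_measurable M"
proof (rule measurable_det)
  fix a b
  show "(\<lambda>w. pole_hessian k s (Y w) $ a $ b) \<in> borel_measurable M"
  proof (cases "a = k \<or> b = k")
    case False
    then have "{#a, b#} \<in> K2 k" by (auto simp: K2_def)
    from assms[OF this] False show ?thesis unfolding pole_hessian_def by simp
  qed (auto simp: pole_hessian_def)
qed

text \<open>By independence the \<open>CARD('n) - 1\<close> tangential derivatives contribute their
  density at 0 each, the energy its own density, and the Hessian its mean absolute determinant with
  multiplier \<open>p t\<close>.\<close>

lemma kdens_eq:
  fixes k :: "'n::finite"
  assumes p: "p \<ge> 2"
  shows "kdens p k t = ennreal (std_normal_density t * (1 / sqrt (2 * pi * real p)) ^ (CARD('n) - 1)) * detmean p k (real p * t)"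
proof -
  let ?K = "K1 k \<union> K2 k"
  interpret product_sigma_finite "grpN p k"
    by (rule product_sigma_finite.intro) (rule prob_space_imp_sigma_finite, rule prob_space_grpN)
  define \<Phi>1 where "\<Phi>1 = (\<lambda>Y :: 'n multiset \<Rightarrow> real. \<Prod>\<kappa>\<in>K1 k. ennreal (std_normal_density (Y \<kappa>)))"
  define \<Phi>2 where "\<Phi>2 = (\<lambda>Y. ennreal \<bar>det (pole_hessian k (real p * t) Y)\<bar>)"
  have injK: "inj_on (\<lambda>a. {#a#}) (UNIV - {k})" by (simp add: inj_on_def)
  have d: "dens p k J (t *\<^sub>R axis k 1) = ennreal (std_normal_density t) * (\<Phi>1 (\<lambda>\<kappa>\<in>?K. gsum p k J \<kappa>) * \<Phi>2 (\<lambda>\<kappa>\<in>?K. gsum p k J \<kappa>))" for J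
  proof -
    have "(\<Prod>a\<in>UNIV - {k}. ennreal (std_normal_density (gsum p k J {#a#}))) = \<Phi>1 (\<lambda>\<kappa>\<in>?K. gsum p k J \<kappa>)"
      unfolding \<Phi>1_def by (subst K1_def, subst prod.reindex[OF injK]) (auto simp: K1_def intro!: prod.cong)
    moreover have "pole_hessian k (real p * t) (gsum p k J) = pole_hessian k (real p * t) (\<lambda>\<kappa>\<in>?K. gsum p k J \<kappa>)"
      by (rule pole_hessian_cong) auto
    ultimately show ?thesis by (simp add: dens_pole[OF p] \<Phi>2_def mult.assoc)
  qed
  have \<Phi>1m: "\<Phi>1 \<in> borel_measurable (PiM I (\<lambda>_. borel))" if "K1 k \<subseteq> I" for I
    unfolding \<Phi>1_def using that by (intro borel_measurable_prod_ennreal) (auto intro!: measurable_compose[OF measurable_component_singleton])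
  have \<Phi>2m: "\<Phi>2 \<in> borel_measurable (PiM I (\<lambda>_. borel))" if "K2 k \<subseteq> I" for I
  proof -
    have "(\<lambda>w. det (pole_hessian k (real p * t) w)) \<in> borel_measurable (PiM I (\<lambda>_. borel))"
      using that by (intro measurable_pole_hessian) (auto intro: measurable_component_singleton)
    then show ?thesis unfolding \<Phi>2_def by measurable
  qed
  have s: "sets (PiM I (grpN p k)) = sets (PiM I (\<lambda>_. borel))" for I by (intro sets_PiM_cong) auto
  have \<Phi>m: "(\<lambda>Y. \<Phi>1 Y * \<Phi>2 Y) \<in> borel_measurable (PiM ?K (\<lambda>_. borel))"
    using \<Phi>1m[of ?K] \<Phi>2m[of ?K] by (intro borel_measurable_times_ennreal) auto
  have Tm: "(\<lambda>J. \<lambda>\<kappa>\<in>?K. gsum p k J \<kappa>) \<in> gam p \<rightarrow>\<^sub>M PiM ?K (\<lambda>_. borel)"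
    unfolding gsum_def by (intro measurable_restrict borel_measurable_sum) auto
  have "kdens p k t = ennreal (std_normal_density t) * (\<integral>\<^sup>+J. \<Phi>1 (\<lambda>\<kappa>\<in>?K. gsum p k J \<kappa>) * \<Phi>2 (\<lambda>\<kappa>\<in>?K. gsum p k J \<kappa>) \<partial>gam p)"
    unfolding kdens_def d by (rule nn_integral_cmult) (rule measurable_compose[OF Tm \<Phi>m])
  also have "(\<integral>\<^sup>+J. \<Phi>1 (\<lambda>\<kappa>\<in>?K. gsum p k J \<kappa>) * \<Phi>2 (\<lambda>\<kappa>\<in>?K. gsum p k J \<kappa>) \<partial>gam p) = (\<integral>\<^sup>+Y. \<Phi>1 Y * \<Phi>2 Y \<partial>PiM ?K (grpN p k))"
    unfolding distr_gsum[OF p, of k, symmetric] by (rule nn_integral_distr[OF Tm, symmetric]) (use \<Phi>m in simp)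
  also have "\<dots> = (\<integral>\<^sup>+x. \<integral>\<^sup>+y. \<Phi>1 (merge (K1 k) (K2 k) (x, y)) * \<Phi>2 (merge (K1 k) (K2 k) (x, y)) \<partial>PiM (K2 k) (grpN p k) \<partial>PiM (K1 k) (grpN p k))"
    by (rule product_nn_integral_fold[OF K_disjoint finite_K]) (use \<Phi>m in \<open>simp add: measurable_cong_sets[OF s refl]\<close>)
  also have "\<dots> = (\<integral>\<^sup>+x. \<integral>\<^sup>+y. \<Phi>1 x * \<Phi>2 y \<partial>PiM (K2 k) (grpN p k) \<partial>PiM (K1 k) (grpN p k))"
  proof (intro nn_integral_cong arg_cong2[where f = "(*)"])
    fix x y
    show "\<Phi>1 (merge (K1 k) (K2 k) (x, y)) = \<Phi>1 x" unfolding \<Phi>1_def by (intro prod.cong) (auto simp: merge_def)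
    have "pole_hessian k (real p * t) (merge (K1 k) (K2 k) (x, y)) = pole_hessian k (real p * t) y"
      using K_disjoint[of k] by (intro pole_hessian_cong) (auto simp: merge_def)
    then show "\<Phi>2 (merge (K1 k) (K2 k) (x, y)) = \<Phi>2 y" by (simp add: \<Phi>2_def)
  qed
  also have "\<dots> = (\<integral>\<^sup>+x. \<Phi>1 x * detmean p k (real p * t) \<partial>PiM (K1 k) (grpN p k))"
    using \<Phi>2m[of "K2 k"] by (simp add: nn_integral_cmult measurable_cong_sets[OF s refl] detmean_def \<Phi>2_def[abs_def])
  also have "\<dots> = (\<integral>\<^sup>+x. \<Phi>1 x \<partial>PiM (K1 k) (grpN p k)) * detmean p k (real p * t)"
    using \<Phi>1m[of "K1 k"] by (simp add: nn_integral_multc measurable_cong_sets[OF s refl])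
  also have "(\<integral>\<^sup>+x. \<Phi>1 x \<partial>PiM (K1 k) (grpN p k)) = (\<Prod>\<kappa>\<in>K1 k. \<integral>\<^sup>+x. ennreal (std_normal_density x) \<partial>grpN p k \<kappa>)"
    unfolding \<Phi>1_def by (rule product_nn_integral_prod) auto
  also have "\<dots> = (\<Prod>\<kappa>\<in>K1 k. ennreal (1 / sqrt (2 * pi * real p)))"
  proof (rule prod.cong[OF refl])
    fix \<kappa> assume \<kappa>: "\<kappa> \<in> K1 k"
    then obtain a where a: "a \<noteq> k" "\<kappa> = {#a#}" by (auto simp: K1_def)
    have c: "real (gcard p k \<kappa>) = real p - 1" using a p by (simp add: gcard_single)
    have "gcard p k \<kappa> > 0" using gcard_pos[OF p] \<kappa> by auto
    then have "grpN p k \<kappa> = normN (real p - 1)" by (simp add: grpN_def c)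
    then show "(\<integral>\<^sup>+x. ennreal (std_normal_density x) \<partial>grpN p k \<kappa>) = ennreal (1 / sqrt (2 * pi * real p))"
      using nn_integral_std_normN[of "real p - 1"] p by simp
  qed
  also have "\<dots> = ennreal ((1 / sqrt (2 * pi * real p)) ^ (CARD('n) - 1))"
    by (simp add: K1_def card_image[OF injK] ennreal_power)
  finally show ?thesis by (simp add: ennreal_mult mult.assoc)
qed

lemma normN_scale:
  assumes "c > 0" "v > 0"
  shows "distr (normN v) borel (\<lambda>x. sqrt c * x) = normN (c * v)"
proof -
  interpret prob_space "normN v" using assms by (intro prob_space_normN)
  have "distr (normN v) lborel (\<lambda>x. x) = normN v"
    by (rule distr_id2) simp
  then have "distributed (normN v) lborel (\<lambda>x. x) (normal_density 0 (sqrt v))"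
    unfolding distributed_def by (simp add: normN_def[symmetric])
  from normal_density_affine[OF this, of "sqrt c" 0] assms
  have "distributed (normN v) lborel (\<lambda>x. sqrt c * x) (normal_density 0 (sqrt (c * v)))"
    by (simp add: real_sqrt_mult)
  moreover have "distr (normN v) lborel (\<lambda>x. sqrt c * x) = distr (normN v) borel (\<lambda>x. sqrt c * x)"
    by (rule distr_cong) auto
  ultimately show ?thesis by (simp add: distributed_def normN_def)
qed

text \<open>The group of \<open>{#a, b#}\<close> is \<open>c\<close> times as large for
  \<open>p\<close> as for 2, so in law the Hessian entries are those for 2 multiplied by sqrt c.
  Scaling the multiplier alike pulls sqrt c out of each of the \<open>CARD('n) - 1\<close>
  tangential rows.\<close>

lemma detmean_scale:
  fixes k :: "'n::finite"
  assumes p: "p \<ge> 2"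
  defines "c \<equiv> real p * (real p - 1) / 2"
  shows "detmean p k (sqrt c * s) = ennreal (sqrt c ^ (CARD('n) - 1)) * detmean 2 k s"
proof -
  have c: "c > 0" using p by (simp add: c_def)
  have s: "sets (PiM I (grpN p k)) = sets (PiM I (\<lambda>_. borel))" for I p by (intro sets_PiM_cong) auto
  have g: "grpN p k \<kappa> = distr (grpN 2 k \<kappa>) borel (\<lambda>x. sqrt c * x)" if \<kappa>: "\<kappa> \<in> K2 k" for \<kappa>
  proof -
    have pos: "gcard p k \<kappa> > 0" "gcard 2 k \<kappa> > 0" using gcard_pos[OF p] gcard_pos[of 2] \<kappa> by auto
    have "real (gcard p k \<kappa>) = c * real (gcard 2 k \<kappa>)"
    proof -
      from \<kappa> obtain a b where "a \<noteq> k" "b \<noteq> k" "\<kappa> = {#a, b#}" unfolding K2_def by auto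
      then show ?thesis using gcard_pair[of a k b p] gcard_pair[of a k b 2] by (simp add: c_def)
    qed
    then show ?thesis using pos c by (simp add: grpN_def normN_scale)
  qed
  have "PiM (K2 k) (grpN p k) = PiM (K2 k) (\<lambda>\<kappa>. distr (grpN 2 k \<kappa>) borel (\<lambda>x. sqrt c * x))"
    using g by (intro PiM_cong) auto
  also have "\<dots> = distr (PiM (K2 k) (grpN 2 k)) (PiM (K2 k) (\<lambda>_. borel)) (compose (K2 k) (\<lambda>x. sqrt c * x))"
  proof -
    have "distr (PiM (K2 k) (grpN 2 k)) (PiM (K2 k) (grpN 2 k)) (compose (K2 k) (\<lambda>x. sqrt c * x)) =
      PiM (K2 k) (\<lambda>\<kappa>. distr (grpN 2 k \<kappa>) (grpN 2 k \<kappa>) (\<lambda>x. sqrt c * x))"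
      by (rule distr_PiM_finite_prob_space') (auto simp: prob_space_grpN)
    moreover have "distr (PiM (K2 k) (grpN 2 k)) (PiM (K2 k) (grpN 2 k)) (compose (K2 k) (\<lambda>x. sqrt c * x)) =
      distr (PiM (K2 k) (grpN 2 k)) (PiM (K2 k) (\<lambda>_. borel)) (compose (K2 k) (\<lambda>x. sqrt c * x))"
      by (rule distr_cong[OF refl s refl])
    moreover have "distr (grpN 2 k \<kappa>) (grpN 2 k \<kappa>) (\<lambda>x. sqrt c * x) = distr (grpN 2 k \<kappa>) borel (\<lambda>x. sqrt c * x)" for \<kappa>
      by (rule distr_cong) auto
    ultimately show ?thesis by simp
  qed
  finally have P: "PiM (K2 k) (grpN p k) = distr (PiM (K2 k) (grpN 2 k)) (PiM (K2 k) (\<lambda>_. borel)) (compose (K2 k) (\<lambda>x. sqrt c * x))" .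
  have dm: "(\<lambda>w. det (pole_hessian k s w)) \<in> borel_measurable (PiM (K2 k) (\<lambda>_. borel))" for s
    by (intro measurable_pole_hessian measurable_component_singleton)
  have cm: "compose (K2 k) (\<lambda>x. sqrt c * x) \<in> PiM (K2 k) (grpN 2 k) \<rightarrow>\<^sub>M PiM (K2 k) (\<lambda>_. borel)"
    unfolding compose_def
    by (intro measurable_restrict borel_measurable_times borel_measurable_const)
      (auto intro!: measurable_component_singleton simp: measurable_cong_sets[OF s refl])
  have D: "det (pole_hessian k (sqrt c * s) (compose (K2 k) (\<lambda>x. sqrt c * x) Y)) = sqrt c ^ (CARD('n) - 1) * det (pole_hessian k s Y)" for Y
  proof -
    define r where "r = (\<lambda>a::'n. if a = k then 1 else sqrt c)"
    have "pole_hessian k (sqrt c * s) (compose (K2 k) (\<lambda>x. sqrt c * x) Y) = (\<chi> a. r a *s (pole_hessian k s Y $ a))"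
      by (auto simp: Finite_Cartesian_Product.vec_eq_iff pole_hessian_def r_def compose_def K2_def algebra_simps)
    then have "det (pole_hessian k (sqrt c * s) (compose (K2 k) (\<lambda>x. sqrt c * x) Y)) = prod r UNIV * det (\<chi> a. pole_hessian k s Y $ a)"
      using Determinants.det_rows_mul[of r "\<lambda>a. pole_hessian k s Y $ a"] by simp
    moreover have "prod r UNIV = sqrt c ^ (CARD('n) - 1)"
      by (subst prod.remove[of UNIV k]) (auto simp: r_def)
    ultimately show ?thesis by simp
  qed
  have "detmean p k (sqrt c * s) = (\<integral>\<^sup>+Y. ennreal \<bar>det (pole_hessian k (sqrt c * s) (compose (K2 k) (\<lambda>x. sqrt c * x) Y))\<bar> \<partial>PiM (K2 k) (grpN 2 k))"
    unfolding detmean_def P by (rule nn_integral_distr[OF cm]) (use dm in simp)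
  also have "\<dots> = (\<integral>\<^sup>+Y. ennreal (sqrt c ^ (CARD('n) - 1)) * ennreal \<bar>det (pole_hessian k s Y)\<bar> \<partial>PiM (K2 k) (grpN 2 k))"
    unfolding D using c by (simp add: abs_mult ennreal_mult)
  also have "\<dots> = ennreal (sqrt c ^ (CARD('n) - 1)) * detmean 2 k s"
    unfolding detmean_def by (rule nn_integral_cmult) (use dm in \<open>simp add: measurable_cong_sets[OF s refl]\<close>)
  finally show ?thesis .
qed

text \<open>\<open>s\<close> makes \<open>p t\<close> equal to sqrt c times \<open>2 (s t)\<close>,
  the multiplier for 2 at energy \<open>s t\<close>, where c = p(p-1)/2. The exponential is the
  quotient of the Gaussian densities of \<open>t\<close> and \<open>s t\<close>. Each tangential
  direction brings the quotient of sqrt c / sqrt p and 1 / sqrt 2, which is sqrt (p - 1).\<close>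

proposition kdens_scale:
  fixes k :: "'n::finite"
  assumes p: "p \<ge> 2"
  defines "s \<equiv> sqrt (real p / (2 * (real p - 1)))"
  shows "kdens p k t = ennreal (sqrt (real p - 1) ^ (CARD('n) - 1) * exp ((s\<^sup>2 - 1) * t\<^sup>2 / 2)) * kdens 2 k (s * t)"
proof -
  define c where "c = real p * (real p - 1) / 2"
  define m where "m = CARD('n) - 1"
  have p1: "real p - 1 > 0" using p by simp
  have cs: "sqrt c * (2 * s) = real p"
  proof -
    have "sqrt c * s = sqrt ((real p / 2)\<^sup>2)"
    proof -
      have "real p * (real p - 1) / 2 * (real p / (2 * (real p - 1))) = (real p / 2)\<^sup>2"
        using p1 by (simp add: power2_eq_square field_simps)
      then show ?thesis unfolding c_def s_def real_sqrt_mult[symmetric] by (rule arg_cong)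
    qed
    then show ?thesis by simp
  qed
  have "detmean p k (real p * t) = detmean p k (sqrt c * (2 * (s * t)))"
    unfolding cs[symmetric] by (simp only: mult.assoc)
  also have "\<dots> = ennreal (sqrt c ^ m) * detmean 2 k (2 * (s * t))"
    unfolding c_def m_def by (rule detmean_scale[OF p])
  finally have 1: "kdens p k t = ennreal (std_normal_density t * (1 / sqrt (2 * pi * real p)) ^ m) * (ennreal (sqrt c ^ m) * detmean 2 k (2 * (s * t)))"
    unfolding kdens_eq[OF p] m_def by simp
  have 2: "kdens 2 k (s * t) = ennreal (std_normal_density (s * t) * (1 / sqrt (2 * pi * 2)) ^ m) * detmean 2 k (2 * (s * t))"
    using kdens_eq[of 2 k "s * t"] by (simp add: m_def)
  have A: "1 / sqrt (2 * pi * real p) * sqrt c = sqrt (real p - 1) * (1 / sqrt (2 * pi * 2))"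
  proof -
    have "sqrt (1 / (2 * pi * real p)) * sqrt c = sqrt ((real p - 1) / (2 * pi * 2))"
      unfolding real_sqrt_mult[symmetric] c_def using p by simp
    then show ?thesis by (simp add: real_sqrt_divide)
  qed
  have B: "std_normal_density t = exp ((s\<^sup>2 - 1) * t\<^sup>2 / 2) * std_normal_density (s * t)"
  proof -
    have "exp ((s\<^sup>2 - 1) * t\<^sup>2 / 2) * exp (- (s * t)\<^sup>2 / 2) = exp (- t\<^sup>2 / 2)"
      unfolding mult_exp_exp by (simp add: field_simps power_mult_distrib)
    then show ?thesis by (simp add: std_normal_density_def)
  qed
  have "std_normal_density t * (1 / sqrt (2 * pi * real p)) ^ m * sqrt c ^ m =
    (sqrt (real p - 1) ^ m * exp ((s\<^sup>2 - 1) * t\<^sup>2 / 2)) * (std_normal_density (s * t) * (1 / sqrt (2 * pi * 2)) ^ m)"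
  proof -
    have "(1 / sqrt (2 * pi * real p)) ^ m * sqrt c ^ m = sqrt (real p - 1) ^ m * (1 / sqrt (2 * pi * 2)) ^ m"
      unfolding power_mult_distrib[symmetric] A ..
    then show ?thesis unfolding B by (simp add: mult_ac)
  qed
  then have "ennreal (std_normal_density t * (1 / sqrt (2 * pi * real p)) ^ m) * ennreal (sqrt c ^ m) =
    ennreal (sqrt (real p - 1) ^ m * exp ((s\<^sup>2 - 1) * t\<^sup>2 / 2)) *
    ennreal (std_normal_density (s * t) * (1 / sqrt (2 * pi * 2)) ^ m)"
    using p1 by (simp add: ennreal_mult[symmetric] c_def)
  then show ?thesis
    unfolding 1 2 m_def[symmetric] mult.assoc[symmetric] by simp
qed

section \<open>Eigenvectors of symmetric matrices\<close>

definition symm :: "real^'n^'n \<Rightarrow> bool" where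
  "symm A \<longleftrightarrow> (\<forall>i j. A $ i $ j = A $ j $ i)"

lemma symm_inner: "symm A \<Longrightarrow> (A *v x) \<bullet> y = x \<bullet> (A *v y)"
proof -
  assume "symm A"
  then have "Finite_Cartesian_Product.transpose A = A"
    by (simp add: symm_def Finite_Cartesian_Product.transpose_def Finite_Cartesian_Product.vec_eq_iff)
  then show ?thesis by (metis dot_lmul_matrix inner_commute vector_transpose_matrix)
qed

text \<open>Induction on the dimension: a maximiser of the Rayleigh quotient on the unit sphere of
  an invariant subspace is an eigenvector, and its orthogonal complement in the subspace is again
  invariant.\<close>

lemma spectral_subspace:
  fixes A :: "real^'n^'n"
  assumes A: "symm A"
  shows "subspace S \<Longrightarrow> (\<And>x. x \<in> S \<Longrightarrow> A *v x \<in> S) \<Longrightarrow>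
    \<exists>B. B \<subseteq> S \<and> pairwise orthogonal B \<and> (\<forall>u\<in>B. norm u = 1 \<and> (\<exists>l. A *v u = l *\<^sub>R u)) \<and> span B = S"
proof (induction "dim S" arbitrary: S rule: less_induct)
  case less
  show ?case
  proof (cases "S = {0}")
    case True
    then show ?thesis by (intro exI[of _ "{}"]) auto
  next
    case False
    let ?K = "S \<inter> sphere 0 1"
    have "0 \<in> S" using less.prems(1) by (rule subspace_0)
    then obtain x where x: "x \<in> S" "x \<noteq> 0" using False by auto
    have ne: "?K \<noteq> {}"
      using x subspace_scale[OF less.prems(1) x(1), of "1 / norm x"] by (auto intro!: exI[of _ "(1 / norm x) *\<^sub>R x"])
    have "compact ?K" using closed_subspace[OF less.prems(1)] by (intro closed_Int_compact) auto
    moreover have "continuous_on ?K (\<lambda>x. x \<bullet> (A *v x))"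
      by (intro continuous_intros matrix_vector_mult_linear_continuous_on)
    ultimately obtain u where u: "u \<in> ?K" "\<And>x. x \<in> ?K \<Longrightarrow> x \<bullet> (A *v x) \<le> u \<bullet> (A *v u)"
      using continuous_attains_sup[OF _ ne] by blast
    define l where "l = u \<bullet> (A *v u)"
    have uS: "u \<in> S" and un: "norm u = 1" and uu: "u \<bullet> u = 1" using u(1) by (auto simp: dot_square_norm)
    have le: "x \<bullet> (A *v x) \<le> l * (x \<bullet> x)" if "x \<in> S" for x
    proof (cases "x = 0")
      case False
      let ?y = "(1 / norm x) *\<^sub>R x"
      have "?y \<in> ?K" using False subspace_scale[OF less.prems(1) that] by simp
      from u(2)[OF this] have "(x \<bullet> (A *v x)) / (norm x)\<^sup>2 \<le> l"
        by (simp add: matrix_vector_mult_scaleR l_def power2_eq_square)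
      then show ?thesis using False by (simp add: field_simps dot_square_norm)
    qed simp
    \<comment> \<open>\<open>w\<close> is the residual of the eigenvalue equation. Moving from
      \<open>u\<close> by \<open>t\<close> times \<open>w\<close> changes the form at first order by
      \<open>2 t (w \<bullet> w)\<close>, which maximality forbids unless
      \<open>w = 0\<close>.\<close>
    define w where "w = A *v u - l *\<^sub>R u"
    have wS: "w \<in> S" unfolding w_def using less.prems uS by (intro subspace_diff subspace_scale) auto
    have wu: "w \<bullet> u = 0" by (simp add: w_def inner_diff_left uu l_def inner_commute[of "A *v u" u])
    have wA: "w \<bullet> (A *v u) = w \<bullet> w" using wu by (simp add: w_def inner_diff_right)
    have q: "2 * t * (w \<bullet> w) \<le> t\<^sup>2 * (l * (w \<bullet> w) - w \<bullet> (A *v w))" for t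
    proof -
      have "u + t *\<^sub>R w \<in> S" using less.prems(1) uS wS by (intro subspace_add subspace_scale)
      from le[OF this] have "l + 2 * t * (w \<bullet> (A *v u)) + t\<^sup>2 * (w \<bullet> (A *v w)) \<le> l * (1 + t\<^sup>2 * (w \<bullet> w))"
        using symm_inner[OF A, of u w] wu
        by (simp add: matrix_vector_right_distrib matrix_vector_mult_scaleR inner_add_left inner_add_right l_def[symmetric] uu
            inner_commute[of u w] inner_commute[of "A *v u" w] power2_eq_square algebra_simps)
      then show ?thesis by (simp add: wA algebra_simps)
    qed
    have "w \<bullet> w = 0"
    proof (rule ccontr)
      assume "w \<bullet> w \<noteq> 0"
      then have w0: "w \<bullet> w > 0" by (simp add: less_le)
      define c where "c = \<bar>l * (w \<bullet> w) - w \<bullet> (A *v w)\<bar> + 1"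
      have c: "c > 0" "l * (w \<bullet> w) - w \<bullet> (A *v w) \<le> c" by (auto simp: c_def)
      define t where "t = (w \<bullet> w) / c"
      have t: "t > 0" using w0 c by (simp add: t_def)
      have "2 * t * (w \<bullet> w) \<le> t\<^sup>2 * c"
        using q[of t] c(2) by (meson mult_left_mono order_trans zero_le_power2)
      then have "2 * (w \<bullet> w) \<le> t * c" using t by (simp add: power2_eq_square)
      then show False using w0 c by (simp add: t_def)
    qed
    then have Au: "A *v u = l *\<^sub>R u" by (simp add: w_def)
    define S' where "S' = S \<inter> {x. u \<bullet> x = 0}"
    have S': "subspace S'" unfolding S'_def using less.prems(1) by (intro subspace_inter subspace_hyperplane)
    have "u \<notin> S'" by (simp add: S'_def uu)
    then have "S' \<subset> S" using uS unfolding S'_def by blast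
    then have "dim S' < dim S"
      using less.prems(1) S' by (metis dim_subset order_less_le subspace_dim_equal psubset_imp_subset less_irrefl)
    moreover have "A *v x \<in> S'" if "x \<in> S'" for x
      using that less.prems(2) symm_inner[OF A, of u x] by (auto simp: S'_def Au)
    ultimately obtain B where B: "B \<subseteq> S'" "pairwise orthogonal B" "\<forall>u\<in>B. norm u = 1 \<and> (\<exists>l. A *v u = l *\<^sub>R u)" "span B = S'"
      using less.hyps[OF _ S'] by blast
    have "insert u B \<subseteq> S" using B(1) uS by (auto simp: S'_def)
    moreover have "pairwise orthogonal (insert u B)"
      using B(1,2) by (auto simp: pairwise_insert Linear_Algebra.orthogonal_def S'_def inner_commute)
    moreover have "\<forall>v\<in>insert u B. norm v = 1 \<and> (\<exists>l. A *v v = l *\<^sub>R v)"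
      using B(3) un Au by auto
    moreover have "span (insert u B) = S"
    proof
      show "span (insert u B) \<subseteq> S" using \<open>insert u B \<subseteq> S\<close> less.prems(1) by (rule span_minimal)
      show "S \<subseteq> span (insert u B)"
      proof
        fix x assume x: "x \<in> S"
        have "x - (u \<bullet> x) *\<^sub>R u \<in> S'"
          unfolding S'_def using x uS less.prems(1) uu
          by (auto intro!: subspace_diff subspace_scale simp: inner_diff_right)
        then show "x \<in> span (insert u B)"
          unfolding span_insert using B(4) by auto
      qed
    qed
    ultimately show ?thesis by blast
  qed
qed

definition eigbasis :: "real^'n^'n \<Rightarrow> ('n \<Rightarrow> real^'n) \<Rightarrow> ('n \<Rightarrow> real) \<Rightarrow> bool" where
  "eigbasis A u l \<longleftrightarrow> (\<forall>c d. u c \<bullet> u d = of_bool (c = d)) \<and> (\<forall>c. A *v u c = l c *\<^sub>R u c)"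

lemma spectral_theorem:
  fixes A :: "real^'n^'n"
  assumes A: "symm A"
  shows "\<exists>u l. eigbasis A u l"
proof -
  obtain B where B: "pairwise orthogonal B" "\<And>u. u \<in> B \<Longrightarrow> norm u = 1" "\<And>u. u \<in> B \<Longrightarrow> \<exists>l. A *v u = l *\<^sub>R u"
    "span B = (UNIV :: (real^'n) set)"
    using spectral_subspace[OF A, of UNIV] by auto
  have ind: "independent B"
    using B(1) B(2)[of 0] by (intro pairwise_orthogonal_independent) auto
  have "card B = CARD('n)"
    using basis_card_eq_dim[of B UNIV] ind B(4) by (simp add: dim_UNIV)
  moreover have "finite B" using ind by (rule independent_imp_finite)
  ultimately obtain u where u: "bij_betw u (UNIV :: 'n set) B"
    by (metis finite_same_card_bij finite)
  have uB: "u c \<in> B" for c using u by (auto simp: bij_betw_def)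
  have "\<forall>c. \<exists>l. A *v u c = l *\<^sub>R u c" using B(3) uB by blast
  then obtain l where l: "\<And>c. A *v u c = l c *\<^sub>R u c" by metis
  have "u c \<bullet> u d = of_bool (c = d)" for c d
  proof (cases "c = d")
    case True
    then show ?thesis using B(2)[OF uB[of d]] by (simp add: dot_square_norm)
  next
    case False
    then have "u c \<noteq> u d" using u by (auto simp: bij_betw_def inj_on_def)
    then show ?thesis using B(1) uB False by (auto simp: pairwise_def Linear_Algebra.orthogonal_def)
  qed
  then show ?thesis using l unfolding eigbasis_def by blast
qed

text \<open>Orthonormality says that a square matrix times its transpose is the identity; the
  product in the other order gives completeness.\<close>

lemma eigbasis_complete:
  assumes "eigbasis A u l"
  shows "(\<Sum>c\<in>UNIV. u c $ i * u c $ j) = of_bool (i = j)"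
proof -
  define U where "U = (\<chi> c i. u c $ i)"
  have "U ** Finite_Cartesian_Product.transpose U = Finite_Cartesian_Product.mat 1"
    using assms by (simp add: eigbasis_def U_def matrix_matrix_mult_def Finite_Cartesian_Product.transpose_def
        Finite_Cartesian_Product.vec_eq_iff Finite_Cartesian_Product.mat_def inner_vec_def of_bool_def)
  then have "Finite_Cartesian_Product.transpose U ** U = Finite_Cartesian_Product.mat 1"
    by (simp add: matrix_left_right_inverse)
  then have "(Finite_Cartesian_Product.transpose U ** U) $ i $ j = Finite_Cartesian_Product.mat 1 $ i $ j" by simp
  then show ?thesis
    by (simp add: U_def matrix_matrix_mult_def Finite_Cartesian_Product.transpose_def
        Finite_Cartesian_Product.mat_def of_bool_def)
qed

lemma eigbasis_expand:
  assumes "eigbasis A u l"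
  shows "x = (\<Sum>c\<in>UNIV. (u c \<bullet> x) *\<^sub>R u c)"
proof -
  have "(\<Sum>c\<in>UNIV. (u c \<bullet> x) *\<^sub>R u c) $ i = x $ i" for i
  proof -
    have "(\<Sum>c\<in>UNIV. (u c \<bullet> x) *\<^sub>R u c) $ i = (\<Sum>c\<in>UNIV. \<Sum>j\<in>UNIV. u c $ j * x $ j * u c $ i)"
      by (simp add: inner_vec_def sum_distrib_right)
    also have "\<dots> = (\<Sum>j\<in>UNIV. x $ j * (\<Sum>c\<in>UNIV. u c $ j * u c $ i))"
      by (subst sum.swap) (simp add: sum_distrib_left mult_ac)
    also have "\<dots> = x $ i" unfolding eigbasis_complete[OF assms] by (simp add: of_bool_def if_distrib cong: if_cong)
    finally show ?thesis .
  qed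
  then show ?thesis by (simp add: Finite_Cartesian_Product.vec_eq_iff)
qed

lemma eigbasis_trace:
  assumes u: "eigbasis A u l" and L: "linear L"
  shows "(\<Sum>c\<in>UNIV. u c \<bullet> L (u c)) = (\<Sum>i\<in>UNIV. L (axis i 1) $ i)"
proof -
  have Lx: "L x $ i = (\<Sum>j\<in>UNIV. x $ j * L (axis j 1) $ i)" for x i
  proof -
    have "x = (\<Sum>j\<in>UNIV. x $ j *\<^sub>R axis j 1)"
      by (simp add: Finite_Cartesian_Product.vec_eq_iff axis_nth if_distrib[of "\<lambda>y. _ * y"] cong: if_cong)
    then have "L x = (\<Sum>j\<in>UNIV. x $ j *\<^sub>R L (axis j 1))"
      using L by (metis (mono_tags, lifting) linear_scale linear_sum sum.cong)
    then show ?thesis by simp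
  qed
  have "(\<Sum>c\<in>UNIV. u c \<bullet> L (u c)) = (\<Sum>c\<in>UNIV. \<Sum>i\<in>UNIV. \<Sum>j\<in>UNIV. u c $ i * u c $ j * L (axis j 1) $ i)"
    by (simp add: inner_vec_def Lx[of "u _"] sum_distrib_left mult.assoc)
  also have "\<dots> = (\<Sum>i\<in>UNIV. \<Sum>c\<in>UNIV. \<Sum>j\<in>UNIV. u c $ i * u c $ j * L (axis j 1) $ i)"
    by (rule sum.swap)
  also have "\<dots> = (\<Sum>i\<in>UNIV. \<Sum>j\<in>UNIV. \<Sum>c\<in>UNIV. u c $ i * u c $ j * L (axis j 1) $ i)"
    by (intro sum.cong refl sum.swap)
  also have "\<dots> = (\<Sum>i\<in>UNIV. \<Sum>j\<in>UNIV. of_bool (i = j) * L (axis j 1) $ i)"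
    by (simp add: sum_distrib_right[symmetric] eigbasis_complete[OF u])
  also have "\<dots> = (\<Sum>i\<in>UNIV. L (axis i 1) $ i)"
    by (simp add: of_bool_def if_distrib[of "\<lambda>y. y * _"] cong: if_cong)
  finally show ?thesis .
qed

lemma eigbasis_moment:
  assumes u: "eigbasis A u l"
  shows "(\<Sum>c\<in>UNIV. l c ^ m) = (\<Sum>i\<in>UNIV. (((*v) A) ^^ m) (axis i 1) $ i)"
proof -
  have L: "linear (((*v) A) ^^ m)"
  proof (induction m)
    case (Suc m)
    then show ?case using linear_compose[OF Suc matrix_vector_mul_linear[of A]] by (simp add: comp_def)
  qed (simp add: linear_id[unfolded id_def] linear_id)
  have "(((*v) A) ^^ m) (u c) = l c ^ m *\<^sub>R u c" for c
    using u by (induction m) (auto simp: eigbasis_def matrix_vector_mult_scaleR)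
  then have "l c ^ m = u c \<bullet> (((*v) A) ^^ m) (u c)" for c
    using u by (simp add: eigbasis_def)
  then show ?thesis using eigbasis_trace[OF u L] by simp
qed

text \<open>The eigenvalue is expressed by the quadratic form, in parallel with the multiplier in
  \<open>crit\<close>.\<close>

definition ueig :: "real^'n^'n \<Rightarrow> real set \<Rightarrow> (real^'n) set" where
  "ueig A B = {x. norm x = 1 \<and> A *v x = (x \<bullet> (A *v x)) *\<^sub>R x \<and> x \<bullet> (A *v x) \<in> B}"

text \<open>Finiteness forces distinct eigenvalues, because a repeated one has a circle of unit
  eigenvectors. With simple spectrum the unit eigenvectors are exactly \<open>u c\<close> and
  \<open>- u c\<close>.\<close>

lemma cnt_ueig:
  fixes A :: "real^'n^'n"
  assumes u: "eigbasis A u l" and fin: "finite (ueig A UNIV)"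
  shows "cnt (ueig A B) = of_nat (2 * card {c. l c \<in> B})"
proof -
  have uc: "u c \<bullet> u d = of_bool (c = d)" "A *v u c = l c *\<^sub>R u c" for c d
    using u by (auto simp: eigbasis_def)
  have un: "norm (u c) = 1" for c using uc(1)[of c c] by (simp add: norm_eq_1)
  have inj: "l c \<noteq> l d" if cd: "c \<noteq> d" for c d
  proof
    assume eq: "l c = l d"
    define g where "g = (\<lambda>t. cos t *\<^sub>R u c + sin t *\<^sub>R u d)"
    have gn: "g t \<bullet> g t = 1" for t
    proof -
      have "g t \<bullet> g t = (cos t)\<^sup>2 + (sin t)\<^sup>2"
        using cd by (simp add: g_def inner_add_left inner_add_right uc power2_eq_square)
      then show ?thesis by simp
    qed
    have gA: "A *v g t = l c *\<^sub>R g t" for t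
      by (simp add: g_def matrix_vector_right_distrib matrix_vector_mult_scaleR uc eq algebra_simps)
    have "g ` {0..pi} \<subseteq> ueig A UNIV" using gn gA by (auto simp: ueig_def norm_eq_1)
    then have "finite (g ` {0..pi})" using fin finite_subset by blast
    moreover have "inj_on g {0..pi}"
    proof (rule inj_onI)
      fix s t assume st: "s \<in> {0..pi}" "t \<in> {0..pi}" "g s = g t"
      have "u c \<bullet> g s = u c \<bullet> g t" using st(3) by simp
      then have "cos s = cos t" using cd by (simp add: g_def inner_add_right uc)
      then show "s = t" using st by (simp add: cos_inj_pi)
    qed
    ultimately have "finite {0..pi}" by (rule finite_imageD)
    then show False using pi_gt_zero infinite_Icc[of 0 pi] by simp
  qed
  have mneg: "A *v (- x) = - (A *v x)" for x
    using matrix_vector_mult_scaleR[of A "- 1" x] by simp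
  have eq: "ueig A B = (\<Union>c\<in>{c. l c \<in> B}. {u c, - u c})"
  proof
    show "(\<Union>c\<in>{c. l c \<in> B}. {u c, - u c}) \<subseteq> ueig A B"
      by (auto simp: ueig_def un uc mneg)
    show "ueig A B \<subseteq> (\<Union>c\<in>{c. l c \<in> B}. {u c, - u c})"
    proof
      fix x assume x: "x \<in> ueig A B"
      define m where "m = x \<bullet> (A *v x)"
      have xA: "A *v x = m *\<^sub>R x" and xn: "norm x = 1" and mB: "m \<in> B" using x by (auto simp: ueig_def m_def)
      define y where "y = (\<lambda>c. u c \<bullet> x)"
      have ex: "x = (\<Sum>c\<in>UNIV. y c *\<^sub>R u c)" unfolding y_def by (rule eigbasis_expand[OF u])
      have yl: "(l c - m) * y c = 0" for c
      proof -
        have "A *v x = (\<Sum>d\<in>UNIV. (y d * l d) *\<^sub>R u d)"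
        proof -
          have "A *v x = A *v (\<Sum>d\<in>UNIV. y d *\<^sub>R u d)" using ex by simp
          also have "\<dots> = (\<Sum>d\<in>UNIV. A *v (y d *\<^sub>R u d))"
            by (rule linear_sum[OF matrix_vector_mul_linear])
          finally show ?thesis by (simp add: matrix_vector_mult_scaleR uc)
        qed
        then have "u c \<bullet> (A *v x) = y c * l c"
          by (simp add: inner_sum_right uc of_bool_def if_distrib[of "\<lambda>z. _ * z"] cong: if_cong)
        moreover have "u c \<bullet> (A *v x) = m * y c" by (simp add: xA y_def)
        ultimately show ?thesis by (auto simp: algebra_simps)
      qed
      have "x \<noteq> 0" using xn by auto
      then obtain c where c: "y c \<noteq> 0" using ex by (metis (mono_tags, lifting) scale_eq_0_iff sum.neutral)
      then have lm: "l c = m" using yl[of c] by simp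
      have y0: "y d = 0" if "d \<noteq> c" for d using yl[of d] inj[OF that] lm by simp
      have xc: "x = y c *\<^sub>R u c"
      proof -
        have "(\<Sum>d\<in>UNIV. y d *\<^sub>R u d) = (\<Sum>d\<in>{c}. y d *\<^sub>R u d)"
          by (rule sum.mono_neutral_right) (auto simp: y0)
        then show ?thesis using ex by simp
      qed
      then have "\<bar>y c\<bar> = 1" using xn un[of c] by (metis mult.right_neutral norm_scaleR)
      then have "y c = 1 \<or> y c = - 1" by auto
      then have "x \<in> {u c, - u c}" using xc by auto
      then show "x \<in> (\<Union>c\<in>{c. l c \<in> B}. {u c, - u c})" using lm mB by auto
    qed
  qed
  have ne: "u c \<noteq> - u c" for c
  proof
    assume "u c = - u c"
    then have "u c \<bullet> u c = - (u c \<bullet> u c)" by (metis inner_minus_left)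
    then show False using uc(1)[of c c] by simp
  qed
  have dj: "{u c, - u c} \<inter> {u d, - u d} = {}" if "c \<noteq> d" for c d
  proof -
    have "v \<noteq> w" if "v \<in> {u c, - u c}" "w \<in> {u d, - u d}" for v w
    proof
      assume "v = w"
      then have "v \<bullet> w = 1" using that(2) un[of d] by (auto simp: dot_square_norm)
      moreover have "v \<bullet> w = 0" using that uc(1)[of c d] \<open>c \<noteq> d\<close> by auto
      ultimately show False by simp
    qed
    then show ?thesis by blast
  qed
  have "card (ueig A B) = (\<Sum>c\<in>{c. l c \<in> B}. card {u c, - u c})"
    unfolding eq using dj by (intro card_UN_disjoint) auto
  also have "\<dots> = 2 * card {c. l c \<in> B}" using ne by simp
  finally have "card (ueig A B) = 2 * card {c. l c \<in> B}" .
  moreover have "finite (ueig A B)" unfolding eq by auto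
  ultimately show ?thesis by (simp add: cnt_finite)
qed

section \<open>Measurability of eigenvalue counts\<close>

definition cart_mat :: "(nat \<Rightarrow> 'n) \<Rightarrow> real^'n^'n \<Rightarrow> real mat" where
  "cart_mat h A = Matrix.mat CARD('n) CARD('n) (\<lambda>(i, j). A $ h i $ h j)"

text \<open>The matrix with columns \<open>u c\<close> diagonalises, and similar matrices have the
  same characteristic polynomial.\<close>

lemma char_poly_eigbasis:
  fixes A :: "real^'n^'n"
  assumes h: "bij_betw h {..<CARD('n)} (UNIV :: 'n set)" and u: "eigbasis A u l"
  shows "char_poly (cart_mat h A) = (\<Prod>a\<leftarrow>map (\<lambda>i. l (h i)) [0..<CARD('n)]. [:- a, 1:])"
proof -
  let ?N = "CARD('n)"
  define W where "W = cart_mat h A"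
  define U where "U = Matrix.mat ?N ?N (\<lambda>(i, j). u (h j) $ h i)"
  define V where "V = Matrix.mat ?N ?N (\<lambda>(i, j). u (h i) $ h j)"
  define D where "D = Matrix.mat ?N ?N (\<lambda>(i, j). if i = j then l (h i) else 0)"
  have c: "W \<in> carrier_mat ?N ?N" "U \<in> carrier_mat ?N ?N" "V \<in> carrier_mat ?N ?N" "D \<in> carrier_mat ?N ?N"
    by (simp_all add: W_def cart_mat_def U_def V_def D_def)
  have hi: "h i = h j \<longleftrightarrow> i = j" if "i < ?N" "j < ?N" for i j
    using h that by (auto simp: bij_betw_def inj_on_def)
  have sm: "(\<Sum>x = 0..<?N. g (h x)) = sum g UNIV" for g :: "'n \<Rightarrow> real"
    using sum.reindex_bij_betw[OF h, of g] by (simp add: atLeast0LessThan)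
  have UV: "U * V = 1\<^sub>m ?N"
  proof (rule eq_matI)
    fix i j assume ij: "i < dim_row (1\<^sub>m ?N)" "j < dim_col (1\<^sub>m ?N)"
    then show "(U * V) $$ (i, j) = 1\<^sub>m ?N $$ (i, j)"
      using eigbasis_complete[OF u, of "h i" "h j"] hi[of i j]
      by (simp add: U_def V_def scalar_prod_def sm[of "\<lambda>x. u x $ h i * u x $ h j"])
  qed (simp_all add: U_def V_def)
  have VU: "V * U = 1\<^sub>m ?N"
    using mat_mult_left_right_inverse[OF c(2) c(3) UV] .
  have WUD: "W * U = U * D"
  proof (rule eq_matI)
    fix i j assume ij: "i < dim_row (U * D)" "j < dim_col (U * D)"
    then have ij': "i < ?N" "j < ?N" by (simp_all add: U_def D_def)
    have "(W * U) $$ (i, j) = (\<Sum>x = 0..<?N. A $ h i $ h x * u (h j) $ h x)"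
      using ij' by (simp add: W_def cart_mat_def U_def scalar_prod_def)
    also have "\<dots> = (A *v u (h j)) $ h i"
      using sm[of "\<lambda>x. A $ h i $ x * u (h j) $ x"] by (simp add: matrix_vector_mult_def)
    also have "\<dots> = l (h j) * u (h j) $ h i" using u by (simp add: eigbasis_def)
    also have "\<dots> = (\<Sum>x = 0..<?N. u (h x) $ h i * (if x = j then l (h x) else 0))"
      using ij' by (simp add: if_distrib cong: if_cong)
    also have "\<dots> = (U * D) $$ (i, j)"
      using ij' by (simp add: U_def D_def scalar_prod_def)
    finally show "(W * U) $$ (i, j) = (U * D) $$ (i, j)" .
  qed (simp_all add: W_def cart_mat_def U_def D_def)
  have "W = W * (U * V)" using c by (simp add: UV)
  also have "\<dots> = U * D * V" using c by (metis WUD assoc_mult_mat)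
  finally have "similar_mat_wit W D U V"
    using c UV VU by (auto simp: similar_mat_wit_def Let_def)
  then have "similar_mat W D" by (auto simp: similar_mat_def)
  then have "char_poly W = char_poly D" by (rule char_poly_similar)
  also have "\<dots> = (\<Prod>a\<leftarrow>diag_mat D. [:- a, 1:])"
    by (rule char_poly_upper_triangular[OF c(4)]) (auto simp: D_def upper_triangular_def)
  also have "diag_mat D = map (\<lambda>i. l (h i)) [0..<?N]"
    by (auto simp: diag_mat_def D_def)
  finally show ?thesis by (simp add: W_def)
qed

lemma proots_prod_list_linear: "proots (\<Prod>a\<leftarrow>xs. [:- a, 1:]) = mset (xs :: real list)"
proof (induction xs)
  case (Cons a xs)
  have "(\<Prod>a\<leftarrow>xs. [:- a, 1:]) \<noteq> 0" by (auto simp: prod_list_zero_iff)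
  moreover have "[:- a, 1:] \<noteq> 0" by simp
  ultimately have "proots ([:- a, 1:] * (\<Prod>a\<leftarrow>xs. [:- a, 1:])) = proots [:- a, 1:] + proots (\<Prod>a\<leftarrow>xs. [:- a, 1:])"
    by (intro proots_mult) auto
  then show ?case using Cons by simp
qed simp

text \<open>The ordered list is a rearrangement of the values of \<open>l\<close>, multiplicities
  included.\<close>

lemma sum_ordered_eigenvalues:
  fixes A :: "real^'n^'n"
  assumes h: "bij_betw h {..<CARD('n)} (UNIV :: 'n set)" and u: "eigbasis A u l"
  shows "(\<Sum>i<CARD('n). f (ordered_eigenvalues (cart_mat h A) ! i)) = (\<Sum>c\<in>UNIV. f (l c) :: real)"
proof -
  let ?N = "CARD('n)"
  define xs where "xs = ordered_eigenvalues (cart_mat h A)"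
  have ms: "mset xs = mset (map (\<lambda>i. l (h i)) [0..<?N])"
    unfolding xs_def ordered_eigenvalues_def char_poly_eigbasis[OF h u] proots_prod_list_linear by simp
  then have len: "length xs = ?N" by (metis length_map length_upt minus_nat.diff_0 size_mset)
  have "(\<Sum>i<?N. f (xs ! i)) = sum_list (map f xs)"
    unfolding sum_list_sum_nth by (simp add: len atLeast0LessThan)
  also have "\<dots> = sum_mset (image_mset f (mset xs))" by (simp add: sum_mset_sum_list[symmetric] flip: mset_map)
  also have "\<dots> = sum_list (map f (map (\<lambda>i. l (h i)) [0..<?N]))"
    unfolding ms by (simp add: sum_mset_sum_list[symmetric] flip: mset_map)
  also have "\<dots> = (\<Sum>i<?N. f (l (h i)))"
    by (simp add: sum_list_sum_nth atLeast0LessThan)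
  also have "\<dots> = (\<Sum>c\<in>UNIV. f (l c))" using sum.reindex_bij_betw[OF h, of "\<lambda>c. f (l c)"] by simp
  finally show ?thesis by (simp add: xs_def)
qed

text \<open>Trapezoids that are 1 on the interval and fall to 0 with slope \<open>n\<close> converge
  pointwise to the indicator. Each is approximated up to 1 / (n + 1) by a polynomial on [-n, n], a
  range that eventually contains any given point.\<close>

lemma polynomials_to_indicator:
  fixes a b :: real
  shows "\<exists>P. (\<forall>n. real_polynomial_function (P n)) \<and> (\<forall>x. (\<lambda>n. P n x) \<longlonglongrightarrow> indicator {a..b} x)"
proof -
  define d where "d = (\<lambda>x. max 0 (a - x) + max 0 (x - b))"
  define g where "g = (\<lambda>n x. if a \<le> b then max 0 (1 - real n * d x) else 0)"
  have "continuous_on {- real n..real n} (g n)" for n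
  proof (cases "a \<le> b")
    case True
    then have "g n = (\<lambda>x. max 0 (1 - real n * (max 0 (a - x) + max 0 (x - b))))" by (simp add: g_def d_def)
    then show ?thesis by (auto intro!: continuous_intros)
  qed (simp add: g_def[abs_def])
  then have "\<exists>P. real_polynomial_function P \<and> (\<forall>x\<in>{- real n..real n}. \<bar>g n x - P x\<bar> < 1 / real (Suc n))" for n
    by (rule Stone_Weierstrass_real_polynomial_function[of "{- real n..real n}" "g n" "1 / real (Suc n)", rotated]) auto
  then obtain P where P: "\<And>n. real_polynomial_function (P n)"
    "\<And>n x. x \<in> {- real n..real n} \<Longrightarrow> \<bar>g n x - P n x\<bar> < 1 / real (Suc n)" by metis
  have "(\<lambda>n. P n x) \<longlonglongrightarrow> indicator {a..b} x" for x
  proof -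
    have "(\<lambda>n. g n x) \<longlonglongrightarrow> indicator {a..b} x"
    proof (cases "x \<in> {a..b}")
      case True
      then have "g n x = 1" for n by (auto simp: g_def d_def)
      then show ?thesis using True by simp
    next
      case False
      have "eventually (\<lambda>n. g n x = 0) sequentially"
      proof (cases "a \<le> b")
        case True
        then have "d x > 0" using False by (auto simp: d_def)
        then obtain m :: nat where m: "1 < real m * d x" using reals_Archimedean3 by blast
        have "g n x = 0" if "n \<ge> m" for n
        proof -
          have "real m * d x \<le> real n * d x" using that \<open>d x > 0\<close> by (intro mult_right_mono) auto
          then show ?thesis using m True by (simp add: g_def)
        qed
        then show ?thesis unfolding eventually_sequentially by blast
      qed (simp add: g_def)
      then show ?thesis using False by (simp add: tendsto_eventually)
    qed
    moreover have "(\<lambda>n. P n x - g n x) \<longlonglongrightarrow> 0"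
    proof (rule Lim_null_comparison)
      obtain m :: nat where m: "\<bar>x\<bar> \<le> real m" using real_arch_simple by blast
      show "\<forall>\<^sub>F n in sequentially. norm (P n x - g n x) \<le> 1 / real (Suc n)"
        unfolding eventually_sequentially
      proof (intro exI allI impI)
        fix n assume "m \<le> n"
        then have "x \<in> {- real n..real n}" using m by (auto simp: abs_le_iff)
        from P(2)[OF this] show "norm (P n x - g n x) \<le> 1 / real (Suc n)" by (simp add: abs_minus_commute)
      qed
      show "(\<lambda>n. 1 / real (Suc n)) \<longlonglongrightarrow> 0" using LIMSEQ_inverse_real_of_nat by (simp add: inverse_eq_divide)
    qed
    ultimately have "(\<lambda>n. (P n x - g n x) + g n x) \<longlonglongrightarrow> 0 + indicator {a..b} x" by (intro tendsto_add)
    then show ?thesis by simp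
  qed
  then show ?thesis using P(1) by blast
qed

text \<open>Sums of powers of the eigenvalues are traces, and the indicator of a compact interval is a pointwise limit
  of polynomials.\<close>
lemma measurable_eigenvalue_count:
  fixes A :: "'w \<Rightarrow> real^'n^'n"
  assumes h: "bij_betw h {..<CARD('n)} (UNIV :: 'n set)" and s: "\<And>w. symm (A w)"
    and A: "\<And>i j. (\<lambda>w. A w $ i $ j) \<in> borel_measurable M"
  shows "(\<lambda>w. \<Sum>i<CARD('n). indicator {a..b} (ordered_eigenvalues (cart_mat h (A w)) ! i) :: real) \<in> borel_measurable M"
proof -
  obtain u l where u: "\<And>w. eigbasis (A w) (u w) (l w)"
    using spectral_theorem[OF s] by metis
  have vm: "(\<lambda>w. (((*v) (A w)) ^^ m) (axis i 1) $ j) \<in> borel_measurable M" for m i j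
  proof (induction m arbitrary: j)
    case (Suc m)
    have "(\<lambda>w. \<Sum>k\<in>UNIV. A w $ j $ k * (((*v) (A w)) ^^ m) (axis i 1) $ k) \<in> borel_measurable M"
      by (intro borel_measurable_sum borel_measurable_times A Suc)
    moreover have "(((*v) (A w)) ^^ Suc m) (axis i 1) $ j = (\<Sum>k\<in>UNIV. A w $ j $ k * (((*v) (A w)) ^^ m) (axis i 1) $ k)" for w
      by (simp only: funpow.simps comp_apply) (subst matrix_vector_mult_def, simp)
    ultimately show ?case by simp
  qed simp
  have mom: "(\<lambda>w. \<Sum>c\<in>UNIV. l w c ^ m) \<in> borel_measurable M" for m
    unfolding eigbasis_moment[OF u] by (intro borel_measurable_sum vm)
  obtain P where P: "\<And>n. real_polynomial_function (P n)" "\<And>x. (\<lambda>n. P n x) \<longlonglongrightarrow> indicator {a..b} x"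
    using polynomials_to_indicator[of a b] by blast
  have "(\<lambda>w. \<Sum>c\<in>UNIV. P n (l w c)) \<in> borel_measurable M" for n
  proof -
    obtain q m where "P n = (\<lambda>x. \<Sum>i\<le>m. q i * x ^ i)"
      using P(1)[of n] unfolding real_polynomial_function_iff_sum by blast
    then have "(\<lambda>w. \<Sum>c\<in>UNIV. P n (l w c)) = (\<lambda>w. \<Sum>i\<le>m. q i * (\<Sum>c\<in>UNIV. l w c ^ i))"
      by (intro ext) (simp only: sum_distrib_left, rule sum.swap)
    then show ?thesis using mom by (simp add: borel_measurable_sum)
  qed
  then have "(\<lambda>w. \<Sum>c\<in>UNIV. indicator {a..b} (l w c) :: real) \<in> borel_measurable M"
    by (rule borel_measurable_LIMSEQ_real[where u = "\<lambda>n w. \<Sum>c\<in>UNIV. P n (l w c)", rotated]) (intro tendsto_sum P(2))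
  then show ?thesis by (simp add: sum_ordered_eigenvalues[OF h u])
qed

section \<open>The case p = 2\<close>

text \<open>The energy is bounded on the sphere, so countably many bounded windows of energies
  suffice.\<close>

lemma AE_finite_crit_UNIV:
  assumes p: "p \<ge> 2"
  shows "AE J in gam p. finite (crit p J UNIV :: (real^'n::{finite,wellorder}) set)"
proof -
  have "AE J in gam p. \<forall>n::nat. finite (crit p J {- real n..real n} :: (real^'n::_) set)"
    unfolding AE_all_countable using AE_finite_crit[OF p] by blast
  then show ?thesis
  proof (rule AE_mp, intro AE_I2 impI)
    fix J :: "'n list \<Rightarrow> real"
    assume fin: "\<forall>n::nat. finite (crit p J {- real n..real n} :: (real^'n::_) set)"
    have "bounded (homf p J ` sphere 0 1)"
      by (intro compact_imp_bounded compact_continuous_image continuous_on_homf continuous_on_id) simp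
    then obtain B where "\<forall>y\<in>homf p J ` sphere 0 1. norm y \<le> B" unfolding bounded_iff by blast
    then have B: "\<And>x. x \<in> sphere 0 1 \<Longrightarrow> \<bar>homf p J x\<bar> \<le> B" by simp
    obtain n :: nat where n: "B \<le> real n" using real_arch_simple by blast
    have "crit p J UNIV \<subseteq> crit p J {- real n..real n}"
    proof
      fix x assume x: "x \<in> crit p J UNIV"
      then have "\<bar>homf p J x\<bar> \<le> real n" using B[of x] n by (simp add: crit_def)
      then show "x \<in> crit p J {- real n..real n}" using x by (auto simp: crit_def abs_le_iff)
    qed
    then show "finite (crit p J UNIV)" using fin finite_subset by blast
  qed
qed

definition uptri :: "nat \<Rightarrow> (nat \<times> nat) set" where
  "uptri N = {(i, j). i \<le> j \<and> j < N}"

lemma finite_uptri [simp]: "finite (uptri N)"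
  by (rule finite_subset[of _ "{..<N} \<times> {..<N}"]) (auto simp: uptri_def)

definition ix :: "(nat \<Rightarrow> 'n::finite) \<Rightarrow> 'n \<Rightarrow> nat" where
  "ix h = inv_into {..<CARD('n)} h"

text \<open>The position of an unordered pair of indices in the upper triangle, for an enumeration \<open>h\<close> of the index type.\<close>
definition mm :: "(nat \<Rightarrow> 'n::finite) \<Rightarrow> 'n \<Rightarrow> 'n \<Rightarrow> nat \<times> nat" where
  "mm h a b = (min (ix h a) (ix h b), max (ix h a) (ix h b))"

definition symA :: "(nat \<Rightarrow> 'n::finite) \<Rightarrow> (nat \<times> nat \<Rightarrow> real) \<Rightarrow> real^'n^'n" where
  "symA h y = (\<chi> a b. y (mm h a b))"

context
  fixes h :: "nat \<Rightarrow> 'n::finite"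
  assumes h: "bij_betw h {..<CARD('n)} (UNIV :: 'n set)"
begin

lemma h_ix: "h (ix h a) = a" "ix h a < CARD('n)"
proof -
  have a: "a \<in> h ` {..<CARD('n)}" using h by (auto simp: bij_betw_def)
  show "h (ix h a) = a" unfolding ix_def using a by (rule f_inv_into_f)
  show "ix h a < CARD('n)" using inv_into_into[OF a] by (simp add: ix_def)
qed

lemma ix_h: "i < CARD('n) \<Longrightarrow> ix h (h i) = i"
  using h by (simp add: ix_def bij_betw_def inv_into_f_f)

lemma ix_eq: "ix h a = ix h b \<longleftrightarrow> a = b"
  using h_ix by metis

lemma mm_uptri: "mm h a b \<in> uptri CARD('n)"
  using h_ix(2)[of a] h_ix(2)[of b] by (auto simp: mm_def uptri_def)

lemma mm_eq: "mm h a b = mm h c d \<longleftrightarrow> (a = c \<and> b = d) \<or> (a = d \<and> b = c)"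
proof -
  have "mm h a b = mm h c d \<longleftrightarrow> (ix h a = ix h c \<and> ix h b = ix h d) \<or> (ix h a = ix h d \<and> ix h b = ix h c)"
    by (auto simp: mm_def min_def max_def)
  then show ?thesis by (simp add: ix_eq)
qed

lemma mm_surj: "x \<in> uptri CARD('n) \<Longrightarrow> x = mm h (h (fst x)) (h (snd x))"
  by (cases x) (auto simp: uptri_def mm_def ix_h)

lemma symm_symA: "symm (symA h y)"
  by (auto simp: symm_def symA_def mm_def min.commute max.commute)

lemma cart_mat_symA: "cart_mat h (symA h y) = Matrix.mat CARD('n) CARD('n) (\<lambda>(i, j). y (min i j, max i j))"
  unfolding cart_mat_def by (rule cong_mat) (auto simp: symA_def mm_def ix_h)

definition evcount :: "real \<Rightarrow> real \<Rightarrow> (nat \<times> nat \<Rightarrow> real) \<Rightarrow> real" where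
  "evcount a b y = (\<Sum>i<CARD('n). indicator {a..b} (ordered_eigenvalues (cart_mat h (symA h y)) ! i))"

lemma measurable_evcount: "evcount a b \<in> borel_measurable (PiM (uptri CARD('n)) (\<lambda>_. borel))"
  unfolding evcount_def[abs_def]
proof (rule measurable_eigenvalue_count[OF h])
  fix c d :: 'n
  show "(\<lambda>y. symA h y $ c $ d) \<in> borel_measurable (PiM (uptri CARD('n)) (\<lambda>_. borel))"
    unfolding symA_def using mm_uptri by simp
qed (rule symm_symA)

lemma evcount_bounds: "0 \<le> evcount a b y" "evcount a b y \<le> real CARD('n)"
proof -
  show "0 \<le> evcount a b y" unfolding evcount_def by (intro sum_nonneg) auto
  have "evcount a b y \<le> (\<Sum>i<CARD('n). 1)" unfolding evcount_def by (intro sum_mono) (auto simp: indicator_def)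
  then show "evcount a b y \<le> real CARD('n)" by simp
qed

definition goe_law :: "(nat \<times> nat \<Rightarrow> real) measure" where
  "goe_law = PiM (uptri CARD('n)) (\<lambda>(i, j). normN ((1 + of_bool (i = j)) / (2 * real CARD('n))))"

lemma sets_goe_law [measurable_cong]: "sets goe_law = sets (PiM (uptri CARD('n)) (\<lambda>_. borel))"
  unfolding goe_law_def by (intro sets_PiM_cong) auto

text \<open>A symmetric matrix is determined by its upper triangle, and \<open>GOE\<close>
  prescribes the joint law of that.\<close>

lemma goe_eigenvalue_mean:
  assumes G: "GOE CARD('n) Q W"
  shows "(LINT \<omega>|Q. (\<Sum>i<CARD('n). indicator {a..b} (ordered_eigenvalues (W \<omega>) ! i))) = (LINT y|goe_law. evcount a b y)"
proof -
  let ?N = "CARD('n)"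
  interpret prob_space Q using G by (simp add: GOE_def)
  let ?X = "\<lambda>(i, j) \<omega>. W \<omega> $$ (i, j)"
  have ind: "indep_vars (\<lambda>_. borel) ?X (uptri ?N)" using G by (simp add: GOE_def uptri_def)
  have d: "distributed Q lborel (\<lambda>\<omega>. W \<omega> $$ (i, j)) (normal_density 0 (sqrt ((1 + of_bool (i = j)) / (2 * real ?N))))"
    if "(i, j) \<in> uptri ?N" for i j
    using G that by (auto simp: GOE_def uptri_def)
  have rv: "?X x \<in> borel_measurable Q" if "x \<in> uptri ?N" for x
    using d that by (cases x) (auto simp: distributed_def)
  have ne: "uptri ?N \<noteq> {}"
  proof -
    have "(0, 0) \<in> uptri ?N" by (simp add: uptri_def)
    then show ?thesis by blast
  qed
  have "distr Q (PiM (uptri ?N) (\<lambda>_. borel)) (\<lambda>\<omega>. \<lambda>x\<in>uptri ?N. ?X x \<omega>) = PiM (uptri ?N) (\<lambda>x. distr Q borel (?X x))"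
    using indep_vars_iff_distr_eq_PiM'[OF ne, where X = ?X and M' = "\<lambda>_. borel"] rv ind by blast
  also have "\<dots> = goe_law"
    unfolding goe_law_def
  proof (rule PiM_cong[OF refl])
    fix x assume x: "x \<in> uptri ?N"
    obtain i j where ij: "x = (i, j)" by (cases x)
    have "distr Q borel (\<lambda>\<omega>. W \<omega> $$ (i, j)) = distr Q lborel (\<lambda>\<omega>. W \<omega> $$ (i, j))" by (rule distr_cong) auto
    then show "distr Q borel (?X x) = (case x of (i, j) \<Rightarrow> normN ((1 + of_bool (i = j)) / (2 * real ?N)))"
      using d[of i j] x unfolding ij by (simp add: distributed_def normN_def)
  qed
  finally have law: "distr Q (PiM (uptri ?N) (\<lambda>_. borel)) (\<lambda>\<omega>. \<lambda>x\<in>uptri ?N. ?X x \<omega>) = goe_law" .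
  have m: "(\<lambda>\<omega>. \<lambda>x\<in>uptri ?N. ?X x \<omega>) \<in> Q \<rightarrow>\<^sub>M PiM (uptri ?N) (\<lambda>_. borel)"
    by (intro measurable_restrict rv)
  have "(LINT y|goe_law. evcount a b y) = (LINT \<omega>|Q. evcount a b (\<lambda>x\<in>uptri ?N. ?X x \<omega>))"
    unfolding law[symmetric] by (rule integral_distr[OF m measurable_evcount])
  also have "\<dots> = (LINT \<omega>|Q. (\<Sum>i<?N. indicator {a..b} (ordered_eigenvalues (W \<omega>) ! i)))"
  proof (rule Bochner_Integration.integral_cong[OF refl])
    fix \<omega> assume w: "\<omega> \<in> space Q"
    then have W: "W \<omega> \<in> carrier_mat ?N ?N" "transpose_mat (W \<omega>) = W \<omega>" using G by (auto simp: GOE_def)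
    have sy: "W \<omega> $$ (i, j) = W \<omega> $$ (j, i)" if "i < ?N" "j < ?N" for i j
      using W that by (metis carrier_matD index_transpose_mat(1))
    have "cart_mat h (symA h (\<lambda>x\<in>uptri ?N. ?X x \<omega>)) = W \<omega>"
      unfolding cart_mat_symA
      using W(1) sy by (intro eq_matI) (auto simp: uptri_def min_def max_def)
    then show "evcount a b (\<lambda>x\<in>uptri ?N. ?X x \<omega>) = (\<Sum>i<?N. indicator {a..b} (ordered_eigenvalues (W \<omega>) ! i))"
      by (simp add: evcount_def)
  qed
  finally show ?thesis ..
qed

text \<open>A diagonal entry is one coupling over sqrt N, an off-diagonal one the sum of two
  couplings over 2 sqrt N; the variances are 1/N and 1/(2N), as for the GOE. Both cases are entries
  of the symmetrised coupling matrix over sqrt N.\<close>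

definition Jtri :: "('n list \<Rightarrow> real) \<Rightarrow> nat \<times> nat \<Rightarrow> real" where
  "Jtri J = (\<lambda>x\<in>uptri CARD('n). (if fst x = snd x then 1 / sqrt (real CARD('n)) else 1 / (2 * sqrt (real CARD('n)))) *
     (\<Sum>i\<in>{i \<in> {i. length i = 2}. mm h (i ! 0) (i ! 1) = x}. J i))"

lemma mm_fiber: "{i \<in> {i. length i = 2}. mm h (i ! 0) (i ! 1) = mm h a b} = {[a, b], [b, a]}"
proof -
  have "i \<in> {i \<in> {i. length i = 2}. mm h (i ! 0) (i ! 1) = mm h a b} \<longleftrightarrow> i \<in> {[a, b], [b, a]}" for i
    by (auto simp: mm_eq length_Suc_conv numeral_2_eq_2)
  then show ?thesis by blast
qed

lemma mm_diag: "fst (mm h a b) = snd (mm h a b) \<longleftrightarrow> a = b"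
  using ix_eq[of a b] by (auto simp: mm_def min_def max_def)

lemma distr_Jtri: "distr (gam 2) (PiM (uptri CARD('n)) (\<lambda>_. borel)) Jtri = goe_law"
proof -
  let ?c = "\<lambda>x::nat \<times> nat. if fst x = snd x then 1 / sqrt (real CARD('n)) else 1 / (2 * sqrt (real CARD('n)))"
  have "distr (PiM {i. length i = 2} (\<lambda>_. stdN)) (PiM (uptri CARD('n)) (\<lambda>_. borel))
      (\<lambda>J. \<lambda>x\<in>uptri CARD('n). ?c x * (\<Sum>i\<in>{i \<in> {i. length i = 2}. mm h (i ! 0) (i ! 1) = x}. J i)) =
    PiM (uptri CARD('n)) (\<lambda>x. normN ((?c x)\<^sup>2 * real (card {i \<in> {i. length i = 2}. mm h (i ! 0) (i ! 1) = x})))"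
  proof (rule distr_group_sums)
    show "{i \<in> {i. length i = 2}. mm h (i ! 0) (i ! 1) = x} \<noteq> {}" if "x \<in> uptri CARD('n)" for x
      using mm_fiber[of "h (fst x)" "h (snd x)"] mm_surj[OF that] by simp
  qed auto
  also have "\<dots> = goe_law"
    unfolding goe_law_def
  proof (rule PiM_cong[OF refl])
    fix x assume "x \<in> uptri CARD('n)"
    then have "x = mm h (h (fst x)) (h (snd x))" by (rule mm_surj)
    then obtain a b where x: "x = mm h a b" by blast
    have "(?c x)\<^sup>2 * real (card {i \<in> {i. length i = 2}. mm h (i ! 0) (i ! 1) = x}) =
      (1 + of_bool (fst x = snd x)) / (2 * real CARD('n))"
      unfolding x mm_fiber mm_diag by (cases "a = b") (auto simp: power_divide power_mult_distrib field_simps)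
    then show "normN ((?c x)\<^sup>2 * real (card {i \<in> {i. length i = 2}. mm h (i ! 0) (i ! 1) = x})) =
      (case x of (i, j) \<Rightarrow> normN ((1 + of_bool (i = j)) / (2 * real CARD('n))))"
      by (simp add: case_prod_beta')
  qed
  finally show ?thesis by (simp add: gam_def Jtri_def[abs_def])
qed

lemma symA_Jtri: "symA h (Jtri J) $ a $ b = (J [a, b] + J [b, a]) / (2 * sqrt (real CARD('n)))"
proof -
  have "Jtri J (mm h a b) = (if a = b then 1 / sqrt (real CARD('n)) else 1 / (2 * sqrt (real CARD('n)))) *
    (\<Sum>i\<in>{[a, b], [b, a]}. J i)"
    unfolding Jtri_def using mm_uptri by (simp only: restrict_apply' mm_diag mm_fiber)
  then show ?thesis by (cases "a = b") (auto simp: symA_def)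
qed

lemma sum_lists_2: "(\<Sum>i | length i = 2. g i) = (\<Sum>a\<in>UNIV. \<Sum>b\<in>UNIV. g [a, b])" for g :: "'n list \<Rightarrow> real"
  by (simp add: numeral_2_eq_2 sum_lists_Suc)

text \<open>For \<open>p = 2\<close> the polynomial is sqrt N times the quadratic form of the
  symmetrised matrix, so critical points are unit eigenvectors and the energy is sqrt N times the
  eigenvalue.\<close>

lemma crit_2_ueig: "crit 2 J ((\<lambda>b. sqrt (real CARD('n)) * b) ` B) = ueig (symA h (Jtri J)) B"
proof -
  define s where "s = sqrt (real CARD('n))"
  have s0: "s > 0" by (simp add: s_def)
  define A where "A = symA h (Jtri J)"
  have g: "homg 2 J x = (2 * s) *\<^sub>R (A *v x)" for x
  proof -
    have "homg 2 J x $ c = (2 * s) * (A *v x) $ c" for c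
    proof -
      have "homg 2 J x $ c = (\<Sum>i | length i = 2. J i * gmon i x $ c)" by (simp add: homg_def)
      also have "\<dots> = (\<Sum>a\<in>UNIV. \<Sum>b\<in>UNIV. of_bool (a = c) * (J [a, b] * x $ b)) +
          (\<Sum>a\<in>UNIV. \<Sum>b\<in>UNIV. of_bool (b = c) * (J [a, b] * x $ a))"
        unfolding sum_lists_2 sum.distrib[symmetric] by (intro sum.cong refl) (auto simp: axis_nth algebra_simps)
      also have "\<dots> = (\<Sum>b\<in>UNIV. J [c, b] * x $ b) + (\<Sum>a\<in>UNIV. J [a, c] * x $ a)"
      proof (rule arg_cong2[where f = "(+)"])
        show "(\<Sum>a\<in>UNIV. \<Sum>b\<in>UNIV. of_bool (a = c) * (J [a, b] * x $ b)) = (\<Sum>b\<in>UNIV. J [c, b] * x $ b)"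
          by (simp only: sum_distrib_left[symmetric]) (simp add: of_bool_def if_distrib[of "\<lambda>y. y * _"] cong: if_cong)
        show "(\<Sum>a\<in>UNIV. \<Sum>b\<in>UNIV. of_bool (b = c) * (J [a, b] * x $ a)) = (\<Sum>a\<in>UNIV. J [a, c] * x $ a)"
          by (simp add: of_bool_def if_distrib[of "\<lambda>y. y * _"] cong: if_cong)
      qed
      also have "\<dots> = (2 * s) * (A *v x) $ c"
      proof -
        have "(2 * s) * (A *v x) $ c = (\<Sum>b\<in>UNIV. (2 * s) * ((J [c, b] + J [b, c]) / (2 * s) * x $ b))"
          unfolding A_def matrix_vector_mult_def by (simp add: symA_Jtri s_def[symmetric] sum_distrib_left)
        also have "\<dots> = (\<Sum>b\<in>UNIV. J [c, b] * x $ b + J [b, c] * x $ b)"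
          using s0 by (intro sum.cong refl) (simp add: distrib_right)
        finally show ?thesis by (simp add: sum.distrib)
      qed
      finally show ?thesis .
    qed
    then show ?thesis by (simp add: Finite_Cartesian_Product.vec_eq_iff)
  qed
  have f: "homf 2 J x = s * (x \<bullet> (A *v x))" for x
    using homg_euler[of 2 J x] by (simp add: g inner_commute)
  have "x \<in> crit 2 J ((\<lambda>b. s * b) ` B) \<longleftrightarrow> x \<in> ueig A B" for x
  proof -
    have "homg 2 J x = (real 2 * homf 2 J x) *\<^sub>R x \<longleftrightarrow> (2 * s) *\<^sub>R (A *v x) = (2 * s) *\<^sub>R ((x \<bullet> (A *v x)) *\<^sub>R x)"
      by (simp add: f g mult.assoc)
    also have "\<dots> \<longleftrightarrow> A *v x = (x \<bullet> (A *v x)) *\<^sub>R x"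
      unfolding real_vector.scale_cancel_left using s0 by simp
    finally show ?thesis using s0 by (auto simp: crit_def ueig_def f)
  qed
  then show ?thesis by (auto simp: s_def A_def)
qed

end

text \<open>Almost surely there are finitely many critical points, and then every eigenvalue counts
  twice, through \<open>u\<close> and \<open>- u\<close>.\<close>

lemma Ecrit_2_GOE:
  assumes G: "GOE CARD('n::{finite,wellorder}) Q W"
  shows "Ecrit 2 TYPE('n) ((\<lambda>b. sqrt (real CARD('n)) * b) ` {a..b}) =
    ennreal (2 * (LINT \<omega>|Q. (\<Sum>i<CARD('n). indicator {a..b} (ordered_eigenvalues (W \<omega>) ! i))))"
proof -
  obtain h where h: "bij_betw h {..<CARD('n)} (UNIV :: 'n set)"
    using finite_same_card_bij[of "{..<CARD('n)}" "UNIV :: 'n set"] by auto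
  let ?T = "PiM (uptri CARD('n)) (\<lambda>_. borel :: real measure)"
  have "Ecrit 2 TYPE('n) ((\<lambda>b. sqrt (real CARD('n)) * b) ` {a..b}) = (\<integral>\<^sup>+J. ennreal (2 * evcount h a b (Jtri h J)) \<partial>gam 2)"
    unfolding Ecrit_def crit_2_ueig[OF h]
  proof (rule nn_integral_cong_AE, rule AE_mp[OF AE_finite_crit_UNIV[of 2]], simp, intro AE_I2 impI)
    fix J :: "'n list \<Rightarrow> real"
    assume fin: "finite (crit 2 J UNIV)"
    let ?A = "symA h (Jtri h J)"
    have "(\<lambda>b. sqrt (real CARD('n)) * b) ` UNIV = UNIV"
      unfolding surj_def by (auto intro!: exI[of _ "_ / sqrt (real CARD('n))"])
    then have fin': "finite (ueig ?A UNIV)" using fin crit_2_ueig[OF h, of J UNIV] by simp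
    obtain u l where u: "eigbasis ?A u l" using spectral_theorem[OF symm_symA[OF h]] by blast
    have "evcount h a b (Jtri h J) = (\<Sum>c\<in>UNIV. indicator {a..b} (l c))"
      unfolding evcount_def[OF h] by (rule sum_ordered_eigenvalues[OF h u])
    also have "\<dots> = real (card {c. l c \<in> {a..b}})"
      by (simp add: indicator_def)
    finally show "cnt (ueig ?A {a..b}) = ennreal (2 * evcount h a b (Jtri h J))"
      unfolding cnt_ueig[OF u fin'] by (simp add: ennreal_of_nat_eq_real_of_nat)
  qed
  also have "\<dots> = (\<integral>\<^sup>+y. ennreal (2 * evcount h a b y) \<partial>goe_law TYPE('n))"
  proof -
    have "Jtri h \<in> gam 2 \<rightarrow>\<^sub>M ?T"
      unfolding Jtri_def[OF h, abs_def]
      by (intro measurable_restrict borel_measurable_times borel_measurable_const borel_measurable_sum) auto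
    moreover have "(\<lambda>y. ennreal (2 * evcount h a b y)) \<in> borel_measurable ?T"
      using measurable_evcount[OF h, of a b] by measurable
    ultimately show ?thesis
      unfolding distr_Jtri[OF h, symmetric] by (subst nn_integral_distr) simp_all
  qed
  also have "\<dots> = ennreal (LINT y|goe_law TYPE('n). 2 * evcount h a b y)"
  proof (rule nn_integral_eq_integral)
    have "prob_space (goe_law TYPE('n))"
      unfolding goe_law_def[OF h] by (intro prob_space_PiM) (auto intro!: prob_space_normN add_pos_nonneg)
    then interpret prob_space "goe_law TYPE('n)" .
    show "integrable (goe_law TYPE('n)) (\<lambda>y. 2 * evcount h a b y)"
      using evcount_bounds[OF h, of a b] measurable_evcount[OF h, of a b]
      by (intro integrable_const_bound[where B = "2 * real CARD('n)"])
        (auto simp: measurable_cong_sets[OF sets_goe_law[OF h] refl] intro!: borel_measurable_times)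
    show "AE y in goe_law TYPE('n). 0 \<le> 2 * evcount h a b y"
      using evcount_bounds[OF h] by auto
  qed
  also have "(LINT y|goe_law TYPE('n). 2 * evcount h a b y) =
      2 * (LINT \<omega>|Q. (\<Sum>i<CARD('n). indicator {a..b} (ordered_eigenvalues (W \<omega>) ! i)))"
    unfolding goe_eigenvalue_mean[OF h G] by simp
  finally show ?thesis .
qed

section \<open>Compact intervals\<close>

text \<open>For large \<open>s\<close> the matrix is diagonally dominant.\<close>
lemma det_pole_hessian_nonzero:
  fixes k :: "'n::finite"
  assumes s: "s > (\<Sum>a\<in>UNIV. \<Sum>b\<in>UNIV. \<bar>(1 + of_bool (a = b)) * Y {#a, b#}\<bar>)"
  shows "det (pole_hessian k s Y) \<noteq> 0"
proof -
  define C where "C = (\<Sum>a\<in>UNIV. \<Sum>b\<in>UNIV. \<bar>(1 + of_bool (a = b)) * Y {#a, b#}\<bar> :: real)"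
  have ker: "v = 0" if v: "pole_hessian k s Y *v v = 0" for v
  proof (rule ccontr)
    assume "v \<noteq> 0"
    have row: "(\<Sum>b\<in>UNIV. pole_hessian k s Y $ a $ b * v $ b) = 0" for a
      using v by (simp add: matrix_vector_mult_def Finite_Cartesian_Product.vec_eq_iff)
    have vk: "v $ k = 0" using row[of k]
      by (simp add: pole_hessian_def if_distrib[of "\<lambda>x. x * _"] cong: if_cong)
    \<comment> \<open>In the row of an entry of \<open>v\<close> with largest modulus the diagonal
      term outweighs all others.\<close>
    have "Max (range (\<lambda>b. \<bar>v $ b\<bar>)) \<in> range (\<lambda>b. \<bar>v $ b\<bar>)" by (rule Max_in) auto
    then obtain m where "Max (range (\<lambda>b. \<bar>v $ b\<bar>)) = \<bar>v $ m\<bar>" by blast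
    then have m: "\<bar>v $ b\<bar> \<le> \<bar>v $ m\<bar>" for b using Max_ge[of "range (\<lambda>b. \<bar>v $ b\<bar>)" "\<bar>v $ b\<bar>"] by auto
    have m0: "\<bar>v $ m\<bar> > 0"
    proof (rule ccontr)
      assume "\<not> \<bar>v $ m\<bar> > 0"
      then have "v $ b = 0" for b using m[of b] by simp
      then show False using \<open>v \<noteq> 0\<close> by (simp add: Finite_Cartesian_Product.vec_eq_iff)
    qed
    then have mk: "m \<noteq> k" using vk by auto
    have "pole_hessian k s Y $ m $ b * v $ b = s * of_bool (m = b) * v $ b - (1 + of_bool (m = b)) * Y {#m, b#} * v $ b" for b
      using mk vk by (cases "b = k") (auto simp: pole_hessian_def algebra_simps)
    then have "0 = (\<Sum>b\<in>UNIV. s * of_bool (m = b) * v $ b - (1 + of_bool (m = b)) * Y {#m, b#} * v $ b)"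
      using row[of m] by simp
    also have "\<dots> = s * v $ m - (\<Sum>b\<in>UNIV. (1 + of_bool (m = b)) * Y {#m, b#} * v $ b)"
      by (simp add: sum_subtractf of_bool_def if_distrib[of "\<lambda>x. _ * x"] if_distrib[of "\<lambda>x. x * _"] cong: if_cong)
    finally have "s * v $ m = (\<Sum>b\<in>UNIV. (1 + of_bool (m = b)) * Y {#m, b#} * v $ b)" by simp
    moreover have "s * \<bar>v $ m\<bar> \<le> \<bar>s * v $ m\<bar>" by (simp add: abs_mult mult_right_mono)
    ultimately have "s * \<bar>v $ m\<bar> \<le> \<bar>\<Sum>b\<in>UNIV. (1 + of_bool (m = b)) * Y {#m, b#} * v $ b\<bar>" by simp
    also have "\<dots> \<le> (\<Sum>b\<in>UNIV. \<bar>(1 + of_bool (m = b)) * Y {#m, b#}\<bar> * \<bar>v $ m\<bar>)"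
      by (rule order_trans[OF sum_abs sum_mono]) (simp add: abs_mult m mult_left_mono)
    also have "\<dots> \<le> C * \<bar>v $ m\<bar>"
      unfolding C_def sum_distrib_right[symmetric]
      by (intro mult_right_mono member_le_sum[of m UNIV "\<lambda>a. \<Sum>b\<in>UNIV. \<bar>(1 + of_bool (a = b)) * Y {#a, b#}\<bar>"] sum_nonneg) auto
    finally have "s \<le> C" using m0 by simp
    then show False using s by (simp add: C_def)
  qed
  then have "\<exists>B. B ** pole_hessian k s Y = Finite_Cartesian_Product.mat 1"
    by (subst matrix_left_invertible_ker) blast
  then show ?thesis using invertible_det_nz invertible_left_inverse by blast
qed

lemma AE_lborel_ex:
  fixes a b :: real
  assumes "AE x in lborel. P x" "a < b"
  shows "\<exists>x. a < x \<and> x < b \<and> P x"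
proof (rule ccontr)
  assume "\<not> ?thesis"
  then have "AE x in lborel. x \<notin> {a<..<b}" using assms(1) by (auto elim!: eventually_mono)
  then have "emeasure lborel {a<..<b} = 0"
    by (subst (asm) AE_iff_measurable[where N = "{a<..<b}"]) auto
  then show False using assms(2) by simp
qed

text \<open>This allows the comparison with \<open>p = 2\<close> to be divided by the integral of the density.\<close>
lemma kdens_pos:
  fixes k :: "'n::finite"
  shows "\<exists>n::nat. (\<integral>\<^sup>+t\<in>{- real n..real n}. kdens 2 k t \<partial>lborel) \<noteq> 0"
proof (rule ccontr)
  assume "\<not> ?thesis"
  then have "AE t in lborel. kdens 2 k t * indicator {- real n..real n} t = 0" for n :: nat
    by (subst nn_integral_0_iff_AE[symmetric]) auto
  then have "AE t in lborel. \<forall>n::nat. kdens 2 k t * indicator {- real n..real n} t = 0"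
    unfolding AE_all_countable by blast
  then have ae: "AE t in lborel. kdens 2 k t = 0"
  proof (rule eventually_mono)
    fix t :: real
    assume 0: "\<forall>n::nat. kdens 2 k t * indicator {- real n..real n} t = 0"
    obtain n :: nat where "\<bar>t\<bar> \<le> real n" using real_arch_simple by blast
    then show "kdens 2 k t = 0" using 0[rule_format, of n] by (auto simp: indicator_def abs_le_iff split: if_splits)
  qed
  \<comment> \<open>If the density vanished almost everywhere, the mean determinant would vanish for
    a sequence of multipliers tending to infinity. Off one null set all of these would make the
    matrix singular, against diagonal dominance.\<close>
  have "\<exists>t. real n < t \<and> detmean 2 k (2 * t) = 0" for n
  proof -
    obtain t where t: "real n < t" "kdens 2 k t = 0"
      using AE_lborel_ex[OF ae, of "real n" "real n + 1"] by auto
    have "std_normal_density t * (1 / sqrt (2 * pi * real 2)) ^ (CARD('n) - 1) > 0"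
      by (simp add: normal_density_pos)
    then show ?thesis using t kdens_eq[of 2 k t] by (auto simp: ennreal_eq_0_iff)
  qed
  then obtain t where t: "\<And>n. real n < t n" "\<And>n. detmean 2 k (2 * t n) = 0" by metis
  let ?P = "PiM (K2 k) (grpN 2 k)"
  interpret prob_space ?P by (intro prob_space_PiM prob_space_grpN)
  have s: "sets ?P = sets (PiM (K2 k) (\<lambda>_. borel))" by (intro sets_PiM_cong) auto
  have dm: "(\<lambda>w. det (pole_hessian k s w)) \<in> borel_measurable ?P" for s
    unfolding measurable_cong_sets[OF s refl] by (intro measurable_pole_hessian measurable_component_singleton)
  have "AE Y in ?P. det (pole_hessian k (2 * t n) Y) = 0" for n
  proof -
    have "AE Y in ?P. ennreal \<bar>det (pole_hessian k (2 * t n) Y)\<bar> = 0"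
      using t(2)[of n] dm[of "2 * t n"] unfolding detmean_def by (subst nn_integral_0_iff_AE[symmetric]) auto
    then show ?thesis by (simp add: ennreal_eq_0_iff)
  qed
  then have "AE Y in ?P. \<forall>n. det (pole_hessian k (2 * t n) Y) = 0" by (simp add: AE_all_countable)
  then have "AE Y in ?P. False"
  proof (rule eventually_mono)
    fix Y assume 0: "\<forall>n. det (pole_hessian k (2 * t n) Y) = 0"
    let ?C = "\<Sum>a\<in>UNIV. \<Sum>b\<in>UNIV. \<bar>(1 + of_bool (a = b)) * Y {#a, b#}\<bar>"
    obtain n :: nat where "?C \<le> real n" using real_arch_simple by blast
    then have "?C < 2 * t n" using t(1)[of n] by simp
    from det_pole_hessian_nonzero[OF this, of k] show False using 0 by simp
  qed
  then show False by simp
qed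

text \<open>The proportionality is evaluated against one reference, \<open>p = 2\<close> on an
  interval where its density has positive integral. The quotient there serves as the constant, which
  is therefore common to all \<open>p\<close>, \<open>a\<close> and \<open>b\<close>.\<close>

proposition Ecrit_eq_kdens:
  obtains c where "c \<noteq> \<infinity>" "\<And>p a b. p \<ge> 2 \<Longrightarrow> Ecrit p TYPE('n::{finite,wellorder}) {a..b} =
    c * (\<integral>\<^sup>+t\<in>{a..b}. kdens p (undefined :: 'n) t \<partial>lborel)"
proof -
  let ?k = "undefined :: 'n"
  obtain n :: nat where n: "(\<integral>\<^sup>+t\<in>{- real n..real n}. kdens 2 ?k t \<partial>lborel) \<noteq> 0"
    using kdens_pos by blast
  define d where "d = (\<integral>\<^sup>+t\<in>{- real n..real n}. kdens 2 ?k t \<partial>lborel)"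
  have d: "d \<noteq> 0" "d < \<infinity>" using n kdens_integral_finite unfolding d_def by blast+
  define E where "E = Ecrit 2 TYPE('n) {- real n..real n}"
  have E: "E < \<infinity>" unfolding E_def by (rule Ecrit_finite) simp
  show ?thesis
  proof (rule that[of "E / d"])
    show "E / d \<noteq> \<infinity>" using E d by (auto simp: divide_ennreal_def ennreal_mult_eq_top_iff)
  next
    fix p :: nat and a b :: real assume p: "p \<ge> 2"
    have "Ecrit p TYPE('n) {a..b} * d = E * (\<integral>\<^sup>+t\<in>{a..b}. kdens p ?k t \<partial>lborel)"
      unfolding d_def E_def by (rule Ecrit_kdens_proportional[OF p]) simp
    then have "Ecrit p TYPE('n) {a..b} * d / d = E * (\<integral>\<^sup>+t\<in>{a..b}. kdens p ?k t \<partial>lborel) / d" by simp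
    moreover have "Ecrit p TYPE('n) {a..b} * d / d = Ecrit p TYPE('n) {a..b}"
      using d by (simp add: ennreal_mult_divide_eq)
    ultimately show "Ecrit p TYPE('n) {a..b} = E / d * (\<integral>\<^sup>+t\<in>{a..b}. kdens p ?k t \<partial>lborel)"
      by (simp add: divide_ennreal_def mult_ac)
  qed
qed

text \<open>\<open>\<rho>\<close> is given only through its integrals, so its sign is extracted by
  testing with the indicator of the set where it is negative.\<close>

lemma mean_spectral_density_nonneg:
  assumes R: "mean_spectral_density N Q W \<rho>"
  shows "AE x in lborel. 0 \<le> \<rho> x"
proof -
  have int: "integrable lborel \<rho>" using R by (simp add: mean_spectral_density_def)
  have [measurable]: "\<rho> \<in> borel_measurable borel" using int by auto
  define A where "A = {x. \<rho> x < 0}"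
  have A: "A \<in> sets borel" unfolding A_def by measurable
  have b: "bounded (range (indicator A :: real \<Rightarrow> real))"
    by (rule boundedI[of _ 1]) (auto simp: indicator_def)
  have "(LINT x|lborel. indicator A x * \<rho> x) =
    1 / real N * (LINT \<omega>|Q. (\<Sum>i<N. indicator A (ordered_eigenvalues (W \<omega>) ! i)))"
    using R A b by (simp add: mean_spectral_density_def)
  also have "\<dots> \<ge> 0" by (intro mult_nonneg_nonneg integral_nonneg_AE AE_I2 sum_nonneg) auto
  finally have "0 \<le> (LINT x|lborel. indicator A x * \<rho> x)" .
  moreover have i: "integrable lborel (\<lambda>x. indicator A x * \<rho> x)"
    using integrable_mult_indicator[OF _ int, of A] A by simp
  moreover have nn: "0 \<le> - (indicator A x * \<rho> x)" for x by (auto simp: A_def indicator_def)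
  ultimately have "(LINT x|lborel. - (indicator A x * \<rho> x)) = 0"
    using integral_nonneg_AE[where M = lborel and f = "\<lambda>x. - (indicator A x * \<rho> x)"] by simp
  then have "AE x in lborel. - (indicator A x * \<rho> x) = 0"
    using integral_nonneg_eq_0_iff_AE[where M = lborel and f = "\<lambda>x. - (indicator A x * \<rho> x)"] i nn by simp
  then show ?thesis by (rule eventually_mono) (auto simp: A_def indicator_def split: if_splits)
qed

lemma spectral_density_interval:
  assumes G: "GOE CARD('n::{finite,wellorder}) Q W" and R: "mean_spectral_density CARD('n) Q W \<rho>"
  shows "Ecrit 2 TYPE('n) ((\<lambda>b. sqrt (real CARD('n)) * b) ` {a..b}) =
    ennreal (2 * real CARD('n)) * (\<integral>\<^sup>+x\<in>{a..b}. ennreal (\<rho> x) \<partial>lborel)"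
proof -
  let ?N = "real CARD('n)"
  have int: "integrable lborel \<rho>" using R by (simp add: mean_spectral_density_def)
  have b: "bounded (range (indicator {a..b} :: real \<Rightarrow> real))"
    by (rule boundedI[of _ 1]) (auto simp: indicator_def)
  have "(\<integral>\<^sup>+x\<in>{a..b}. ennreal (\<rho> x) \<partial>lborel) = (\<integral>\<^sup>+x. ennreal (indicator {a..b} x * \<rho> x) \<partial>lborel)"
    by (intro nn_integral_cong) (auto simp: indicator_def)
  also have "\<dots> = ennreal (LINT x|lborel. indicator {a..b} x * \<rho> x)"
  proof (rule nn_integral_eq_integral)
    show "integrable lborel (\<lambda>x. indicator {a..b} x * \<rho> x)"
      using integrable_mult_indicator[OF _ int, of "{a..b}"] by simp
    show "AE x in lborel. 0 \<le> indicator {a..b} x * \<rho> x"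
      using mean_spectral_density_nonneg[OF R] by (rule eventually_mono) auto
  qed
  also have "(LINT x|lborel. indicator {a..b} x * \<rho> x) =
    1 / ?N * (LINT \<omega>|Q. (\<Sum>i<CARD('n). indicator {a..b} (ordered_eigenvalues (W \<omega>) ! i)))"
    using R b by (simp add: mean_spectral_density_def)
  finally show ?thesis
    unfolding Ecrit_2_GOE[OF G] by (simp add: ennreal_mult'[symmetric])
qed

definition crt_density :: "nat \<Rightarrow> nat \<Rightarrow> real \<Rightarrow> real" where
  "crt_density N p x = 2 * real N * sqrt (2 / real p) * (real p - 1) powr (real N / 2) *
     exp (- (real N * (real p - 2) * x\<^sup>2 / (2 * real p)))"

lemma borel_crt_density [measurable]: "crt_density N p \<in> borel_measurable borel"
  unfolding crt_density_def by measurable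

lemma crt_density_nonneg: "p \<ge> 2 \<Longrightarrow> 0 \<le> crt_density N p x"
  unfolding crt_density_def by (intro mult_nonneg_nonneg) auto

text \<open>The case \<open>p = 2\<close> on all intervals identifies \<open>\<rho>\<close> with a
  multiple of the rescaled density \<open>w\<close>. Expressing the density for \<open>p\<close> by
  the one for 2 and substituting \<open>y = s x\<close> turns the mean into an integral against
  \<open>\<rho>\<close>, with the unknown constant absorbed in it.\<close>

proposition Ecrit_interval:
  assumes p: "p \<ge> 2"
    and G: "GOE CARD('n::{finite,wellorder}) Q W" and R: "mean_spectral_density CARD('n) Q W \<rho>"
  defines "s \<equiv> sqrt (real p / (2 * (real p - 1)))"
  shows "Ecrit p TYPE('n) ((\<lambda>b. sqrt (real CARD('n)) * b) ` {a..b}) =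
    (\<integral>\<^sup>+y. ennreal (crt_density CARD('n) p y) * ennreal (\<rho> y) * indicator {a..b} (y / s) \<partial>lborel)"
proof -
  define N where "N = real CARD('n)"
  define q where "q = sqrt N"
  have N: "N > 0" and q: "q > 0" "q * q = N" by (auto simp: N_def q_def)
  have p1: "real p - 1 > 0" using p by simp
  have s: "s > 0" using p by (simp add: s_def)
  have s2: "s\<^sup>2 = real p / (2 * (real p - 1))" using p by (simp add: s_def)
  obtain c where c: "c \<noteq> \<infinity>" "\<And>p a b. p \<ge> 2 \<Longrightarrow> Ecrit p TYPE('n) {a..b} =
    c * (\<integral>\<^sup>+t\<in>{a..b}. kdens p (undefined :: 'n) t \<partial>lborel)"
    using Ecrit_eq_kdens[where 'n = 'n] by blast
  have img: "(\<lambda>b. sqrt (real CARD('n)) * b) ` {a..b} = {q * a..q * b}" for a b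
    using image_mult_atLeastAtMost[OF q(1), of a b] by (simp add: q_def N_def)
  define w where "w = kdens 2 (undefined :: 'n)"
  \<comment> \<open>The value of \<open>\<rho>\<close> almost everywhere according to the case
    \<open>p = 2\<close>: \<open>q\<close> is the scale of the energy, and \<open>2 * N\<close>
    stems from two eigenvectors per eigenvalue and the average over \<open>N\<close>
    eigenvalues.\<close>
  define r where "r = (\<lambda>x. ennreal (q / (2 * N)) * c * w (q * x))"
  have [measurable]: "w \<in> borel_measurable borel" "r \<in> borel_measurable borel" unfolding w_def r_def by measurable
  have [measurable]: "\<rho> \<in> borel_measurable borel" using R by (auto simp: mean_spectral_density_def)
  have E: "Ecrit p TYPE('n) ((\<lambda>b. sqrt (real CARD('n)) * b) ` {a..b}) =
    ennreal q * c * (\<integral>\<^sup>+x\<in>{a..b}. kdens p (undefined :: 'n) (q * x) \<partial>lborel)" if "p \<ge> 2" for p a b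
  proof -
    have "(\<integral>\<^sup>+t\<in>{q * a..q * b}. kdens p (undefined :: 'n) t \<partial>lborel) =
      ennreal q * (\<integral>\<^sup>+x. kdens p (undefined :: 'n) (0 + q * x) * indicator {q * a..q * b} (0 + q * x) \<partial>lborel)"
      using q by (subst nn_integral_real_affine[where c = q and t = 0]) auto
    also have "(\<lambda>x. kdens p (undefined :: 'n) (0 + q * x) * indicator {q * a..q * b} (0 + q * x)) =
      (\<lambda>x. kdens p (undefined :: 'n) (q * x) * indicator {a..b} x)"
      using q by (auto simp: indicator_def)
    finally show ?thesis unfolding img c(2)[OF that] by (simp add: mult_ac)
  qed
  have eq: "density lborel (\<lambda>x. ennreal (\<rho> x)) = density lborel r"
  proof (rule measure_eqI_generator_eq[where \<Omega> = UNIV and E = "range (\<lambda>(a, b). {a..b})" and A = "\<lambda>n::nat. {- real n..real n}"])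
    have iv: "emeasure (density lborel (\<lambda>x. ennreal (\<rho> x))) {a..b} = emeasure (density lborel r) {a..b}" for a b
    proof -
      have m: "ennreal (2 * N) * (\<integral>\<^sup>+x\<in>{a..b}. ennreal (\<rho> x) \<partial>lborel) = ennreal q * c * (\<integral>\<^sup>+x\<in>{a..b}. w (q * x) \<partial>lborel)"
        using spectral_density_interval[OF G R, of a b] E[of 2 a b] by (simp add: N_def w_def)
      have f: "ennreal (1 / (2 * N)) * ennreal (2 * N) = 1" "ennreal (1 / (2 * N)) * ennreal q = ennreal (q / (2 * N))"
        using N q by (simp_all add: ennreal_mult'[symmetric])
      have "(\<integral>\<^sup>+x\<in>{a..b}. ennreal (\<rho> x) \<partial>lborel) =
        ennreal (1 / (2 * N)) * (ennreal (2 * N) * (\<integral>\<^sup>+x\<in>{a..b}. ennreal (\<rho> x) \<partial>lborel))"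
        unfolding mult.assoc[symmetric] f by simp
      also have "\<dots> = ennreal (1 / (2 * N)) * (ennreal q * c * (\<integral>\<^sup>+x\<in>{a..b}. w (q * x) \<partial>lborel))"
        by (simp only: m)
      also have "\<dots> = ennreal (q / (2 * N)) * c * (\<integral>\<^sup>+x\<in>{a..b}. w (q * x) \<partial>lborel)"
        unfolding mult.assoc[symmetric] f ..
      also have "\<dots> = (\<integral>\<^sup>+x\<in>{a..b}. r x \<partial>lborel)"
        unfolding r_def mult.assoc by (simp add: nn_integral_cmult)
      finally show ?thesis by (simp add: emeasure_density)
    qed
    then show "emeasure (density lborel (\<lambda>x. ennreal (\<rho> x))) X = emeasure (density lborel r) X"
      if "X \<in> range (\<lambda>(a, b). {a..b})" for X using that by auto
    show "Int_stable (range (\<lambda>(a, b). {a..b} :: real set))"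
      by (auto simp: Int_stable_def Int_atLeastAtMost)
    show "sets (density lborel (\<lambda>x. ennreal (\<rho> x))) = sigma_sets UNIV (range (\<lambda>(a, b). {a..b}))"
      "sets (density lborel r) = sigma_sets UNIV (range (\<lambda>(a, b). {a..b}))"
      by (simp_all add: borel_eq_atLeastAtMost)
    show "(\<Union>n::nat. {- real n..real n}) = UNIV"
    proof -
      have "\<exists>n::nat. x \<in> {- real n..real n}" for x :: real
      proof -
        obtain n :: nat where "\<bar>x\<bar> \<le> real n" using real_arch_simple by blast
        then have "x \<in> {- real n..real n}" unfolding atLeastAtMost_iff by linarith
        then show ?thesis by blast
      qed
      then show ?thesis by blast
    qed
    show "emeasure (density lborel (\<lambda>x. ennreal (\<rho> x))) {- real n..real n} \<noteq> \<infinity>" for n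
    proof -
      have "(\<integral>\<^sup>+x. ennreal (\<rho> x) * indicator {- real n..real n} x \<partial>lborel) \<le> (\<integral>\<^sup>+x. ennreal (norm (\<rho> x)) \<partial>lborel)"
        by (intro nn_integral_mono) (auto simp: indicator_def ennreal_leI)
      also have "\<dots> < \<infinity>" using R by (simp add: mean_spectral_density_def integrable_iff_bounded)
      finally show ?thesis by (simp add: emeasure_density)
    qed
  qed auto
  define K where "K = sqrt (real p - 1) ^ (CARD('n) - 1)"
  have K0: "K \<ge> 0" unfolding K_def using p1 by simp
  define g where "g = (\<lambda>y. ennreal (2 * N * (K * exp ((s\<^sup>2 - 1) * (q * (y / s))\<^sup>2 / 2))) * indicator {a..b} (y / s))"
  have [measurable]: "g \<in> borel_measurable borel" unfolding g_def by measurable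
  have "Ecrit p TYPE('n) ((\<lambda>b. sqrt (real CARD('n)) * b) ` {a..b}) =
    (\<integral>\<^sup>+x. ennreal q * c * (kdens p (undefined :: 'n) (q * x) * indicator {a..b} x) \<partial>lborel)"
    unfolding E[OF p] by (rule nn_integral_cmult[symmetric]) measurable
  also have "\<dots> = (\<integral>\<^sup>+x. g (s * x) * r (s * x) \<partial>lborel)"
  proof (rule nn_integral_cong)
    fix x
    have k: "kdens p (undefined :: 'n) (q * x) = ennreal (K * exp ((s\<^sup>2 - 1) * (q * x)\<^sup>2 / 2)) * w (s * (q * x))"
      unfolding K_def w_def s_def by (rule kdens_scale[OF p])
    have rr: "ennreal q * c * w (s * (q * x)) = ennreal (2 * N) * r (s * x)"
    proof -
      have "ennreal (2 * N) * ennreal (q / (2 * N)) = ennreal q" using N q by (simp add: ennreal_mult'[symmetric])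
      then show ?thesis unfolding r_def by (metis mult.assoc mult.left_commute)
    qed
    have "ennreal q * c * (kdens p (undefined :: 'n) (q * x) * indicator {a..b} x) =
      ennreal (K * exp ((s\<^sup>2 - 1) * (q * x)\<^sup>2 / 2)) * indicator {a..b} x * (ennreal q * c * w (s * (q * x)))"
      unfolding k by (simp add: mult_ac)
    also have "\<dots> = ennreal (2 * N) * ennreal (K * exp ((s\<^sup>2 - 1) * (q * x)\<^sup>2 / 2)) * indicator {a..b} x * r (s * x)"
      unfolding rr by (simp add: mult_ac)
    also have "\<dots> = g (s * x) * r (s * x)"
      using s N K0 by (simp add: g_def ennreal_mult'[symmetric])
    finally show "ennreal q * c * (kdens p (undefined :: 'n) (q * x) * indicator {a..b} x) = g (s * x) * r (s * x)" .
  qed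
  also have "\<dots> = ennreal (1 / s) * (\<integral>\<^sup>+y. g y * r y \<partial>lborel)"
  proof -
    have "(\<integral>\<^sup>+y. g y * r y \<partial>lborel) = ennreal s * (\<integral>\<^sup>+x. g (s * x) * r (s * x) \<partial>lborel)"
      using s by (subst nn_integral_real_affine[where c = s and t = 0]) auto
    then have "ennreal (1 / s) * (\<integral>\<^sup>+y. g y * r y \<partial>lborel) = (ennreal (1 / s) * ennreal s) * (\<integral>\<^sup>+x. g (s * x) * r (s * x) \<partial>lborel)"
      by (simp add: mult.assoc)
    also have "ennreal (1 / s) * ennreal s = 1" using s by (simp add: ennreal_mult'[symmetric])
    finally show ?thesis by simp
  qed
  also have "(\<integral>\<^sup>+y. g y * r y \<partial>lborel) = (\<integral>\<^sup>+y. g y \<partial>density lborel r)"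
    by (subst nn_integral_density) (auto simp: mult.commute)
  also have "\<dots> = (\<integral>\<^sup>+y. ennreal (\<rho> y) * g y \<partial>lborel)"
    unfolding eq[symmetric] by (subst nn_integral_density) auto
  also have "ennreal (1 / s) * \<dots> = (\<integral>\<^sup>+y. ennreal (1 / s) * (ennreal (\<rho> y) * g y) \<partial>lborel)"
    by (rule nn_integral_cmult[symmetric]) measurable
  also have "\<dots> = (\<integral>\<^sup>+y. ennreal (crt_density CARD('n) p y) * ennreal (\<rho> y) * indicator {a..b} (y / s) \<partial>lborel)"
  proof (rule nn_integral_cong)
    fix y
    \<comment> \<open>Since 1 / s^2 = 2 (p - 1) / p, the quotient (s^2 - 1) / s^2 equals - (p - 2) /
      p.\<close>
    have e: "(s\<^sup>2 - 1) * (q * (y / s))\<^sup>2 / 2 = - (N * (real p - 2) * y\<^sup>2 / (2 * real p))"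
    proof -
      have "(s\<^sup>2 - 1) * (q * (y / s))\<^sup>2 / 2 = (s\<^sup>2 - 1) / s\<^sup>2 * (N * y\<^sup>2) / 2"
        using s q by (simp add: power_mult_distrib power_divide power2_eq_square)
      also have "(s\<^sup>2 - 1) / s\<^sup>2 = - (real p - 2) / real p"
        unfolding s2 using p p1 by (simp add: field_simps)
      also have "- (real p - 2) / real p * (N * y\<^sup>2) / 2 = - (N * (real p - 2) * y\<^sup>2 / (2 * real p))"
        by (simp only: minus_divide_left[symmetric] mult_minus_left) (simp add: mult_ac)
      finally show ?thesis .
    qed
    \<comment> \<open>The factor sqrt (p - 1) in \<open>1 / s\<close> raises the exponent
      \<open>CARD('n) - 1\<close> in \<open>K\<close> to \<open>CARD('n)\<close>.\<close>
    have k: "1 / s * K = sqrt (2 / real p) * (real p - 1) powr (N / 2)"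
    proof -
      have "1 / s = sqrt (2 / real p) * sqrt (real p - 1)"
        unfolding s_def real_sqrt_mult[symmetric] using p p1 by (simp add: real_sqrt_divide real_sqrt_mult)
      moreover have "sqrt (real p - 1) * K = sqrt (real p - 1) ^ CARD('n)"
        unfolding K_def by (metis card_gt_0_iff finite finite_UNIV_card_ge_0 power_eq_if less_not_refl UNIV_not_empty)
      moreover have "sqrt (real p - 1) ^ CARD('n) = (real p - 1) powr (N / 2)"
      proof -
        have "(real p - 1) powr (N / 2) = ((real p - 1) powr (1 / 2)) powr N" by (simp add: powr_powr)
        also have "\<dots> = sqrt (real p - 1) ^ CARD('n)"
          using p1 by (simp add: powr_half_sqrt N_def powr_realpow)
        finally show ?thesis ..
      qed
      ultimately show ?thesis by (simp add: mult.assoc)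
    qed
    have "1 / s * (2 * N * (K * exp ((s\<^sup>2 - 1) * (q * (y / s))\<^sup>2 / 2))) = crt_density CARD('n) p y"
    proof -
      have "1 / s * (2 * N * (K * exp ((s\<^sup>2 - 1) * (q * (y / s))\<^sup>2 / 2))) =
        2 * N * (1 / s * K) * exp ((s\<^sup>2 - 1) * (q * (y / s))\<^sup>2 / 2)" by simp
      then show ?thesis unfolding k e crt_density_def N_def by (simp add: mult.assoc)
    qed
    then have "ennreal (1 / s) * ennreal (2 * N * (K * exp ((s\<^sup>2 - 1) * (q * (y / s))\<^sup>2 / 2))) = ennreal (crt_density CARD('n) p y)"
      using s by (simp only: ennreal_mult'[symmetric] zero_le_divide_1_iff less_imp_le)
    moreover have "ennreal (1 / s) * (ennreal (\<rho> y) * g y) =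
      (ennreal (1 / s) * ennreal (2 * N * (K * exp ((s\<^sup>2 - 1) * (q * (y / s))\<^sup>2 / 2)))) * ennreal (\<rho> y) * indicator {a..b} (y / s)"
      unfolding g_def by (simp only: mult_ac)
    ultimately show "ennreal (1 / s) * (ennreal (\<rho> y) * g y) =
      ennreal (crt_density CARD('n) p y) * ennreal (\<rho> y) * indicator {a..b} (y / s)"
      by simp
  qed
  finally show ?thesis .
qed

section \<open>Borel sets\<close>

text \<open>The sets whose mass has a measurable version with the right mean form a Dynkin class
  containing the closed intervals. A version \<open>g\<close> is carried along because measurability
  is assumed on intervals and the measures are finite only almost surely, so that the step to
  complements holds off a null set.\<close>

lemma mean_measure_interval_extend:
  fixes F :: "'a \<Rightarrow> real measure" and \<nu> :: "real measure"
  assumes sF: "\<And>\<omega>. sets (F \<omega>) = sets borel" and s\<nu>: "sets \<nu> = sets borel"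
    and meas: "\<And>a b. (\<lambda>\<omega>. emeasure (F \<omega>) {a..b}) \<in> borel_measurable M"
    and eq: "\<And>a b. (\<integral>\<^sup>+\<omega>. emeasure (F \<omega>) {a..b} \<partial>M) = emeasure \<nu> {a..b}"
    and finF: "AE \<omega> in M. finite_measure (F \<omega>)" and fin\<nu>: "finite_measure \<nu>"
    and B: "B \<in> sets borel"
  shows "\<exists>g\<in>borel_measurable M. (AE \<omega> in M. emeasure (F \<omega>) B = g \<omega>) \<and> (\<integral>\<^sup>+\<omega>. g \<omega> \<partial>M) = emeasure \<nu> B"
proof -
  define P where "P B \<longleftrightarrow>
    (\<exists>g\<in>borel_measurable M. (AE \<omega> in M. emeasure (F \<omega>) B = g \<omega>) \<and> (\<integral>\<^sup>+\<omega>. g \<omega> \<partial>M) = emeasure \<nu> B)" for B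
  have spF: "space (F \<omega>) = UNIV" for \<omega> using sets_eq_imp_space_eq[OF sF] by simp
  have sp\<nu>: "space \<nu> = UNIV" using sets_eq_imp_space_eq[OF s\<nu>] by simp
  \<comment> \<open>The whole line, as an increasing limit of intervals, comes first because
    complements are taken relative to its mass.\<close>
  have P_UNIV: "P UNIV"
  proof -
    let ?I = "\<lambda>n::nat. {- real n..real n}"
    have U: "(\<Union>n. ?I n) = UNIV"
    proof (intro Set.set_eqI iffI UNIV_I)
      fix x :: real
      obtain n where "\<bar>x\<bar> \<le> real n" using real_arch_simple by blast
      then show "x \<in> (\<Union>n. ?I n)" by (intro UN_I[of n]) auto
    qed
    have inc: "incseq ?I" by (auto simp: incseq_def)
    have sup: "(SUP n. emeasure \<mu> (?I n)) = emeasure \<mu> UNIV" if "sets \<mu> = sets borel" for \<mu>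
      using SUP_emeasure_incseq[OF _ inc, of \<mu>] U that by (auto simp: image_subset_iff)
    have "(\<integral>\<^sup>+\<omega>. (SUP n. emeasure (F \<omega>) (?I n)) \<partial>M) = (SUP n. \<integral>\<^sup>+\<omega>. emeasure (F \<omega>) (?I n) \<partial>M)"
      using inc sF by (intro nn_integral_monotone_convergence_SUP meas)
        (auto simp: incseq_def le_fun_def intro!: emeasure_mono)
    moreover have "(\<lambda>\<omega>. SUP n. emeasure (F \<omega>) (?I n)) \<in> borel_measurable M"
      by (intro borel_measurable_SUP meas) auto
    ultimately show ?thesis
      unfolding P_def using sup[OF s\<nu>] sup[OF sF] eq
      by (intro bexI[of _ "\<lambda>\<omega>. SUP n. emeasure (F \<omega>) (?I n)"]) auto
  qed
  from B have "P B"
  proof (induction rule: borel_set_induct)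
    case empty
    then show ?case unfolding P_def by (intro bexI[of _ "\<lambda>_. 0"]) auto
  next
    case (interval a b)
    then show ?case unfolding P_def using eq meas by (intro bexI[of _ "\<lambda>\<omega>. emeasure (F \<omega>) {a..b}"]) auto
  next
    case (compl A)
    from P_UNIV obtain u where u: "u \<in> borel_measurable M" "AE \<omega> in M. emeasure (F \<omega>) UNIV = u \<omega>"
      "(\<integral>\<^sup>+\<omega>. u \<omega> \<partial>M) = emeasure \<nu> UNIV" unfolding P_def by auto
    from compl obtain g where g: "g \<in> borel_measurable M" "AE \<omega> in M. emeasure (F \<omega>) A = g \<omega>"
      "(\<integral>\<^sup>+\<omega>. g \<omega> \<partial>M) = emeasure \<nu> A" unfolding P_def by auto
    have c: "emeasure \<mu> (- A) = emeasure \<mu> UNIV - emeasure \<mu> A"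
      if "finite_measure \<mu>" "sets \<mu> = sets borel" for \<mu>
      using emeasure_compl[of A \<mu>] finite_measure.emeasure_finite[OF that(1)] that(2) compl.hyps
        sets_eq_imp_space_eq[OF that(2)] by (simp add: Compl_eq_Diff_UNIV)
    have "AE \<omega> in M. emeasure (F \<omega>) (- A) = u \<omega> - g \<omega>"
      using u(2) g(2) finF by eventually_elim (use c sF in auto)
    moreover have "AE \<omega> in M. g \<omega> \<le> u \<omega>"
      using u(2) g(2)
    proof eventually_elim
      case (elim \<omega>)
      then show ?case using emeasure_mono[of A UNIV "F \<omega>"] sF[of \<omega>] sets.top[of "F \<omega>"] spF by auto
    qed
    then have "(\<integral>\<^sup>+\<omega>. u \<omega> - g \<omega> \<partial>M) = emeasure \<nu> (- A)"
      using nn_integral_diff[OF u(1) g(1)] u(3) g(3) c[OF fin\<nu> s\<nu>] finite_measure.emeasure_finite[OF fin\<nu>]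
      by auto
    ultimately show ?case unfolding P_def using u(1) g(1)
      by (intro bexI[of _ "\<lambda>\<omega>. u \<omega> - g \<omega>"]) auto
  next
    case (union A)
    then have "\<forall>i. \<exists>g\<in>borel_measurable M. (AE \<omega> in M. emeasure (F \<omega>) (A i) = g \<omega>) \<and>
      (\<integral>\<^sup>+\<omega>. g \<omega> \<partial>M) = emeasure \<nu> (A i)" unfolding P_def by auto
    then obtain g where g: "\<And>i. g i \<in> borel_measurable M" "\<And>i. AE \<omega> in M. emeasure (F \<omega>) (A i) = g i \<omega>"
      "\<And>i. (\<integral>\<^sup>+\<omega>. g i \<omega> \<partial>M) = emeasure \<nu> (A i)" by metis
    have s: "(\<Sum>i. emeasure \<mu> (A i)) = emeasure \<mu> (\<Union>i. A i)" if "sets \<mu> = sets borel" for \<mu>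
      using union.hyps that by (intro suminf_emeasure) auto
    have "AE \<omega> in M. \<forall>i. emeasure (F \<omega>) (A i) = g i \<omega>" using g(2) by (simp add: AE_all_countable)
    then have "AE \<omega> in M. emeasure (F \<omega>) (\<Union>i. A i) = (\<Sum>i. g i \<omega>)"
      by (rule eventually_mono) (use s[OF sF, symmetric] in auto)
    moreover have "(\<integral>\<^sup>+\<omega>. (\<Sum>i. g i \<omega>) \<partial>M) = emeasure \<nu> (\<Union>i. A i)"
      using g(1,3) s[OF s\<nu>] by (simp add: nn_integral_suminf)
    ultimately show ?case unfolding P_def using g(1)
      by (intro bexI[of _ "\<lambda>\<omega>. \<Sum>i. g i \<omega>"]) auto
  qed
  then show ?thesis unfolding P_def .
qed

text \<open>\<open>F J\<close> counts the critical points by their energies divided by sqrt N, and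
  \<open>\<nu>\<close> is the claimed mean measure. Their agreement on intervals, with the almost
  sure finiteness of the critical set, extends to Borel sets.\<close>

proposition cnt_crit_gam_Borel:
  assumes p: "p \<ge> 2"
    and G: "GOE CARD('n::{finite,wellorder}) Q W" and R: "mean_spectral_density CARD('n) Q W \<rho>"
    and B: "B \<in> sets borel"
  defines "s \<equiv> sqrt (real p / (2 * (real p - 1)))"
  shows "\<exists>g\<in>borel_measurable (gam p).
    (AE J in gam p. cnt (crit p J ((\<lambda>b. sqrt (real CARD('n)) * b) ` B) :: (real^'n::_) set) = g J) \<and>
    (\<integral>\<^sup>+J. g J \<partial>gam p) = ennreal (LINT x : (\<lambda>x. s * x) ` B | lborel. crt_density CARD('n) p x * \<rho> x)"
proof -
  define c where "c = sqrt (real CARD('n))"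
  have c: "c > 0" by (simp add: c_def)
  have s: "s > 0" using p by (simp add: s_def)
  let ?C = "\<lambda>J B. crit p J ((\<lambda>b. c * b) ` B) :: (real^'n::_) set"
  define h where "h = (\<lambda>x. crt_density CARD('n) p x * \<rho> x)"
  have int: "integrable lborel \<rho>" using R by (simp add: mean_spectral_density_def)
  then have [measurable]: "\<rho> \<in> borel_measurable borel" by simp
  have [measurable]: "h \<in> borel_measurable borel" unfolding h_def by measurable
  have hint: "integrable lborel h"
  proof (rule Bochner_Integration.integrable_bound)
    \<comment> \<open>The exponential is at most 1, so \<open>h\<close> inherits integrability from
      \<open>\<rho>\<close>.\<close>
    define K where "K = 2 * real CARD('n) * sqrt (2 / real p) * (real p - 1) powr (real CARD('n) / 2)"
    show "integrable lborel (\<lambda>x. K * \<rho> x)" using int by simp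
    have "crt_density CARD('n) p x \<le> \<bar>K\<bar>" for x
    proof -
      have "0 \<le> K" using p unfolding K_def by (intro mult_nonneg_nonneg) auto
      then show ?thesis unfolding crt_density_def K_def[symmetric] using p by (simp add: mult_left_le)
    qed
    then show "AE x in lborel. norm (h x) \<le> norm (K * \<rho> x)"
      using crt_density_nonneg[OF p] by (auto simp: h_def abs_mult intro!: mult_right_mono)
  qed simp
  have hnn: "AE x in lborel. 0 \<le> h x"
    using mean_spectral_density_nonneg[OF R] crt_density_nonneg[OF p] by (auto simp: h_def elim!: eventually_mono)
  define \<nu> where "\<nu> = distr (density lborel (\<lambda>x. ennreal (h x))) borel (\<lambda>x. x / s)"
  have \<nu>: "emeasure \<nu> B = (\<integral>\<^sup>+x. ennreal (h x) * indicator B (x / s) \<partial>lborel)" if "B \<in> sets borel" for B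
  proof -
    have "(\<lambda>x. x / s) -` B \<in> sets borel"
      by (rule measurable_sets_borel[OF _ that]) measurable
    then show ?thesis
      using that unfolding \<nu>_def
      by (subst emeasure_distr) (auto simp: emeasure_density indicator_def intro!: nn_integral_cong)
  qed
  have \<nu>_int: "emeasure \<nu> B = ennreal (LINT x : (\<lambda>x. s * x) ` B | lborel. h x)" if B: "B \<in> sets borel" for B
  proof -
    have im: "indicator B (x / s) = (indicator ((\<lambda>x. s * x) ` B) x :: real)" for x
      using s by (auto simp: indicator_def image_iff intro!: bexI[of _ "x / s"])
    have "emeasure \<nu> B = (\<integral>\<^sup>+x. ennreal (indicator B (x / s) * h x) \<partial>lborel)"
      unfolding \<nu>[OF B] by (intro nn_integral_cong) (auto simp: indicator_def)
    also have "\<dots> = ennreal (LINT x|lborel. indicator B (x / s) * h x)"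
    proof (rule nn_integral_eq_integral)
      show "integrable lborel (\<lambda>x. indicator B (x / s) * h x)"
        using B by (intro Bochner_Integration.integrable_bound[OF hint]) (auto simp: indicator_def)
      show "AE x in lborel. 0 \<le> indicator B (x / s) * h x"
        using hnn by (rule eventually_mono) auto
    qed
    finally show ?thesis unfolding im by (simp add: set_lebesgue_integral_def)
  qed
  define F where "F = (\<lambda>J. distr (count_space (crit p J UNIV :: (real^'n::_) set)) borel (\<lambda>x. homf p J x / c))"
  have F: "emeasure (F J) B = cnt (?C J B)" if "B \<in> sets borel" for J B
  proof -
    have e: "(\<lambda>x. homf p J x / c) -` B \<inter> crit p J UNIV = ?C J B"
      using c by (auto simp: crit_def image_iff intro!: bexI[of _ "homf p J _ / c"])
    have "?C J B \<subseteq> crit p J UNIV" by (auto simp: crit_def)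
    then show ?thesis unfolding F_def using that e
      by (subst emeasure_distr) (auto simp: cnt_def emeasure_count_space)
  qed
  have iv: "(\<lambda>b. c * b) ` {a..b} = {c * a..c * b}" for a b
    using c by (simp add: image_mult_atLeastAtMost_if)
  have "\<exists>g\<in>borel_measurable (gam p). (AE J in gam p. emeasure (F J) B = g J) \<and> (\<integral>\<^sup>+J. g J \<partial>gam p) = emeasure \<nu> B"
  proof (rule mean_measure_interval_extend[OF _ _ _ _ _ _ B])
    show "sets (F J) = sets borel" for J by (simp add: F_def)
    show "sets \<nu> = sets borel" by (simp add: \<nu>_def)
    show "(\<lambda>J. emeasure (F J) {a..b}) \<in> borel_measurable (gam p)" for a b
      using cnt_crit_gam_measurable by (simp add: F iv)
    show "(\<integral>\<^sup>+J. emeasure (F J) {a..b} \<partial>gam p) = emeasure \<nu> {a..b}" for a b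
      using Ecrit_interval[OF p G R, of a b] crt_density_nonneg[OF p] mean_spectral_density_nonneg[OF R]
      unfolding Ecrit_def c_def[symmetric] s_def[symmetric]
      by (simp add: F \<nu> h_def ennreal_mult')
    show "AE J in gam p. finite_measure (F J)"
      using AE_finite_crit_UNIV[OF p]
    proof eventually_elim
      case (elim J)
      then show ?case unfolding F_def
        by (intro finite_measure.finite_measure_distr finite_measure_count_space) auto
    qed
    show "finite_measure \<nu>"
      using \<nu>_int[of UNIV] by (intro finite_measureI) (simp add: \<nu>_def)
  qed
  then show ?thesis using \<nu>_int[OF B] F[OF B] by (simp add: c_def h_def)
qed

text \<open>The library's change of variables theorem requires a well-ordered index type for \<open>real ^ 'n\<close>, while the
  index type of the theorem is merely finite. It is replaced by a copy that carries an arbitrary well-order.\<close>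
typedef 'a wo = "UNIV :: 'a set" ..

instance wo :: (finite) finite
proof
  have "surj (Abs_wo :: 'a \<Rightarrow> 'a wo)"
    by (rule type_definition.Abs_image[OF type_definition_wo])
  then show "finite (UNIV :: 'a wo set)" by (metis finite_imageI finite)
qed

instantiation wo :: (finite) wellorder
begin

definition wo_rank :: "'a wo \<Rightarrow> nat" where
  "wo_rank = (SOME f. inj f)"

definition less_eq_wo :: "'a wo \<Rightarrow> 'a wo \<Rightarrow> bool" where
  "x \<le> y \<longleftrightarrow> wo_rank x \<le> wo_rank y"

definition less_wo :: "'a wo \<Rightarrow> 'a wo \<Rightarrow> bool" where
  "x < y \<longleftrightarrow> wo_rank x < wo_rank y"

instance
proof
  have inj: "inj (wo_rank :: 'a wo \<Rightarrow> nat)"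
  proof -
    have "\<exists>f :: 'a wo \<Rightarrow> nat. inj f"
      using finite_imp_inj_to_nat_seg[of "UNIV :: 'a wo set"] by auto
    then show ?thesis unfolding wo_rank_def by (rule someI_ex)
  qed
  fix x y z :: "'a wo"
  show "x < y \<longleftrightarrow> x \<le> y \<and> \<not> y \<le> x" by (auto simp: less_eq_wo_def less_wo_def)
  show "x \<le> x" "x \<le> y \<Longrightarrow> y \<le> z \<Longrightarrow> x \<le> z" "x \<le> y \<or> y \<le> x" by (auto simp: less_eq_wo_def)
  show "x \<le> y \<Longrightarrow> y \<le> x \<Longrightarrow> x = y" using inj by (auto simp: less_eq_wo_def dest: injD)
  show "(\<And>x. (\<And>y. y < x \<Longrightarrow> P y) \<Longrightarrow> P x) \<Longrightarrow> P x" for P :: "'a wo \<Rightarrow> bool" and x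
    by (rule measure_induct_rule[of wo_rank P x]) (simp add: less_wo_def)
qed

end

section \<open>Renaming the indices\<close>

lemma bij_Rep_wo: "bij Rep_wo"
  by (metis Rep_wo_inject Rep_wo_cases UNIV_I bijI injI surjI)

lemma mon_reindex: "mon i (\<chi> a. x $ f a) = mon (map f i) x"
  by (induction i) auto

lemma gmon_reindex:
  assumes "inj f"
  shows "gmon i (\<chi> a. x $ f a) = (\<chi> a. gmon (map f i) x $ f a)"
  using assms
  by (induction i) (auto simp: Finite_Cartesian_Product.vec_eq_iff mon_reindex axis_def inj_eq)

lemma bij_betw_map_lists: "bij f \<Longrightarrow> bij_betw (map f) {i. length i = p} {i. length i = p}"
  by (rule bij_betw_byWitness[of _ "map (inv_into UNIV f)"])
    (auto simp: bij_is_inj bij_is_surj surj_f_inv_f intro!: map_idI)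

text \<open>Renaming the coordinates is an isometry that carries the polynomial and its gradient
  along.\<close>

lemma crit_reindex:
  fixes f :: "'m::finite \<Rightarrow> 'n::finite" and J :: "'n list \<Rightarrow> real"
  assumes f: "bij f"
  shows "cnt (crit p (\<lambda>i. J (map f i)) B) = cnt (crit p J B)"
proof (rule cnt_bij_betw[symmetric])
  let ?L = "\<lambda>x::real^'n. (\<chi> a. x $ f a) :: real^'m" and ?K = "\<lambda>x::real^'m. (\<chi> a. x $ inv_into UNIV f a) :: real^'n"
  have KL: "?K (?L x) = x" and LK: "?L (?K y) = y" for x y
    using f by (auto simp: Finite_Cartesian_Product.vec_eq_iff bij_is_inj bij_is_surj surj_f_inv_f)
  have inj: "?L x = ?L y \<longleftrightarrow> x = y" for x y using KL by metis
  have homf: "homf p (\<lambda>i. J (map f i)) (?L x) = homf p J x" for x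
    unfolding homf_def mon_reindex
    using sum.reindex_bij_betw[OF bij_betw_map_lists[OF f], of "\<lambda>i. J i * mon i x"] .
  have homg: "homg p (\<lambda>i. J (map f i)) (?L x) = ?L (homg p J x)" for x
    unfolding homg_def gmon_reindex[OF bij_is_inj[OF f]]
    using sum.reindex_bij_betw[OF bij_betw_map_lists[OF f], of "\<lambda>i. J i * gmon i x $ _" p]
    by (auto simp: Finite_Cartesian_Product.vec_eq_iff)
  have norm: "norm (?L x) = norm x" for x
    unfolding norm_vec_def L2_set_def using sum.reindex_bij_betw[OF f, of "\<lambda>a. (norm (x $ a))\<^sup>2"] by simp
  have scale: "c *\<^sub>R ?L x = ?L (c *\<^sub>R x)" for c x by (simp add: Finite_Cartesian_Product.vec_eq_iff)
  have L: "?L x \<in> crit p (\<lambda>i. J (map f i)) B \<longleftrightarrow> x \<in> crit p J B" for x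
    by (simp only: crit_def homf homg norm scale inj mem_Collect_eq)
  have K: "?K y \<in> crit p J B \<longleftrightarrow> y \<in> crit p (\<lambda>i. J (map f i)) B" for y
    unfolding L[symmetric] LK ..
  show "bij_betw ?L (crit p J B) (crit p (\<lambda>i. J (map f i)) B)"
  proof (rule bij_betw_byWitness[of _ ?K])
    show "\<forall>x\<in>crit p J B. ?K (?L x) = x" using KL by blast
    show "\<forall>y\<in>crit p (\<lambda>i. J (map f i)) B. ?L (?K y) = y" using LK by blast
    show "?L ` crit p J B \<subseteq> crit p (\<lambda>i. J (map f i)) B" using L by (auto simp only:)
    show "?K ` crit p (\<lambda>i. J (map f i)) B \<subseteq> crit p J B" using K by (auto simp only:)
  qed
qed

lemma crit_cong: "(\<And>i. length i = p \<Longrightarrow> J i = J' i) \<Longrightarrow> crit p J B = crit p J' B"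
proof -
  assume e: "\<And>i. length i = p \<Longrightarrow> J i = J' i"
  have "homf p J = homf p J'" "homg p J = homg p J'"
    unfolding homf_def[abs_def] homg_def[abs_def] using e by (auto simp: fun_eq_iff intro!: sum.cong)
  then show ?thesis by (simp add: crit_def)
qed

text \<open>Independence with standard Gaussian marginals means that the joint law is the product
  measure, and relabelling by a bijection preserves it. This moves statements from the abstract
  probability space to \<open>gam\<close>.\<close>

lemma couplings_law:
  fixes J :: "'n::finite list \<Rightarrow> 'w \<Rightarrow> real" and f :: "'m::finite \<Rightarrow> 'n"
  assumes "prob_space M" and ind: "prob_space.indep_vars M (\<lambda>_. borel) J {i. length i = p}"
    and law: "\<And>i. length i = p \<Longrightarrow> distributed M lborel (J i) std_normal_density"
    and f: "bij f"
  defines "T \<equiv> \<lambda>\<omega>. \<lambda>i\<in>{i. length i = p}. J (map f i) \<omega>"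
  shows "T \<in> measurable M (gam p)" "distr M (gam p) T = gam p"
proof -
  interpret prob_space M by fact
  let ?I = "{i :: 'n list. length i = p}" and ?K = "{i :: 'm list. length i = p}"
  have rv: "J i \<in> borel_measurable M" if "i \<in> ?I" for i
    using distributed_measurable[OF law] that by simp
  have d: "distr M borel (J i) = stdN" if "i \<in> ?I" for i
    using distributed_distr_eq_density[OF law, of i] that
    by (simp add: stdN_def cong: distr_cong)
  have sg: "sets (gam p) = sets (PiM ?K (\<lambda>_. borel))"
    unfolding gam_def by (intro sets_PiM_cong) auto
  have "replicate p undefined \<in> ?I" by simp
  then have "?I \<noteq> {}" by blast
  then have "distr M (PiM ?I (\<lambda>_. borel)) (\<lambda>\<omega>. \<lambda>i\<in>?I. J i \<omega>) = PiM ?I (\<lambda>i. distr M borel (J i))"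
    using ind indep_vars_iff_distr_eq_PiM'[where I = ?I and M' = "\<lambda>_. borel" and X = J] rv by simp
  also have "\<dots> = PiM ?I (\<lambda>_. stdN)" by (intro PiM_cong) (auto simp: d)
  finally have lawI: "distr M (PiM ?I (\<lambda>_. borel)) (\<lambda>\<omega>. \<lambda>i\<in>?I. J i \<omega>) = PiM ?I (\<lambda>_. stdN)" .
  have mf: "inj_on (map f) ?K" "map f \<in> ?K \<rightarrow> ?I"
    using bij_betw_map_lists[OF f, of p] by (auto simp: bij_betw_def)
  show T: "T \<in> measurable M (gam p)"
    unfolding T_def measurable_cong_sets[OF refl sg] by (intro measurable_restrict rv) auto
  let ?t = "\<lambda>\<omega>. \<lambda>i\<in>?K. \<omega> (map f i)"
  have t: "?t \<in> measurable (PiM ?I (\<lambda>_. borel)) (gam p)"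
    unfolding measurable_cong_sets[OF refl sg] by (intro measurable_restrict measurable_component_singleton) auto
  have r: "(\<lambda>\<omega>. \<lambda>i\<in>?I. J i \<omega>) \<in> measurable M (PiM ?I (\<lambda>_. borel))"
    by (intro measurable_restrict rv)
  have "T = ?t \<circ> (\<lambda>\<omega>. \<lambda>i\<in>?I. J i \<omega>)" by (auto simp: T_def fun_eq_iff)
  then have "distr M (gam p) T = distr (PiM ?I (\<lambda>_. stdN)) (gam p) ?t"
    using distr_distr[OF t r] lawI by simp
  also have "\<dots> = gam p"
    using distr_PiM_reindex[OF prob_space_stdN mf] by (simp add: gam_def)
  finally show "distr M (gam p) T = gam p" .
qed

text \<open>Preimages under \<open>f\<close> and \<open>g\<close> differ by a subset of a null set,
  which is measurable in the completion.\<close>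

lemma borel_measurable_completion_AE_eq:
  fixes f g :: "'a \<Rightarrow> ennreal"
  assumes g: "g \<in> borel_measurable M" and ae: "AE x in M. f x = g x"
  shows "f \<in> borel_measurable (completion M)"
proof (rule measurableI)
  fix A :: "ennreal set"
  assume A: "A \<in> sets borel"
  have "g -` A \<inter> space M \<in> sets (completion M)"
    using measurable_sets[OF g A] by auto
  moreover have "AE x in completion M. x \<in> g -` A \<inter> space M \<longleftrightarrow> x \<in> f -` A \<inter> space (completion M)"
    using AE_completion[OF ae] by (rule eventually_mono) auto
  ultimately show "f -` A \<inter> space (completion M) \<in> sets (completion M)"
    using completion.in_sets_AE[of "g -` A \<inter> space M" "f -` A \<inter> space (completion M)" M] by auto
qed auto

theorem theorem2p2:
  fixes N p :: nat
    and M :: "'w measure" and J :: "'n::finite list \<Rightarrow> 'w \<Rightarrow> real"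
    and Q :: "'b measure" and W :: "'b \<Rightarrow> real mat" and \<rho> :: "real \<Rightarrow> real"
    and B :: "real set"
  assumes "N = CARD('n)" and "p \<ge> 2"
    and "prob_space M"
    and "prob_space.indep_vars M (\<lambda>_. borel) J {i. length i = p}"
    and "\<And>i. length i = p \<Longrightarrow> distributed M lborel (J i) std_normal_density"
    and "GOE N Q W" and "mean_spectral_density N Q W \<rho>"
    and "B \<in> sets borel"
  shows "(\<lambda>\<omega>. Crt p (\<lambda>i. J i \<omega>) B) \<in> borel_measurable (completion M) \<and>
    (\<integral>\<^sup>+ \<omega>. Crt p (\<lambda>i. J i \<omega>) B \<partial>M) =
      ennreal (2 * real N * sqrt (2 / real p) * (real p - 1) powr (real N / 2) *
        (LINT x : (\<lambda>x. sqrt (real p / (2 * (real p - 1))) * x) ` B | lborel.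
           exp (- (real N * (real p - 2) * x\<^sup>2 / (2 * real p))) * \<rho> x))"
proof -
  define T where "T = (\<lambda>\<omega>. \<lambda>i\<in>{i :: 'n wo list. length i = p}. J (map Rep_wo i) \<omega>)"
  have T: "T \<in> measurable M (gam p)" "distr M (gam p) T = gam p"
    using couplings_law[OF assms(3-5) bij_Rep_wo] by (simp_all add: T_def)
  have card: "CARD('n wo) = N" using bij_betw_same_card[OF bij_Rep_wo] assms(1) by simp
  let ?B = "(\<lambda>b. sqrt (real N) * b) ` B"
  obtain g where g: "g \<in> borel_measurable (gam p)"
    and ae: "AE J in gam p. cnt (crit p J ?B :: (real^('n wo)) set) = g J"
    and int: "(\<integral>\<^sup>+J. g J \<partial>gam p) =
      ennreal (LINT x : (\<lambda>x. sqrt (real p / (2 * (real p - 1))) * x) ` B | lborel. crt_density N p x * \<rho> x)"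
    using cnt_crit_gam_Borel[where 'n = "'n wo" and p = p and Q = Q and W = W and \<rho> = \<rho> and B = B] assms
    unfolding card by auto
  have Crt: "Crt p (\<lambda>i. J i \<omega>) B = cnt (crit p (T \<omega>) ?B)" for \<omega>
  proof -
    have "crit p (T \<omega>) ?B = crit p (\<lambda>i. J (map Rep_wo i) \<omega>) ?B"
      by (rule crit_cong) (simp add: T_def)
    then show ?thesis
      using assms(1,2) crit_reindex[OF bij_Rep_wo, of p "\<lambda>i. J i \<omega>"] by (simp add: Crt_eq_cnt_crit)
  qed
  have "AE J in distr M (gam p) T. cnt (crit p J ?B) = g J"
    unfolding T(2) by (rule ae)
  \<comment> \<open>For a general Borel set the count is known to agree with a measurable function
    almost surely, hence the completion in the statement.\<close>
  then have aeM: "AE \<omega> in M. Crt p (\<lambda>i. J i \<omega>) B = g (T \<omega>)"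
    unfolding Crt by (rule AE_distrD[OF T(1), rotated])
  have "(\<integral>\<^sup>+\<omega>. Crt p (\<lambda>i. J i \<omega>) B \<partial>M) = (\<integral>\<^sup>+\<omega>. g (T \<omega>) \<partial>M)"
    by (rule nn_integral_cong_AE[OF aeM])
  also have "\<dots> = (\<integral>\<^sup>+J. g J \<partial>gam p)"
    using nn_integral_distr[OF T(1), of g] g T(2) by simp
  finally show ?thesis
    using borel_measurable_completion_AE_eq[OF measurable_compose[OF T(1) g] aeM]
    by (simp add: int crt_density_def mult.assoc)
qed

end
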